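(* Fix $T\in\mathbb{N}$. Let $F:\mathbb{T}\to\mathbb{T}$ be continuous, $h\in C^3(\mathbb{T}\times\mathbb{T})$, and $\kappa,K>0$. There exist constants $\Delta_0>0$ and $C>0$, depending only on $\|h\|_{C^3},\kappa$ and $K$, such that the following holds whenever $0<\Delta<\Delta_0$. Let $\bar\rho_t$, $t=0,1,\dots,T$, be a solution of $\bar\rho_{t+1}=(F_{\bar\rho_t})_*\bar\rho_t$ consisting of $C^2$ probability densities with $\bar\rho_t\geq\kappa$ and $\|\bar\rho_t\|_{C^2}\leq K$ for $t=0,1,\dots,T$. Let $\rho_{N,t}$ be the distribution on $\mathbb{T}^N$ of $X(t)=(x_1(t),\dots,x_N(t))$, where $$x_i(t+1)=F\Big(x_i(t)+\frac{\Delta}{N}\sum_{j=1}^N h(x_i(t),x_j(t))\Big),\quad i=1,\dots,N,$$ and let $\mathcal{H}_N(t):=\frac1N H(\rho_{N,t}\,|\,\bar\rho_t^{\otimes N})$. Then $$\mathcal{H}_N(t)\leq e^{Ct}\Big(\mathcal{H}_N(0)+\frac1N\Big),\qquad t=0,1,\dots,T.$$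
   Context: $\mathbb{T}=\mathbb{R}/\mathbb{Z}$; $\mathcal{P}(\mathbb{T})$ is the set of Borel probability measures on $\mathbb{T}$; $h$ is real-valued and sums $x+(\text{real number})$ with $x\in\mathbb{T}$ are taken modulo $1$. For $\mu\in\mathcal{P}(\mathbb{T})$, $\phi_\mu(x):=x+\Delta\int_{\mathbb{T}}h(x,y)\,d\mu(y)$ and $F_\mu:=F\circ\phi_\mu$. $G_*\mu$ is the push-forward of $\mu$ under $G$. The same symbol denotes an absolutely continuous measure and its density. The relative entropy is $H(\mu|\nu)=\int\frac{d\mu}{d\nu}\log\frac{d\mu}{d\nu}\,d\nu$ if $\mu\ll\nu$ and $+\infty$ otherwise. The initial law $\rho_{N,0}$ is arbitrary (the bound is trivial if $\mathcal{H}_N(0)=\infty$), and the constants do not depend on $N$. *)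

theory Defs
  imports "HOL-Probability.Probability"
begin

section \<open>The circle \<open>\<real>/\<int>\<close>\<close>

quotient_type circle = real / "\<lambda>x y. x - y \<in> \<int>"
  morphisms rep_circle to_circle
proof (rule equivpI)
  show "reflp (\<lambda>x y :: real. x - y \<in> \<int>)"
    by (auto intro: reflpI)
  show "symp (\<lambda>x y :: real. x - y \<in> \<int>)"
  proof (rule sympI)
    show "y - x \<in> \<int>" if "x - y \<in> \<int>" for x y :: real
      using Ints_minus[OF that] by simp
  qed
  show "transp (\<lambda>x y :: real. x - y \<in> \<int>)"
  proof (rule transpI)
    show "x - z \<in> \<int>" if "x - y \<in> \<int>" "y - z \<in> \<int>" for x y z :: real
      using Ints_add[OF that] by simp
  qed
qed

instantiation circle :: topological_space
begin

definition open_circle :: "circle set \<Rightarrow> bool"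
  where "open_circle U \<longleftrightarrow> open (to_circle -` U)"

instance
proof
  show "open (UNIV :: circle set)"
    by (simp add: open_circle_def)
  show "open (U \<inter> V)" if "open U" "open V" for U V :: "circle set"
    using that by (simp add: open_circle_def open_Int)
  show "open (\<Union>\<U>)" if "\<forall>U\<in>\<U>. open U" for \<U> :: "circle set set"
    using that by (simp add: open_circle_def vimage_Union open_UN)
qed

end

lift_definition translate :: "circle \<Rightarrow> real \<Rightarrow> circle"  (infixl "\<oplus>" 65)
  is "(+)"
  by simp

definition circle_lebesgue :: "circle measure" where
  "circle_lebesgue = distr (restrict_space lborel {0..<1}) borel to_circle"

definition measure_of_density :: "(circle \<Rightarrow> real) \<Rightarrow> circle measure" where
  "measure_of_density \<rho> = density circle_lebesgue (\<lambda>x. ennreal (\<rho> x))"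


section \<open>The spaces \<open>C\<^sup>k\<close>\<close>

definition partial_deriv :: "'a \<Rightarrow> ('a::euclidean_space \<Rightarrow> real) \<Rightarrow> 'a \<Rightarrow> real" where
  "partial_deriv b f x = deriv (\<lambda>s. f (x + s *\<^sub>R b)) 0"

primrec C_diff :: "nat \<Rightarrow> ('a::euclidean_space \<Rightarrow> real) \<Rightarrow> bool" where
  "C_diff 0 f \<longleftrightarrow> continuous_on UNIV f"
| "C_diff (Suc k) f \<longleftrightarrow> continuous_on UNIV f \<and>
     (\<forall>b\<in>Basis. (\<forall>x. (\<lambda>s. f (x + s *\<^sub>R b)) differentiable (at (0::real))) \<and>
                C_diff k (partial_deriv b f))"

text \<open>
  The maximum of the sup norms of all iterated partial derivatives of order at most \<open>k\<close>.
  The supremum is taken in the reals, so this is meaningful only when these derivatives are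
  bounded, as they are for the periodic \<open>C\<^sup>k\<close> functions below.
\<close>
primrec C_norm :: "nat \<Rightarrow> ('a::euclidean_space \<Rightarrow> real) \<Rightarrow> real" where
  "C_norm 0 f = (SUP x. \<bar>f x\<bar>)"
| "C_norm (Suc k) f =
     Max (insert (SUP x. \<bar>f x\<bar>) ((\<lambda>b. C_norm k (partial_deriv b f)) ` Basis))"

text \<open>
  Differentiability and \<open>C\<^sup>k\<close> norms of functions on the circle and on the 2-torus are those of
  their periodic lifts to \<open>\<real>\<close> and \<open>\<real>\<^sup>2\<close>.
\<close>
definition lift1 :: "(circle \<Rightarrow> real) \<Rightarrow> real \<Rightarrow> real" where
  "lift1 f s = f (to_circle s)"

definition lift2 :: "(circle \<Rightarrow> circle \<Rightarrow> real) \<Rightarrow> real \<times> real \<Rightarrow> real" where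
  "lift2 h p = h (to_circle (fst p)) (to_circle (snd p))"


section \<open>Relative entropy\<close>

text \<open>
  With \<open>u = d\<mu>/d\<nu>\<close>, the integral of \<open>u log u\<close> may be \<open>+\<infinity>\<close> although \<open>\<mu> \<lless> \<nu>\<close>, and the
  Bochner integral (hence the library's \<open>KL_divergence\<close>) would return \<open>0\<close> in that case. So the
  integral is taken as the difference of the integrals of the positive and the negative part;
  the latter is at most \<open>1/e\<close> for a probability measure \<open>\<nu>\<close>.
  Note \<open>0 * ln 0 = 0\<close>, and that in both \<open>absolutely_continuous\<close> and \<open>RN_deriv\<close> the reference
  measure is the first argument.
\<close>
definition rel_entropy :: "'a measure \<Rightarrow> 'a measure \<Rightarrow> ereal" where
  "rel_entropy \<mu> \<nu> =
     (if absolutely_continuous \<nu> \<mu> then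
        (let u = (\<lambda>x. enn2real (RN_deriv \<nu> \<mu> x)) in
           enn2ereal (\<integral>\<^sup>+x. ennreal (u x * ln (u x)) \<partial>\<nu>) -
           enn2ereal (\<integral>\<^sup>+x. ennreal (- (u x * ln (u x))) \<partial>\<nu>))
      else \<infinity>)"


section \<open>Mean-field dynamics and particle system\<close>

definition mf_shift ::
  "(circle \<Rightarrow> circle \<Rightarrow> real) \<Rightarrow> real \<Rightarrow> circle measure \<Rightarrow> circle \<Rightarrow> circle" where
  "mf_shift h \<Delta> \<mu> x = x \<oplus> \<Delta> * (\<integral>y. h x y \<partial>\<mu>)"

definition mf_map ::
  "(circle \<Rightarrow> circle) \<Rightarrow> (circle \<Rightarrow> circle \<Rightarrow> real) \<Rightarrow> real \<Rightarrow> circle measure \<Rightarrow> circle \<Rightarrow> circle"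
where
  "mf_map F h \<Delta> \<mu> = F \<circ> mf_shift h \<Delta> \<mu>"

text \<open>
  The \<open>N\<close>-torus consists of the extensional functions on \<open>{..<N}\<close>, so the particles are
  numbered \<open>0, \<dots>, N - 1\<close>. Since the circle is second countable, the product
  \<open>\<sigma>\<close>-algebra is the Borel \<open>\<sigma>\<close>-algebra.
\<close>
abbreviation torus_borel :: "nat \<Rightarrow> (nat \<Rightarrow> circle) measure" where
  "torus_borel N \<equiv> Pi\<^sub>M {..<N} (\<lambda>_. borel)"

primrec particles ::
  "(circle \<Rightarrow> circle) \<Rightarrow> (circle \<Rightarrow> circle \<Rightarrow> real) \<Rightarrow> real \<Rightarrow> nat \<Rightarrow> nat \<Rightarrow>
   (nat \<Rightarrow> circle) \<Rightarrow> (nat \<Rightarrow> circle)" where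
  "particles F h \<Delta> N 0 x = x"
| "particles F h \<Delta> N (Suc t) x =
     (let X = particles F h \<Delta> N t x in
       (\<lambda>i\<in>{..<N}. F (X i \<oplus> \<Delta> / real N * (\<Sum>j<N. h (X i) (X j)))))"

text \<open>
  The dynamics being deterministic, the \<open>N\<close>-torus with the initial law \<open>\<rho>\<^sub>0\<close> serves as the
  underlying probability space, with \<open>X(0)\<close> the identity.
\<close>
definition particle_law ::
  "(circle \<Rightarrow> circle) \<Rightarrow> (circle \<Rightarrow> circle \<Rightarrow> real) \<Rightarrow> real \<Rightarrow> nat \<Rightarrow>
   (nat \<Rightarrow> circle) measure \<Rightarrow> nat \<Rightarrow> (nat \<Rightarrow> circle) measure" where
  "particle_law F h \<Delta> N \<rho>\<^sub>0 t = distr \<rho>\<^sub>0 (torus_borel N) (particles F h \<Delta> N t)"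

definition scaled_entropy :: "nat \<Rightarrow> (nat \<Rightarrow> circle) measure \<Rightarrow> circle measure \<Rightarrow> ereal" where
  "scaled_entropy N \<mu> \<nu> = ereal (1 / real N) * rel_entropy \<mu> (Pi\<^sub>M {..<N} (\<lambda>_. \<nu>))"

end

theory Submission
  imports Defs
begin

text \<open>
  Let \<open>\<phi>\<close> be the mean-field shift at a given time. In the coordinates given by \<open>\<phi>\<close> the particle
  step is a map \<open>x \<mapsto> x + w x\<close> of the torus close to the identity, followed by the product map
  \<open>F \<circ> \<phi>\<close>, which carries the current product measure to the next one. By the
  Donsker--Varadhan formula the entropy after the step is at most the entropy before it plus the
  mean of any function \<open>b\<close> such that \<open>exp (- b)\<close> times the product measure is transported by
  \<open>x + w x\<close> to a measure below the product measure. The Jacobian of \<open>x + w x\<close> is bounded below by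
  the product of its diagonal entries up to a constant factor, by substituting one coordinate at
  a time. Expanding to second order, with the interaction errors written, by
  partial integration, as integrals over \<open>t\<close> of the derivative of \<open>h\<close> in its second argument
  against the centered empirical distribution function, one may take \<open>b\<close> to be
  a constant plus a constant times an integral over \<open>t\<close> of squares of normalised sums of
  independent centered bounded variables; the first-order term is centered because it is the
  derivative of a periodic function divided by the density. Such squares have uniformly bounded
  exponential moments, and the mean of \<open>b\<close> is then bounded by the entropy by
  Donsker--Varadhan once more.
\<close>

section \<open>Coordinates on the circle\<close>

text \<open>The obstacle is uniformity in \<open>N\<close>. The logarithm of the Jacobian times the
  ratio of densities is a sum of \<open>N\<close> terms that must stay of order one, so each
  particle may lose only \<open>O(1/N)\<close>; this shapes the Jacobian inequality and the
  treatment of the self-interaction. The first-order part is \<open>1/N\<close> times a double sum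
  over pairs of particles. It is of order one only because its kernel has mean zero in each of its
  two arguments: in the second by subtraction of the mean field, in the first by the divergence
  structure. The variable \<open>t\<close> exists to separate these arguments. For fixed
  \<open>t\<close> the double sum is a product of two sums of independent variables, so that
  Hoeffding's lemma takes the place of a combinatorial estimate for pair interactions. As
  \<open>F\<close> is merely continuous, it offers no Jacobian and no inverse. Bounded test
  functions are used instead of densities, because \<open>F\<close> acts in the same way on the
  particles and on the reference law and can be absorbed into the test function.\<close>

lemma to_circle_eq_iff: "to_circle x = to_circle y \<longleftrightarrow> x - y \<in> \<int>"
  by (rule circle.abs_eq_iff)

lemma translate_to_circle [simp]: "to_circle x \<oplus> s = to_circle (x + s)"
  by (rule translate.abs_eq)

lemma to_circle_add_1 [simp]: "to_circle (x + 1) = to_circle x"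
  by (simp add: to_circle_eq_iff)

text \<open>\<open>rep_circle\<close> chooses an arbitrary real representative; \<open>frac\<close>
  normalises it to \<open>[0, 1)\<close>.\<close>

definition circle_coord :: "circle \<Rightarrow> real" where
  "circle_coord x = frac (rep_circle x)"

lemma to_circle_coord [simp]: "to_circle (circle_coord x) = x"
proof -
  have "to_circle (frac (rep_circle x)) = to_circle (rep_circle x)"
    by (auto simp: to_circle_eq_iff frac_def)
  then show ?thesis
    using Quotient3_abs_rep[OF Quotient3_circle, of x] by (simp add: circle_coord_def)
qed

lemma circle_coord_ge_0 [simp]: "0 \<le> circle_coord x"
  and circle_coord_lt_1 [simp]: "circle_coord x < 1"
  by (simp_all add: circle_coord_def frac_lt_1)

lemma circle_coord_to_circle: "circle_coord (to_circle s) = frac s"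
proof -
  have "circle_coord (to_circle s) - s \<in> \<int>"
    using to_circle_coord[of "to_circle s"] by (simp only: to_circle_eq_iff)
  then obtain n where n: "circle_coord (to_circle s) = s + of_int n"
    by (metis Ints_cases add.commute diff_add_cancel)
  have "frac (circle_coord (to_circle s)) = frac s"
    unfolding n by (simp add: frac_def)
  then show ?thesis
    using frac_eq[of "circle_coord (to_circle s)"] by simp
qed

lemma translate_0 [simp]: "x \<oplus> 0 = x"
  by (metis to_circle_coord translate_to_circle add.right_neutral)

lemma translate_translate [simp]: "x \<oplus> s \<oplus> t = x \<oplus> (s + t)"
  by (metis to_circle_coord translate_to_circle add.assoc)

lemma continuous_to_circle: "continuous_on UNIV to_circle"
  by (simp add: continuous_on_open_vimage open_circle_def)

lemma measurable_to_circle [measurable]: "to_circle \<in> borel \<rightarrow>\<^sub>M borel"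
  by (rule borel_measurable_continuous_onI[OF continuous_to_circle])

text \<open>The coordinate jumps at \<open>to_circle 0\<close>, so continuity is no argument. A
  proper nonempty sublevel set is an open arc together with this point.\<close>

lemma measurable_circle_coord [measurable]: "circle_coord \<in> borel_measurable borel"
proof (rule borel_measurableI_less)
  fix a :: real
  have "{x. circle_coord x < a} =
      (if a \<le> 0 then {} else if a > 1 then UNIV else insert (to_circle 0) (to_circle ` {0<..<a}))"
  proof -
    have "x \<in> insert (to_circle 0) (to_circle ` {0<..<a})" if "circle_coord x < a" for x
    proof (cases "circle_coord x = 0")
      case True
      then show ?thesis by (metis insertI1 to_circle_coord)
    next
      case False
      then have "circle_coord x \<in> {0<..<a}"
        using that circle_coord_ge_0[of x] by (simp add: less_le)
      then show ?thesis by (metis image_eqI insertCI to_circle_coord)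
    qed
    moreover have "circle_coord (to_circle s) < a" if "0 < s" "s < a" "a \<le> 1" for s
      using that frac_eq[of s] by (simp add: circle_coord_to_circle)
    moreover have "circle_coord x < a" if "a > 1" for x
      using circle_coord_lt_1[of x] that by linarith
    moreover have "\<not> circle_coord x < a" if "a \<le> 0" for x
      using circle_coord_ge_0[of x] that by linarith
    ultimately show ?thesis
      by (auto simp: circle_coord_to_circle)
  qed
  moreover have "to_circle ` {0<..<a} \<in> sets borel"
  proof (rule borel_open)
    have "to_circle -` (to_circle ` {0<..<a}) = (\<Union>n::int. (\<lambda>s. s + of_int n) ` {0<..<a})"
    proof (intro set_eqI iffI)
      fix x assume "x \<in> to_circle -` (to_circle ` {0<..<a})"
      then obtain s n where "s \<in> {0<..<a}" "x - s = of_int n"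
        by (auto simp: to_circle_eq_iff elim!: Ints_cases)
      then show "x \<in> (\<Union>n::int. (\<lambda>s. s + of_int n) ` {0<..<a})"
        by (intro UN_I[of n] image_eqI[of _ _ s]) auto
    next
      fix x assume "x \<in> (\<Union>n::int. (\<lambda>s. s + of_int n) ` {0<..<a})"
      then obtain s n where "s \<in> {0<..<a}" "x = s + of_int n" by auto
      then show "x \<in> to_circle -` (to_circle ` {0<..<a})"
        by (auto simp: to_circle_eq_iff intro!: image_eqI[of _ _ s])
    qed
    moreover have "open ((\<lambda>s. s + of_int n) ` {0<..<a})" for n
      using open_translation[OF open_greaterThanLessThan, of "of_int n :: real" 0 a]
      by (simp only: add.commute)
    ultimately show "open (to_circle ` {0<..<a})"
      by (simp add: open_circle_def open_UN)
  qed
  moreover have "{to_circle 0} \<in> sets borel"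
  proof (rule borel_closed)
    have "to_circle -` (- {to_circle 0}) = - \<int>"
      by (auto simp: to_circle_eq_iff)
    then show "closed {to_circle 0}"
      using closed_Ints[where ?'a = real] unfolding closed_def open_circle_def by metis
  qed
  ultimately show "{x \<in> space borel. circle_coord x < a} \<in> sets borel"
    by (auto intro: sets.insert_in_sets)
qed

lemma measurable_translate [measurable (raw)]:
  assumes "f \<in> M \<rightarrow>\<^sub>M borel" and "g \<in> borel_measurable M"
  shows "(\<lambda>x. f x \<oplus> g x) \<in> M \<rightarrow>\<^sub>M borel"
proof -
  have "f x \<oplus> g x = to_circle (circle_coord (f x) + g x)" for x
    by (metis to_circle_coord translate_to_circle)
  with assms show ?thesis by simp
qed

lemma space_circle_lebesgue [simp]: "space circle_lebesgue = UNIV"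
  and sets_circle_lebesgue [measurable_cong, simp]: "sets circle_lebesgue = sets borel"
  by (simp_all add: circle_lebesgue_def)

lemma measurable_to_circle' [measurable]:
  "to_circle \<in> restrict_space lborel A \<rightarrow>\<^sub>M borel"
  by (rule measurable_restrict_space1) simp

lemma prob_space_circle_lebesgue: "prob_space circle_lebesgue"
  unfolding circle_lebesgue_def
  by (rule prob_space.prob_space_distr) (auto intro!: prob_spaceI simp: emeasure_restrict_space)

interpretation circle_lebesgue: prob_space circle_lebesgue
  by (rule prob_space_circle_lebesgue)

lemma nn_integral_circle_lebesgue:
  assumes [measurable]: "f \<in> borel_measurable borel"
  shows "(\<integral>\<^sup>+y. f y \<partial>circle_lebesgue) = (\<integral>\<^sup>+s. f (to_circle s) * indicator {0..<1} s \<partial>lborel)"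
  unfolding circle_lebesgue_def
  by (simp add: nn_integral_distr nn_integral_restrict_space)

lemma integral_circle_lebesgue:
  fixes f :: "circle \<Rightarrow> real"
  assumes [measurable]: "f \<in> borel_measurable borel"
  shows "(\<integral>y. f y \<partial>circle_lebesgue) = (\<integral>s. f (to_circle s) * indicator {0..<1} s \<partial>lborel)"
  unfolding circle_lebesgue_def
  by (simp add: integral_distr integral_restrict_space mult.commute)

text \<open>The window is cut at the integer \<open>n\<close> above \<open>a\<close>, and the part
  beyond \<open>n\<close> is moved back by one period.\<close>

lemma nn_integral_circle_period:
  assumes [measurable]: "f \<in> borel_measurable borel"
  shows "(\<integral>\<^sup>+s. f (to_circle s) * indicator {a..<a+1} s \<partial>lborel) = (\<integral>\<^sup>+y. f y \<partial>circle_lebesgue)"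
proof -
  define n where "n = (of_int \<lceil>a\<rceil> :: real)"
  have n: "n - 1 < a" "a \<le> n" "n \<in> \<int>"
    unfolding n_def by linarith+ (simp add: n_def)
  have shift: "(\<integral>\<^sup>+s. f (to_circle s) * indicator {b+z..<c+z} s \<partial>lborel) =
      (\<integral>\<^sup>+s. f (to_circle s) * indicator {b..<c} s \<partial>lborel)" if "z \<in> \<int>" for b c z :: real
  proof -
    have "(\<integral>\<^sup>+s. f (to_circle s) * indicator {b+z..<c+z} s \<partial>lborel) =
      (\<integral>\<^sup>+s. f (to_circle (z + 1 * s)) * indicator {b+z..<c+z} (z + 1 * s) \<partial>lborel)"
      by (subst nn_integral_real_affine[where c=1 and t=z]) auto
    also have "\<dots> = (\<integral>\<^sup>+s. f (to_circle s) * indicator {b..<c} s \<partial>lborel)"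
      using that by (intro nn_integral_cong)
        (auto simp: indicator_def to_circle_eq_iff intro!: arg_cong[where f=f])
    finally show ?thesis .
  qed
  have split: "(\<integral>\<^sup>+s. f (to_circle s) * indicator {b..<d} s \<partial>lborel) =
     (\<integral>\<^sup>+s. f (to_circle s) * indicator {b..<c} s \<partial>lborel) +
     (\<integral>\<^sup>+s. f (to_circle s) * indicator {c..<d} s \<partial>lborel)" if "b \<le> c" "c \<le> d" for b c d :: real
    using that by (subst nn_integral_add[symmetric])
      (auto intro!: nn_integral_cong simp: indicator_def)
  have "(\<integral>\<^sup>+s. f (to_circle s) * indicator {a..<a+1} s \<partial>lborel) =
     (\<integral>\<^sup>+s. f (to_circle s) * indicator {a..<n} s \<partial>lborel) +
     (\<integral>\<^sup>+s. f (to_circle s) * indicator {n..<a+1} s \<partial>lborel)"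
    using n by (intro split) auto
  also have "(\<integral>\<^sup>+s. f (to_circle s) * indicator {n..<a+1} s \<partial>lborel) =
     (\<integral>\<^sup>+s. f (to_circle s) * indicator {n-1..<a} s \<partial>lborel)"
    using shift[of 1 "n-1" a] by simp
  also have "(\<integral>\<^sup>+s. f (to_circle s) * indicator {a..<n} s \<partial>lborel) + \<dots> =
     (\<integral>\<^sup>+s. f (to_circle s) * indicator {n-1..<n} s \<partial>lborel)"
    using split[of "n-1" a n] n by (simp add: add.commute)
  also have "\<dots> = (\<integral>\<^sup>+s. f (to_circle s) * indicator {0..<1} s \<partial>lborel)"
    using shift[of "n-1" 0 1] n by simp
  finally show ?thesis by (simp add: nn_integral_circle_lebesgue)
qed

section \<open>A one-dimensional substitution inequality\<close>

text \<open>
  The averages of \<open>\<tau>\<close> over short intervals are continuously differentiable, with derivative a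
  difference quotient of \<open>\<tau>\<close>. For open sets the substitution rule for these averages passes to
  the limit by Fatou's lemma, and outer regularity extends the inequality to Borel sets.
\<close>
lemma emeasure_open_substitution_ineq:
  fixes \<tau> \<delta> :: "real \<Rightarrow> real"
  assumes cont: "continuous_on UNIV \<tau>" and mono: "\<And>s t. s \<le> t \<Longrightarrow> \<tau> s \<le> \<tau> t"
    and \<delta> [measurable]: "\<delta> \<in> borel_measurable borel"
    and inc: "\<And>s \<eta>. 0 \<le> \<eta> \<Longrightarrow> \<tau> (s + \<eta>) - \<tau> s \<ge> \<eta> * \<delta> s - C * \<eta>\<^sup>2"
    and U: "open U"
  shows "(\<integral>\<^sup>+s. ennreal (\<delta> s) * indicator U (\<tau> s) * indicator {0..1} s \<partial>lborel) \<le> emeasure lborel U"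
proof -
  have [measurable]: "\<tau> \<in> borel_measurable borel"
    by (rule borel_measurable_continuous_onI[OF cont])
  have [measurable]: "U \<in> sets borel" using U by simp
  \<comment> \<open>For each sign of \<open>x\<close> one of the two intervals is empty or a point,
    so \<open>P\<close> is the primitive of \<open>\<tau>\<close> that vanishes at
    \<open>0\<close>.\<close>
  define P where "P x = integral {0..x} \<tau> - integral {x..0} \<tau>" for x
  have dP: "(P has_real_derivative \<tau> x) (at x)" for x
  proof -
    obtain a where a: "a < x" "a < 0" by (rule that[of "min x 0 - 1"]) auto
    have I: "\<tau> integrable_on {u..v}" for u v
      by (rule integrable_continuous_real[OF continuous_on_subset[OF cont]]) simp
    have eq: "P y = integral {a..y} \<tau> - integral {a..0} \<tau>" if "a \<le> y" for y
    proof (cases "y \<le> 0")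
      case True
      then show ?thesis
        using Henstock_Kurzweil_Integration.integral_combine[OF that True I] that
        by (cases "y = 0") (auto simp: P_def)
    next
      case False
      then show ?thesis
        using Henstock_Kurzweil_Integration.integral_combine[of a 0 y \<tau>, OF _ _ I] a by (simp add: P_def)
    qed
    have "((\<lambda>y. integral {a..y} \<tau>) has_real_derivative \<tau> x) (at x within {a..x+1})"
      by (rule integral_has_real_derivative) (use a continuous_on_subset[OF cont] in auto)
    then have "((\<lambda>y. integral {a..y} \<tau>) has_real_derivative \<tau> x) (at x)"
      using a at_within_Icc_at[of a x "x+1"] by simp
    then have "((\<lambda>y. integral {a..y} \<tau> - integral {a..0} \<tau>) has_real_derivative \<tau> x) (at x)"
      by (auto intro!: derivative_eq_intros)
    then show ?thesis
      by (rule has_field_derivative_transform_within_open[where S="{a<..}"]) (use a eq in auto)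
  qed
  define \<tau>' where "\<tau>' \<eta> s = (P (s + \<eta>) - P s) / \<eta>" for \<eta> s
  define q where "q \<eta> s = (\<tau> (s + \<eta>) - \<tau> s) / \<eta>" for \<eta> s
  have ineq: "(\<integral>\<^sup>+s. ennreal (\<delta> s - C * \<eta>) * indicator U (\<tau>' \<eta> s) * indicator {0..1} s \<partial>lborel)
     \<le> emeasure lborel U" if \<eta>: "0 < \<eta>" for \<eta>
  proof -
    have d: "(\<tau>' \<eta> has_real_derivative q \<eta> s) (at s)" for s
      unfolding \<tau>'_def q_def using \<eta>
      by (auto intro!: derivative_eq_intros DERIV_chain2[OF dP] dP)
    have q: "q \<eta> s \<ge> 0" "\<delta> s - C * \<eta> \<le> q \<eta> s" for s
      using mono[of s "s+\<eta>"] inc[of \<eta> s] \<eta>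
      by (auto simp: q_def field_simps power2_eq_square)
    have "(\<integral>\<^sup>+s. ennreal (\<delta> s - C * \<eta>) * indicator U (\<tau>' \<eta> s) * indicator {0..1} s \<partial>lborel)
      \<le> (\<integral>\<^sup>+s. ennreal (indicator U (\<tau>' \<eta> s) * q \<eta> s * indicator {0..1} s) \<partial>lborel)"
      using q by (intro nn_integral_mono) (auto simp: indicator_def ennreal_leI)
    also have "\<dots> = (\<integral>\<^sup>+s. ennreal (indicator U s * indicator {\<tau>' \<eta> 0..\<tau>' \<eta> 1} s) \<partial>lborel)"
      using q(1) d cont \<eta>
      by (intro nn_integral_substitution[symmetric])
        (auto simp: q_def[abs_def] set_borel_measurable_def  intro!: continuous_intros
           intro: continuous_on_subset[OF cont] continuous_on_compose2[OF cont])
    also have "\<dots> \<le> (\<integral>\<^sup>+s. indicator U s \<partial>lborel)"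
      by (intro nn_integral_mono) (auto simp: indicator_def)
    finally show ?thesis by simp
  qed
  define \<eta> :: "nat \<Rightarrow> real" where "\<eta> n = inverse (real (Suc n))" for n
  have \<eta>: "\<eta> n > 0" "\<eta> \<longlonglongrightarrow> 0" for n
    unfolding \<eta>_def using LIMSEQ_inverse_real_of_nat by auto
  have lim: "(\<lambda>n. \<tau>' (\<eta> n) s) \<longlonglongrightarrow> \<tau> s" for s
  proof -
    have "((\<lambda>h. (P (s + h) - P s) / h) \<longlongrightarrow> \<tau> s) (at 0)"
      using dP[of s] by (simp add: DERIV_def)
    moreover have "filterlim \<eta> (at 0) sequentially"
      using \<eta> by (auto simp: filterlim_at intro!: always_eventually less_imp_neq[symmetric])
    ultimately show ?thesis
      unfolding \<tau>'_def by (rule filterlim_compose)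
  qed
  have [measurable]: "\<tau>' c \<in> borel_measurable borel" for c
  proof -
    have "continuous_on UNIV P"
      using dP by (meson DERIV_isCont continuous_at_imp_continuous_on)
    then have [measurable]: "P \<in> borel_measurable borel"
      by (rule borel_measurable_continuous_onI)
    show ?thesis unfolding \<tau>'_def by measurable
  qed
  have "(\<integral>\<^sup>+s. ennreal (\<delta> s) * indicator U (\<tau> s) * indicator {0..1} s \<partial>lborel)
    \<le> (\<integral>\<^sup>+s. liminf (\<lambda>n. ennreal (\<delta> s - C * \<eta> n) * indicator U (\<tau>' (\<eta> n) s) * indicator {0..1} s) \<partial>lborel)"
  proof (rule nn_integral_mono)
    fix s :: real
    show "ennreal (\<delta> s) * indicator U (\<tau> s) * indicator {0..1} s \<le>
       liminf (\<lambda>n. ennreal (\<delta> s - C * \<eta> n) * indicator U (\<tau>' (\<eta> n) s) * indicator {0..1} s)"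
    proof (cases "\<tau> s \<in> U \<and> s \<in> {0..1}")
      case True
      have "(\<lambda>n. ennreal (\<delta> s - C * \<eta> n)) \<longlonglongrightarrow> ennreal (\<delta> s - C * 0)"
        by (intro tendsto_intros \<eta>)
      \<comment> \<open>Openness of \<open>U\<close>: if the limit lies in \<open>U\<close>, so do
        the averages eventually. This is the direction that Fatou's lemma needs.\<close>
      moreover have "\<forall>\<^sub>F n in sequentially. \<tau>' (\<eta> n) s \<in> U"
        using lim[of s] U True by (auto simp: topological_tendstoD)
      then have "\<forall>\<^sub>F n in sequentially. ennreal (\<delta> s - C * \<eta> n) =
         ennreal (\<delta> s - C * \<eta> n) * indicator U (\<tau>' (\<eta> n) s) * indicator {0..1} s"
        by eventually_elim (use True in auto)
      ultimately have "(\<lambda>n. ennreal (\<delta> s - C * \<eta> n) * indicator U (\<tau>' (\<eta> n) s) * indicator {0..1} s)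
         \<longlonglongrightarrow> ennreal (\<delta> s)"
        by (simp add: Lim_transform_eventually)
      then show ?thesis
        using True by (simp add: lim_imp_Liminf)
    qed auto
  qed
  also have "\<dots> \<le> liminf (\<lambda>n. \<integral>\<^sup>+s. ennreal (\<delta> s - C * \<eta> n) * indicator U (\<tau>' (\<eta> n) s) * indicator {0..1} s \<partial>lborel)"
    by (rule nn_integral_liminf) measurable
  also have "\<dots> \<le> liminf (\<lambda>n::nat. emeasure lborel U)"
    by (intro Liminf_mono always_eventually allI ineq \<eta>)
  finally show ?thesis by (simp add: Liminf_const)
qed

text \<open>A 1-Lipschitz displacement has a nondecreasing lift \<open>\<tau>\<close> with
  \<open>\<tau> 1 = \<tau> 0 + 1\<close>, so one turn of the circle goes to one turn and the
  substitution on the line descends. Only an inequality results, as \<open>\<delta>\<close> merely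
  bounds the growth of the lift from below.\<close>

lemma circle_substitution_ineq:
  fixes \<theta> \<delta> :: "circle \<Rightarrow> real"
  assumes lip: "\<And>y s. 0 \<le> s \<Longrightarrow> \<bar>\<theta> (y \<oplus> s) - \<theta> y\<bar> \<le> s"
    and \<delta> [measurable]: "\<delta> \<in> borel_measurable borel"
    and inc: "\<And>y s. 0 \<le> s \<Longrightarrow> s + \<theta> (y \<oplus> s) - \<theta> y \<ge> s * \<delta> y - C * s\<^sup>2"
    and G [measurable]: "G \<in> borel_measurable borel"
  shows "(\<integral>\<^sup>+y. G (y \<oplus> \<theta> y) * ennreal (\<delta> y) \<partial>circle_lebesgue) \<le> (\<integral>\<^sup>+y. G y \<partial>circle_lebesgue)"
proof -
  define \<tau> where "\<tau> s = s + \<theta> (to_circle s)" for s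
  have \<theta>_lip: "\<bar>\<theta> (to_circle t) - \<theta> (to_circle s)\<bar> \<le> \<bar>t - s\<bar>" for s t
    using lip[of "t - s" "to_circle s"] lip[of "s - t" "to_circle t"] by (cases "s \<le> t") auto
  have "1-lipschitz_on UNIV (\<lambda>s. \<theta> (to_circle s))"
    by (rule lipschitz_onI) (use \<theta>_lip in \<open>auto simp: dist_real_def\<close>)
  then have "continuous_on UNIV (\<lambda>s. \<theta> (to_circle s))"
    by (rule lipschitz_on_continuous_on)
  then have cont: "continuous_on UNIV \<tau>"
    unfolding \<tau>_def by (intro continuous_intros)
  have mono: "\<tau> s \<le> \<tau> t" if "s \<le> t" for s t
    using \<theta>_lip[of t s] that unfolding \<tau>_def by linarith
  have [measurable]: "\<tau> \<in> borel_measurable borel"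
    by (rule borel_measurable_continuous_onI[OF cont])
  have [measurable]: "\<theta> \<in> borel_measurable borel"
  proof -
    have "\<theta> = (\<lambda>y. \<tau> (circle_coord y) - circle_coord y)"
      by (simp add: \<tau>_def)
    then show ?thesis by simp
  qed
  have \<tau>1: "\<tau> 1 = \<tau> 0 + 1"
    using to_circle_add_1[of 0] by (simp add: \<tau>_def)
  define \<mu> where "\<mu> = distr (density lborel (\<lambda>s. ennreal (\<delta> (to_circle s)) * indicator {0..<1} s)) borel \<tau>"
  have [simp, measurable_cong]: "sets \<mu> = sets borel" "space \<mu> = UNIV"
    by (simp_all add: \<mu>_def)
  have \<mu>: "emeasure \<mu> A \<le> emeasure lborel A" if A: "A \<in> sets borel" for A
  proof (rule ennreal_le_epsilon)
    fix e :: real assume "0 < e"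
    then obtain U where U: "open U" "A \<subseteq> U" "emeasure lborel (U - A) < e"
      using outer_regular_lborel[OF A] by blast
    have [measurable]: "U \<in> sets borel" "A \<in> sets borel" using U A by auto
    have "\<tau> -` U \<in> sets borel"
      by (rule measurable_sets_borel) measurable
    have "emeasure \<mu> A \<le> emeasure \<mu> U"
      using U by (intro emeasure_mono) auto
    also have "\<dots> = (\<integral>\<^sup>+s. ennreal (\<delta> (to_circle s)) * indicator {0..<1} s * indicator U (\<tau> s) \<partial>lborel)"
      unfolding \<mu>_def
      by (subst emeasure_distr; (subst emeasure_density)?)
        (use \<open>\<tau> -` U \<in> sets borel\<close> in \<open>auto intro!: nn_integral_cong simp: indicator_def\<close>)
    also have "\<dots> \<le> (\<integral>\<^sup>+s. ennreal (\<delta> (to_circle s)) * indicator U (\<tau> s) * indicator {0..1} s \<partial>lborel)"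
      by (intro nn_integral_mono) (auto simp: indicator_def)
    also have "\<dots> \<le> emeasure lborel U"
    proof (rule emeasure_open_substitution_ineq[OF cont mono _ _ U(1), where C = C])
      show "\<eta> * \<delta> (to_circle s) - C * \<eta>\<^sup>2 \<le> \<tau> (s + \<eta>) - \<tau> s" if "0 \<le> \<eta>" for s \<eta>
        using inc[OF that, of "to_circle s"] by (simp add: \<tau>_def)
    qed auto
    also have "\<dots> = emeasure lborel A + emeasure lborel (U - A)"
      using U(2) by (subst plus_emeasure) (auto intro!: arg_cong[where f="emeasure lborel"])
    also have "\<dots> \<le> emeasure lborel A + ennreal e"
      using U(3) by (intro add_left_mono) simp
    finally show "emeasure \<mu> A \<le> emeasure lborel A + ennreal e" .
  qed
  have "\<mu> \<le> lborel"
  proof -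
    have "emeasure \<mu> A \<le> emeasure lborel A" for A
      by (cases "A \<in> sets borel") (simp_all add: \<mu> emeasure_notin_sets)
    then show ?thesis by (simp add: le_measure_iff le_fun_def)
  qed
  have "(\<integral>\<^sup>+y. G (y \<oplus> \<theta> y) * ennreal (\<delta> y) \<partial>circle_lebesgue)
     = (\<integral>\<^sup>+s. ennreal (\<delta> (to_circle s)) * indicator {0..<1} s * G (to_circle (\<tau> s)) \<partial>lborel)"
    by (subst nn_integral_circle_lebesgue) (auto simp: \<tau>_def mult_ac)
  \<comment> \<open>The indicator of one period is inserted before \<open>\<mu>\<close> is replaced
    by \<open>lborel\<close>; over the whole line the integral of a periodic function would count
    every period.\<close>
  also have "\<dots> \<le> (\<integral>\<^sup>+s. ennreal (\<delta> (to_circle s)) * indicator {0..<1} s *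
       (G (to_circle (\<tau> s)) * indicator {\<tau> 0..\<tau> 0 + 1} (\<tau> s)) \<partial>lborel)"
    using mono[of 0] mono[of _ 1] \<tau>1 by (intro nn_integral_mono) (auto simp: indicator_def)
  also have "\<dots> = (\<integral>\<^sup>+t. G (to_circle t) * indicator {\<tau> 0..\<tau> 0 + 1} t \<partial>\<mu>)"
    unfolding \<mu>_def by (simp add: nn_integral_distr nn_integral_density)
  also have "\<dots> \<le> (\<integral>\<^sup>+t. G (to_circle t) * indicator {\<tau> 0..\<tau> 0 + 1} t \<partial>lborel)"
    by (rule nn_integral_mono_measure) (simp_all add: \<open>\<mu> \<le> lborel\<close>)
  also have "\<dots> = (\<integral>\<^sup>+t. G (to_circle t) * indicator {\<tau> 0..<\<tau> 0 + 1} t \<partial>lborel)"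
  proof (rule nn_integral_cong_AE)
    show "AE t in lborel. G (to_circle t) * indicator {\<tau> 0..\<tau> 0 + 1} t =
        G (to_circle t) * indicator {\<tau> 0..<\<tau> 0 + 1} t"
      using AE_lborel_singleton[of "\<tau> 0 + 1"]
      by eventually_elim (auto simp: indicator_def)
  qed
  also have "\<dots> = (\<integral>\<^sup>+y. G y \<partial>circle_lebesgue)"
    by (rule nn_integral_circle_period) simp
  finally show ?thesis .
qed

section \<open>A measurable contraction principle\<close>

text \<open>The contraction property is stated for every common bound \<open>c\<close>, which
  encodes the maximum norm over \<open>I\<close>; it is applied to the maximal difference
  itself.\<close>

lemma contraction_fixpoint_unique:
  fixes u v :: "nat \<Rightarrow> real"
  assumes fin: "finite I" and L: "L < 1"
    and contr: "\<And>c i. (\<And>j. j \<in> I \<Longrightarrow> \<bar>u j - v j\<bar> \<le> c) \<Longrightarrow> i \<in> I \<Longrightarrow> \<bar>u i - v i\<bar> \<le> L * c"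
    and i: "i \<in> I"
  shows "u i = v i"
proof -
  define c where "c = Max ((\<lambda>j. \<bar>u j - v j\<bar>) ` I)"
  have le: "\<bar>u j - v j\<bar> \<le> c" if "j \<in> I" for j
    using that fin by (simp add: c_def)
  have "c \<in> (\<lambda>j. \<bar>u j - v j\<bar>) ` I"
    unfolding c_def using fin i by (intro Max_in) auto
  then obtain j where "j \<in> I" "c = \<bar>u j - v j\<bar>" by auto
  with contr[OF le] have "c \<le> L * c" by auto
  moreover have "0 \<le> c" using le[OF i] by linarith
  moreover have "L * c < 1 * c" if "0 < c"
    using L that by (intro mult_strict_right_mono) auto
  ultimately have "c = 0" by (cases "0 < c") auto
  with le[OF i] show ?thesis by simp
qed

text \<open>Picard iteration from zero, carried out for all parameters \<open>z\<close> at once: the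
  iterates stay measurable and the pointwise limit inherits this.\<close>

lemma measurable_contraction_fixpoint:
  fixes f :: "nat \<Rightarrow> 'z \<Rightarrow> (nat \<Rightarrow> real) \<Rightarrow> real"
  assumes fin: "finite I" and L: "0 \<le> L" "L < 1"
    and meas: "\<And>v i. (\<And>j. j \<in> I \<Longrightarrow> v j \<in> borel_measurable M) \<Longrightarrow> i \<in> I \<Longrightarrow>
        (\<lambda>z. f i z (\<lambda>j. v j z)) \<in> borel_measurable M"
    and contr: "\<And>z u v c i. z \<in> space M \<Longrightarrow> (\<And>j. j \<in> I \<Longrightarrow> \<bar>u j - v j\<bar> \<le> c) \<Longrightarrow> i \<in> I \<Longrightarrow>
        \<bar>f i z u - f i z v\<bar> \<le> L * c"
  obtains v where "\<And>i. i \<in> I \<Longrightarrow> v i \<in> borel_measurable M"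
    and "\<And>z i. z \<in> space M \<Longrightarrow> i \<in> I \<Longrightarrow> v i z = f i z (\<lambda>j. v j z)"
proof
  define V where "V n = ((\<lambda>V i z. f i z (\<lambda>j. V j z)) ^^ n) (\<lambda>i z. 0)" for n
  have V_Suc: "V (Suc n) i z = f i z (\<lambda>j. V n j z)" for n i z
    by (simp add: V_def)
  have V_meas: "V n i \<in> borel_measurable M" if "i \<in> I" for n i
    using that
  proof (induction n arbitrary: i)
    case 0
    then show ?case by (simp add: V_def)
  next
    case (Suc n)
    then show ?case using meas[of "V n" i] by (simp add: V_Suc[abs_def])
  qed
  define v where "v i z = lim (\<lambda>n. V n i z)" for i z
  show "v i \<in> borel_measurable M" if "i \<in> I" for i
    unfolding v_def using V_meas[OF that] by (rule borel_measurable_lim_metric)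
  fix z i assume z: "z \<in> space M" and i: "i \<in> I"
  \<comment> \<open>The sum over \<open>I\<close> serves as a bound for the first increment in the
    maximum norm.\<close>
  define c where "c = (\<Sum>j\<in>I. \<bar>V 1 j z - V 0 j z\<bar>)"
  have step: "\<bar>V (Suc n) j z - V n j z\<bar> \<le> L ^ n * c" if "j \<in> I" for n j
    using that
  proof (induction n arbitrary: j)
    case 0
    then show ?case using member_le_sum[of j I "\<lambda>j. \<bar>V 1 j z - V 0 j z\<bar>"] fin by (simp add: c_def)
  next
    case (Suc n)
    show ?case
      using contr[OF z Suc.IH Suc.prems] by (simp add: V_Suc mult.assoc)
  qed
  have conv: "(\<lambda>n. V n j z) \<longlonglongrightarrow> v j z" if j: "j \<in> I" for j
  proof -
    have "summable (\<lambda>n. V (Suc n) j z - V n j z)"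
      by (rule summable_comparison_test'[where g="\<lambda>n. L ^ n * c" and N=0])
        (use step[OF j] L in \<open>auto intro!: summable_mult2 summable_geometric\<close>)
    then have "convergent (\<lambda>n. \<Sum>m<n. V (Suc m) j z - V m j z)"
      by (simp add: summable_iff_convergent)
    from convergent_add[OF this convergent_const[of "V 0 j z"]]
    have "convergent (\<lambda>n. V n j z)"
      unfolding sum_lessThan_telescope[of "\<lambda>n. V n j z"] by simp
    then show ?thesis by (simp add: v_def convergent_LIMSEQ_iff)
  qed
  have "(\<lambda>n. V (Suc n) i z) \<longlonglongrightarrow> f i z (\<lambda>j. v j z)"
  proof (rule LIM_zero_cancel, rule Lim_null_comparison)
    show "\<forall>\<^sub>F n in sequentially. norm (V (Suc n) i z - f i z (\<lambda>j. v j z)) \<le> L * (\<Sum>j\<in>I. \<bar>V n j z - v j z\<bar>)"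
    proof (intro always_eventually allI)
      fix n
      have "\<bar>V n j z - v j z\<bar> \<le> (\<Sum>j\<in>I. \<bar>V n j z - v j z\<bar>)" if "j \<in> I" for j
        using member_le_sum[of j I "\<lambda>j. \<bar>V n j z - v j z\<bar>"] that fin by simp
      from contr[OF z this i]
      show "norm (V (Suc n) i z - f i z (\<lambda>j. v j z)) \<le> L * (\<Sum>j\<in>I. \<bar>V n j z - v j z\<bar>)"
        by (simp add: V_Suc)
    qed
    have "(\<lambda>n. L * (\<Sum>j\<in>I. \<bar>V n j z - v j z\<bar>)) \<longlonglongrightarrow> L * (\<Sum>j\<in>I. \<bar>v j z - v j z\<bar>)"
      by (intro tendsto_intros conv)
    then show "(\<lambda>n. L * (\<Sum>j\<in>I. \<bar>V n j z - v j z\<bar>)) \<longlonglongrightarrow> 0" by simp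
  qed
  moreover have "(\<lambda>n. V (Suc n) i z) \<longlonglongrightarrow> v i z"
    by (rule LIMSEQ_Suc[OF conv[OF i]])
  ultimately show "v i z = f i z (\<lambda>j. v j z)"
    using LIMSEQ_unique by blast
qed

section \<open>The Jacobian inequality on the torus\<close>

abbreviation torus_lebesgue :: "nat \<Rightarrow> (nat \<Rightarrow> circle) measure" where
  "torus_lebesgue N \<equiv> Pi\<^sub>M {..<N} (\<lambda>_. circle_lebesgue)"

lemma sets_torus_lebesgue [measurable_cong, simp]: "sets (torus_lebesgue N) = sets (torus_borel N)"
  by (intro sets_PiM_cong) simp_all

lemma space_torus [simp]:
  "space (torus_lebesgue N) = extensional {..<N}" "space (torus_borel N) = extensional {..<N}"
  by (simp_all add: space_PiM PiE_def)

definition torus_shift :: "nat \<Rightarrow> (nat \<Rightarrow> circle) \<Rightarrow> (nat \<Rightarrow> real) \<Rightarrow> nat \<Rightarrow> circle" where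
  "torus_shift N x a = (\<lambda>i\<in>{..<N}. x i \<oplus> a i)"

lemma torus_shift_apply [simp]: "i < N \<Longrightarrow> torus_shift N x a i = x i \<oplus> a i"
  by (simp add: torus_shift_def)

lemma torus_shift_extensional [simp]: "torus_shift N x a \<in> extensional {..<N}"
  by (simp add: torus_shift_def)

lemma torus_eqI:
  assumes "x \<in> extensional {..<N}" "y \<in> extensional {..<N}" "\<And>i. i < N \<Longrightarrow> x i = y i"
  shows "x = y"
  by (rule extensionalityI[OF assms(1,2)]) (use assms(3) in auto)

lemma measurable_torus_shift [measurable (raw)]:
  assumes "x \<in> M \<rightarrow>\<^sub>M torus_borel N" and "\<And>i. i < N \<Longrightarrow> (\<lambda>z. a z i) \<in> borel_measurable M"
  shows "(\<lambda>z. torus_shift N (x z) (a z)) \<in> M \<rightarrow>\<^sub>M torus_borel N"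
proof -
  have "(\<lambda>z. x z i) \<in> M \<rightarrow>\<^sub>M borel" if "i < N" for i
    using measurable_compose[OF assms(1) measurable_component_singleton, of i] that by simp
  with assms(2) show ?thesis
    unfolding torus_shift_def by (intro measurable_restrict measurable_translate) auto
qed

lemma nn_integral_torus_split:
  assumes k: "k < N" and G: "G \<in> borel_measurable (torus_borel N)"
  shows "(\<integral>\<^sup>+x. G x \<partial>torus_lebesgue N) =
    (\<integral>\<^sup>+x. (\<integral>\<^sup>+y. G (x(k := y)) \<partial>circle_lebesgue) \<partial>Pi\<^sub>M ({..<N} - {k}) (\<lambda>_. circle_lebesgue))"
proof -
  interpret product_sigma_finite "\<lambda>_::nat. circle_lebesgue" by standard
  have "insert k ({..<N} - {k}) = {..<N}" using k by auto
  with product_nn_integral_insert[of "{..<N} - {k}" k G] G show ?thesis by simp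
qed

text \<open>
  The map \<open>x \<mapsto> x + w x\<close> is a composition of maps each changing one coordinate: the first \<open>k\<close>
  coordinates are moved by \<open>S k\<close>, and the step from \<open>S k\<close> to \<open>S (Suc k)\<close> is, after inverting
  \<open>S k\<close>, a substitution in the coordinate \<open>k\<close> alone. Moving that coordinate by \<open>s\<close> with the
  first \<open>k\<close> values of \<open>S k\<close> fixed moves the preimages of the latter by \<open>O(l s)\<close> in total,
  whence the loss \<open>2 l\<^sup>2/N\<close>.
\<close>
lemma torus_jacobian_ineq:
  fixes w d :: "nat \<Rightarrow> (nat \<Rightarrow> circle) \<Rightarrow> real"
  assumes l: "0 \<le> l" "l \<le> 1/4"
    and w_meas: "\<And>i. i < N \<Longrightarrow> w i \<in> borel_measurable (torus_borel N)"
    and d_meas: "\<And>i. i < N \<Longrightarrow> d i \<in> borel_measurable (torus_borel N)"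
    and lip: "\<And>i x a. i < N \<Longrightarrow> x \<in> extensional {..<N} \<Longrightarrow>
        \<bar>w i (torus_shift N x a) - w i x\<bar> \<le> l * \<bar>a i\<bar> + l / real N * (\<Sum>j<N. \<bar>a j\<bar>)"
    and inc: "\<And>i x s. i < N \<Longrightarrow> x \<in> extensional {..<N} \<Longrightarrow> 0 \<le> s \<Longrightarrow>
        w i (x(i := x i \<oplus> s)) - w i x \<ge> s * d i x - C * s\<^sup>2"
    and G: "G \<in> borel_measurable (torus_borel N)"
  shows "(\<integral>\<^sup>+x. G (torus_shift N x (\<lambda>i. w i x)) * (\<Prod>i<N. ennreal (1 + d i x - 2 * l\<^sup>2 / real N))
      \<partial>torus_lebesgue N) \<le> (\<integral>\<^sup>+x. G x \<partial>torus_lebesgue N)"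
proof -
  define S where "S k x = torus_shift N x (\<lambda>i. if i < k then w i x else 0)" for k x
  define D where "D i x = ennreal (1 + d i x - 2 * l\<^sup>2 / real N)" for i x
  have D_meas: "D i \<in> borel_measurable (torus_borel N)" if "i < N" for i
    unfolding D_def using d_meas[OF that] by measurable
  have S_meas: "S k \<in> torus_borel N \<rightarrow>\<^sub>M torus_borel N" for k
    unfolding S_def using w_meas by (intro measurable_torus_shift) auto
  have "(\<integral>\<^sup>+x. G (S k x) * (\<Prod>i<k. D i x) \<partial>torus_lebesgue N) \<le> (\<integral>\<^sup>+x. G x \<partial>torus_lebesgue N)"
    if "k \<le> N" for k
    using that G
  proof (induction k arbitrary: G)
    case 0
    have "S 0 x = x" if "x \<in> extensional {..<N}" for x
      by (rule torus_eqI[where N=N]) (use that in \<open>auto simp: S_def\<close>)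
    then show ?case by (auto intro!: nn_integral_mono)
  next
    case (Suc k)
    note [measurable] = Suc.prems(2)
    from Suc.prems have k: "k < N" "k \<le> N" by auto
    have N: "0 < real N" using k by simp
    \<comment> \<open>If \<open>S k\<close> moves \<open>x\<close> to \<open>z\<close> with
      displacement \<open>v\<close>, then \<open>x = z - v\<close> and
      \<open>v i = w i (z - v)\<close> for \<open>i < k\<close>. The inverse of \<open>S k\<close>
      comes from solving this fixed-point equation, a contraction with factor
      \<open>2 * l\<close>.\<close>
    define f where "f i z v = (if i < k then w i (torus_shift N z (\<lambda>j. - v j)) else 0)" for i z v
    have f_contr: "\<bar>f i z u - f i z v\<bar> \<le> (2 * l) * c"
      if z: "z \<in> extensional {..<N}" and c: "\<And>j. j < N \<Longrightarrow> \<bar>u j - v j\<bar> \<le> c" and i: "i < N" for i z u v c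
    proof -
      have c0: "0 \<le> c" using c[OF i] by linarith
      have eq: "torus_shift N z (\<lambda>j. - u j) = torus_shift N (torus_shift N z (\<lambda>j. - v j)) (\<lambda>j. v j - u j)"
        by (rule torus_eqI[where N=N]) (auto)
      have "\<bar>w i (torus_shift N z (\<lambda>j. - u j)) - w i (torus_shift N z (\<lambda>j. - v j))\<bar>
        \<le> l * \<bar>v i - u i\<bar> + l / real N * (\<Sum>j<N. \<bar>v j - u j\<bar>)"
        unfolding eq by (rule lip[OF i]) simp
      also have "\<dots> \<le> l * c + l / real N * (\<Sum>j<N. c)"
        using c[OF i] l by (intro add_mono mult_left_mono sum_mono) (auto simp: abs_minus_commute c)
      also have "\<dots> = 2 * l * c" using N by simp
      finally show ?thesis using c0 l by (simp add: f_def)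
    qed
    obtain v where v_meas: "\<And>i. i < N \<Longrightarrow> v i \<in> borel_measurable (torus_borel N)"
      and v_eq: "\<And>z i. z \<in> extensional {..<N} \<Longrightarrow> i < N \<Longrightarrow> v i z = f i z (\<lambda>j. v j z)"
    proof (rule measurable_contraction_fixpoint[of "{..<N}" "2*l" "torus_borel N" f])
      show "(\<lambda>z. f i z (\<lambda>j. v j z)) \<in> borel_measurable (torus_borel N)"
        if v: "\<And>j. j \<in> {..<N} \<Longrightarrow> v j \<in> borel_measurable (torus_borel N)" and i: "i \<in> {..<N}" for v i
      proof -
        have "(\<lambda>z. torus_shift N z (\<lambda>j. - v j z)) \<in> torus_borel N \<rightarrow>\<^sub>M torus_borel N"
          using v by (intro measurable_torus_shift) auto
        from measurable_compose[OF this w_meas] i show ?thesis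
          by (auto simp: f_def)
      qed
    qed (use l f_contr in auto)
    define R where "R z = torus_shift N z (\<lambda>j. - v j z)" for z
    have R_ext [simp]: "R z \<in> extensional {..<N}" for z by (simp add: R_def)
    have [measurable]: "R \<in> torus_borel N \<rightarrow>\<^sub>M torus_borel N"
      unfolding R_def using v_meas by (intro measurable_torus_shift) auto
    have v_R: "v i z = (if i < k then w i (R z) else 0)" if "z \<in> extensional {..<N}" "i < N" for z i
      using v_eq[OF that] by (simp add: f_def R_def)
    \<comment> \<open>The true displacement solves the same equation, so uniqueness makes
      \<open>R\<close> a left inverse of \<open>S k\<close>.\<close>
    have R_S: "R (S k x) = x" if x: "x \<in> extensional {..<N}" for x
    proof -
      define u where "u i = (if i < k then w i x else 0)" for i
      have sh: "torus_shift N (S k x) (\<lambda>j. - u j) = x"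
        by (rule torus_eqI[where N=N]) (use x in \<open>auto simp: S_def u_def\<close>)
      have fu: "u i = f i (S k x) u" for i
        by (simp add: f_def sh) (simp add: u_def)
      have "v i (S k x) = u i" if i: "i < N" for i
      proof (rule contraction_fixpoint_unique[of "{..<N}" "2*l" "\<lambda>i. v i (S k x)" u])
        fix c i assume c: "\<And>j. j \<in> {..<N} \<Longrightarrow> \<bar>v j (S k x) - u j\<bar> \<le> c" and i: "i \<in> {..<N}"
        show "\<bar>v i (S k x) - u i\<bar> \<le> 2 * l * c"
          using f_contr[of "S k x" "\<lambda>j. v j (S k x)" u c i] c i
          by (subst v_eq, simp add: S_def, simp) (subst fu, auto simp: S_def)
      qed (use l i in auto)
      then have "R (S k x) = torus_shift N (S k x) (\<lambda>j. - u j)"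
        unfolding R_def by (intro torus_eqI[where N=N]) auto
      with sh show ?thesis by simp
    qed
    \<comment> \<open>The displacement of the coordinate \<open>k\<close> is evaluated at the
      preimage, so that \<open>\<Theta>\<close> after \<open>S k\<close> is
      \<open>S (Suc k)\<close>.\<close>
    define \<Theta> where "\<Theta> z = z(k := z k \<oplus> w k (R z))" for z
    have wR_meas [measurable]: "(\<lambda>z. w k (R z)) \<in> borel_measurable (torus_borel N)"
      using w_meas[OF k(1)] by measurable
    have DR_meas [measurable]: "(\<lambda>z. D k (R z)) \<in> borel_measurable (torus_borel N)"
      using D_meas[OF k(1)] by measurable
    have \<Theta>_eq: "\<Theta> z = torus_shift N z (\<lambda>j. if j = k then w k (R z) else 0)" if "z \<in> extensional {..<N}" for z
      by (rule torus_eqI[where N=N]) (use that k in \<open>auto simp: \<Theta>_def extensional_def torus_shift_def\<close>)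
    have [measurable]: "\<Theta> \<in> torus_borel N \<rightarrow>\<^sub>M torus_borel N"
      by (subst measurable_cong[OF \<Theta>_eq]) (auto intro!: measurable_torus_shift)
    have S_Suc: "S (Suc k) x = \<Theta> (S k x)" if x: "x \<in> extensional {..<N}" for x
      unfolding \<Theta>_def R_S[OF x]
      by (rule torus_eqI[where N=N])
        (use k in \<open>auto simp: S_def extensional_def torus_shift_def less_Suc_eq\<close>)
    have "(\<integral>\<^sup>+x. G (S (Suc k) x) * (\<Prod>i<Suc k. D i x) \<partial>torus_lebesgue N)
      = (\<integral>\<^sup>+x. (G (\<Theta> (S k x)) * D k (R (S k x))) * (\<Prod>i<k. D i x) \<partial>torus_lebesgue N)"
      by (intro nn_integral_cong) (simp add: S_Suc R_S mult_ac)
    also have "\<dots> \<le> (\<integral>\<^sup>+z. G (\<Theta> z) * D k (R z) \<partial>torus_lebesgue N)"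
      by (rule Suc.IH[OF k(2), of "\<lambda>z. G (\<Theta> z) * D k (R z)"]) measurable
    also have "\<dots> = (\<integral>\<^sup>+x. (\<integral>\<^sup>+y. G (\<Theta> (x(k := y))) * D k (R (x(k := y))) \<partial>circle_lebesgue)
         \<partial>Pi\<^sub>M ({..<N} - {k}) (\<lambda>_. circle_lebesgue))"
      by (rule nn_integral_torus_split[OF k(1)]) measurable
    also have "\<dots> \<le> (\<integral>\<^sup>+x. (\<integral>\<^sup>+y. G (x(k := y)) \<partial>circle_lebesgue)
         \<partial>Pi\<^sub>M ({..<N} - {k}) (\<lambda>_. circle_lebesgue))"
    proof (rule nn_integral_mono)
      fix x assume "x \<in> space (Pi\<^sub>M ({..<N} - {k}) (\<lambda>_. circle_lebesgue))"
      then have x: "x \<in> space (Pi\<^sub>M ({..<N} - {k}) (\<lambda>_. borel::circle measure))" and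
        x': "x \<in> extensional ({..<N} - {k})"
        by (auto simp: space_PiM PiE_def)
      have ext [simp]: "x(k := y) \<in> extensional {..<N}" for y
        using x' k by (auto simp: extensional_def)
      have upd: "(\<lambda>y. x(k := y)) \<in> borel \<rightarrow>\<^sub>M torus_borel N"
        using measurable_component_update[OF x, of k] k by (simp add: insert_absorb)
      define \<theta> where "\<theta> y = w k (R (x(k := y)))" for y
      define \<delta> where "\<delta> y = 1 + d k (R (x(k := y))) - 2 * l\<^sup>2 / real N" for y
      \<comment> \<open>\<open>A\<close> is the total change of the first \<open>k\<close>
        coordinates of the preimage in response to a move of the coordinate \<open>k\<close> by
        \<open>s\<close>.\<close>
      have move: "\<exists>A\<ge>0. A \<le> 2 * l * s \<and>
          \<bar>\<theta> (y \<oplus> s) - w k ((R (x(k := y)))(k := R (x(k := y)) k \<oplus> s))\<bar> \<le> l / real N * A \<and>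
          \<bar>\<theta> (y \<oplus> s) - \<theta> y\<bar> \<le> l * s + l / real N * (A + s)" if s: "0 \<le> s" for y s
      proof -
        define Z Z' where "Z = x(k := y)" and "Z' = x(k := y \<oplus> s)"
        have [simp]: "Z \<in> extensional {..<N}" "Z' \<in> extensional {..<N}"
          by (simp_all add: Z_def Z'_def)
        define b where "b i = (if i < k then - (w i (R Z') - w i (R Z)) else 0)" for i
        define A where "A = (\<Sum>j<N. \<bar>b j\<bar>)"
        have Rk: "R Z' k = R Z k \<oplus> s"
          using k by (simp add: R_def v_R) (simp add: Z_def Z'_def)
        have R1: "R Z' = torus_shift N (R Z) (\<lambda>i. if i = k then s else b i)"
        proof (rule torus_eqI[where N=N])
          fix i assume i: "i < N"
          show "R Z' i = torus_shift N (R Z) (\<lambda>i. if i = k then s else b i) i"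
            using i Rk by (cases "i = k") (auto simp: R_def v_R b_def Z_def Z'_def)
        qed (simp_all)
        have R2: "R Z' = torus_shift N ((R Z)(k := R Z k \<oplus> s)) b"
          using k by (subst R1, intro torus_eqI[where N=N]) (auto simp: b_def)
        have sum_eq: "(\<Sum>j<N. \<bar>if j = k then s else b j\<bar>) = A + s"
        proof -
          have "(\<Sum>j<N. \<bar>if j = k then s else b j\<bar>) = (\<Sum>j<N. \<bar>b j\<bar> + (if j = k then s else 0))"
            using s by (intro sum.cong) (auto simp: b_def)
          also have "\<dots> = A + s"
            using k by (simp add: A_def sum.distrib)
          finally show ?thesis .
        qed
        have lip': "\<bar>w i (R Z') - w i (R Z)\<bar> \<le> l * \<bar>if i = k then s else b i\<bar> + l / real N * (A + s)"
          if "i < N" for i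
          using lip[OF that, of "R Z" "\<lambda>i. if i = k then s else b i"] unfolding R1[symmetric] sum_eq by simp
        have A0: "0 \<le> A" unfolding A_def by (intro sum_nonneg) auto
        have b_le: "\<bar>b i\<bar> \<le> l * \<bar>b i\<bar> + l / real N * (A + s)" if i: "i < N" for i
        proof (cases "i < k")
          case True
          then show ?thesis using lip'[OF i] by (simp add: b_def abs_minus_commute)
        next
          case False
          then show ?thesis using l A0 s by (simp add: b_def)
        qed
        \<comment> \<open>The total change occurs on both sides and is absorbed, since
          \<open>2 * l \<le> 1/2\<close>.\<close>
        have "A \<le> (\<Sum>i<N. l * \<bar>b i\<bar> + l / real N * (A + s))"
          unfolding A_def by (intro sum_mono) (use b_le in \<open>auto simp: A_def\<close>)
        also have "\<dots> = l * A + l * (A + s)"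
          using N by (simp add: sum.distrib sum_distrib_left[symmetric] A_def)
        finally have "A * (1 - 2 * l) \<le> l * s" by (simp add: algebra_simps)
        moreover have "A * (1 - 2 * l) \<ge> A * (1/2)" using l A0 by (intro mult_left_mono) auto
        ultimately have A_le: "A \<le> 2 * l * s" by linarith
        have "\<bar>w k (R Z') - w k ((R Z)(k := R Z k \<oplus> s))\<bar> \<le> l * \<bar>b k\<bar> + l / real N * A"
          unfolding R2 A_def
          by (rule lip[OF k(1)]) (use k in \<open>auto simp: extensional_def R_def torus_shift_def\<close>)
        moreover have "b k = 0" by (simp add: b_def)
        ultimately show ?thesis
          using A0 A_le lip'[OF k(1)] s unfolding \<theta>_def Z_def Z'_def by (intro exI[of _ A]) auto
      qed
      have "(\<integral>\<^sup>+y. G (x(k := y \<oplus> \<theta> y)) * ennreal (\<delta> y) \<partial>circle_lebesgue)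
        \<le> (\<integral>\<^sup>+y. G (x(k := y)) \<partial>circle_lebesgue)"
      proof (rule circle_substitution_ineq[where C = C])
        show "\<delta> \<in> borel_measurable borel"
          unfolding \<delta>_def using d_meas[OF k(1)] upd by measurable
        show "(\<lambda>y. G (x(k := y))) \<in> borel_measurable borel"
          using upd by measurable
        fix y s assume s: "(0::real) \<le> s"
        from move[OF s, of y] obtain A where A: "A \<ge> 0" "A \<le> 2 * l * s"
          "\<bar>\<theta> (y \<oplus> s) - w k ((R (x(k := y)))(k := R (x(k := y)) k \<oplus> s))\<bar> \<le> l / real N * A"
          "\<bar>\<theta> (y \<oplus> s) - \<theta> y\<bar> \<le> l * s + l / real N * (A + s)" by blast
        have "l / real N * (A + s) \<le> l / 1 * (2 * l * s + s)"
          using l A s N k by (intro mult_mono divide_left_mono) auto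
        moreover have "l * (2 * l * s + s) \<le> (1/4) * (2 * (1/4) * s + s)"
          using l s by (intro mult_mono add_mono) auto
        moreover have "l * s \<le> 1/4 * s" using l s by (intro mult_right_mono) auto
        ultimately show "\<bar>\<theta> (y \<oplus> s) - \<theta> y\<bar> \<le> s" using A(4) s by simp
        have "w k ((R (x(k := y)))(k := R (x(k := y)) k \<oplus> s)) - \<theta> y \<ge> s * d k (R (x(k := y))) - C * s\<^sup>2"
          unfolding \<theta>_def by (rule inc[OF k(1) _ s]) simp
        \<comment> \<open>The response of the other coordinates costs
          \<open>2 * l\<^sup>2 / N\<close> per unit of \<open>s\<close>; this is the term subtracted
          in \<open>\<delta>\<close>.\<close>
        moreover have "l / real N * A \<le> l / real N * (2 * l * s)"
          using l A N by (intro mult_left_mono) auto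
        moreover have "s * \<delta> y = s + s * d k (R (x(k := y))) - l / real N * (2 * l * s)"
          by (simp add: \<delta>_def algebra_simps power2_eq_square)
        ultimately show "s * \<delta> y - C * s\<^sup>2 \<le> s + \<theta> (y \<oplus> s) - \<theta> y"
          using A(3) by linarith
      qed
      then show "(\<integral>\<^sup>+y. G (\<Theta> (x(k := y))) * D k (R (x(k := y))) \<partial>circle_lebesgue)
          \<le> (\<integral>\<^sup>+y. G (x(k := y)) \<partial>circle_lebesgue)"
        by (simp add: \<Theta>_def \<theta>_def D_def \<delta>_def)
    qed
    also have "\<dots> = (\<integral>\<^sup>+x. G x \<partial>torus_lebesgue N)"
      by (rule nn_integral_torus_split[OF k(1), symmetric]) measurable
    finally show ?case .
  qed
  from this[of N]
  have "(\<integral>\<^sup>+x. G (S N x) * (\<Prod>i<N. D i x) \<partial>torus_lebesgue N) \<le> (\<integral>\<^sup>+x. G x \<partial>torus_lebesgue N)" by simp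
  moreover have "S N x = torus_shift N x (\<lambda>i. w i x)" for x
    by (rule torus_eqI[where N=N]) (auto simp: S_def)
  ultimately show ?thesis by (simp add: D_def)
qed

section \<open>The Donsker--Varadhan formula\<close>

context
  fixes \<mu> \<nu> :: "'a measure"
  assumes \<mu>: "prob_space \<mu>" and \<nu>: "prob_space \<nu>" and sets_eq: "sets \<mu> = sets \<nu>"
begin

interpretation \<mu>: prob_space \<mu> by (rule \<mu>)
interpretation \<nu>: prob_space \<nu> by (rule \<nu>)

lemma absolutely_continuous_density:
  assumes ac: "absolutely_continuous \<nu> \<mu>"
  defines "u \<equiv> \<lambda>x. enn2real (RN_deriv \<nu> \<mu> x)"
  shows "\<mu> = density \<nu> (\<lambda>x. ennreal (u x))" and "integrable \<nu> u" and "(\<integral>x. u x \<partial>\<nu>) = 1"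
proof -
  have "AE x in \<nu>. RN_deriv \<nu> \<mu> x \<noteq> \<infinity>"
    using \<nu>.RN_deriv_finite[OF \<mu>.sigma_finite_measure_axioms ac sets_eq] .
  then have "AE x in \<nu>. RN_deriv \<nu> \<mu> x = ennreal (u x)"
    by eventually_elim (simp add: u_def less_top)
  then have "density \<nu> (RN_deriv \<nu> \<mu>) = density \<nu> (\<lambda>x. ennreal (u x))"
    by (intro density_cong) (simp_all add: u_def)
  then show eq: "\<mu> = density \<nu> (\<lambda>x. ennreal (u x))"
    using \<nu>.density_RN_deriv[OF ac sets_eq] by simp
  have "(\<integral>\<^sup>+x. ennreal (u x) \<partial>\<nu>) = emeasure (density \<nu> (\<lambda>x. ennreal (u x))) (space \<nu>)"
    by (subst emeasure_density) (auto simp: u_def intro!: nn_integral_cong)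
  also have "\<dots> = 1"
    unfolding eq[symmetric] using \<mu>.emeasure_space_1 sets_eq_imp_space_eq[OF sets_eq] by simp
  finally have 1: "(\<integral>\<^sup>+x. ennreal (u x) \<partial>\<nu>) = ennreal 1" by simp
  have "has_bochner_integral \<nu> u 1"
    by (rule has_bochner_integral_nn_integral[OF _ _ _ 1]) (simp_all add: u_def)
  then show "integrable \<nu> u" and "(\<integral>x. u x \<partial>\<nu>) = 1"
    by (auto simp: has_bochner_integral_iff)
qed

lemma x_ln_x_ge: "x * ln x \<ge> x - 1" if "0 \<le> x" for x :: real
proof (cases "x = 0")
  case False
  then have "ln (inverse x) \<le> inverse x - 1"
    using that by (intro ln_le_minus_one) simp
  then have "x * (1 - inverse x) \<le> x * ln x"
    using that False by (intro mult_left_mono) (simp_all add: ln_inverse)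
  then show ?thesis using False by (simp add: algebra_simps)
qed simp

text \<open>Since \<open>x * ln x \<ge> - 1\<close> for nonnegative \<open>x\<close>, the negative
  part has a finite integral and the difference in the definition is never
  \<open>\<infinity> - \<infinity>\<close>. What remains is the value infinity or a genuine Bochner
  integral.\<close>

lemma rel_entropy_cases:
  defines "u \<equiv> \<lambda>x. enn2real (RN_deriv \<nu> \<mu> x)"
  obtains "rel_entropy \<mu> \<nu> = \<infinity>"
  | "absolutely_continuous \<nu> \<mu>" "integrable \<nu> (\<lambda>x. u x * ln (u x))"
    "rel_entropy \<mu> \<nu> = ereal (\<integral>x. u x * ln (u x) \<partial>\<nu>)"
proof (cases "absolutely_continuous \<nu> \<mu>")
  case False
  then show ?thesis by (intro that(1)) (simp add: rel_entropy_def)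
next
  case True
  have [measurable]: "u \<in> borel_measurable \<nu>" by (simp add: u_def)
  let ?P = "\<integral>\<^sup>+x. ennreal (u x * ln (u x)) \<partial>\<nu>" and ?Q = "\<integral>\<^sup>+x. ennreal (- (u x * ln (u x))) \<partial>\<nu>"
  have H: "rel_entropy \<mu> \<nu> = enn2ereal ?P - enn2ereal ?Q"
    using True by (simp add: rel_entropy_def Let_def u_def)
  have "?Q \<le> (\<integral>\<^sup>+x. 1 \<partial>\<nu>)"
  proof (rule nn_integral_mono)
    fix x
    have "- (u x * ln (u x)) \<le> 1"
      using x_ln_x_ge[of "u x"] enn2real_nonneg[of "RN_deriv \<nu> \<mu> x"] unfolding u_def by linarith
    then show "ennreal (- (u x * ln (u x))) \<le> 1" by simp
  qed
  then have Q: "?Q < \<infinity>"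
    by (simp add: \<nu>.emeasure_space_1 le_less_trans[OF _ ennreal_one_less_top])
  show ?thesis
  proof (cases "?P = \<infinity>")
    case True
    then show ?thesis
      using H Q by (intro that(1)) (cases ?Q rule: ennreal_cases, auto)
  next
    case False
    have int: "integrable \<nu> (\<lambda>x. u x * ln (u x))"
      using False Q by (simp add: real_integrable_def)
    have "(\<integral>x. u x * ln (u x) \<partial>\<nu>) = enn2real ?P - enn2real ?Q"
      by (rule real_lebesgue_integral_def[OF int])
    then have "rel_entropy \<mu> \<nu> = ereal (\<integral>x. u x * ln (u x) \<partial>\<nu>)"
      using H Q False
      by (cases ?Q rule: ennreal_cases; cases ?P rule: ennreal_cases) auto
    with True int show ?thesis by (rule that(2))
  qed
qed

text \<open>Young's inequality between \<open>u * ln u\<close> and \<open>exp g / Z\<close> holds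
  pointwise. Both \<open>u\<close> and \<open>exp g / Z\<close> have integral one, so the correction
  terms cancel after integration.\<close>

lemma donsker_varadhan:
  assumes g [measurable]: "g \<in> borel_measurable \<nu>" and B: "\<And>x. \<bar>g x\<bar> \<le> B"
  shows "ereal ((\<integral>x. g x \<partial>\<mu>) - ln (\<integral>x. exp (g x) \<partial>\<nu>)) \<le> rel_entropy \<mu> \<nu>"
proof (cases rule: rel_entropy_cases)
  case 2
  define u where "u = (\<lambda>x. enn2real (RN_deriv \<nu> \<mu> x))"
  have dens: "\<mu> = density \<nu> (\<lambda>x. ennreal (u x))" "integrable \<nu> u" "(\<integral>x. u x \<partial>\<nu>) = 1"
    unfolding u_def by (rule absolutely_continuous_density[OF 2(1)])+
  have [measurable]: "u \<in> borel_measurable \<nu>" by (simp add: u_def)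
  have u0: "u x \<ge> 0" for x by (simp add: u_def)
  define Z where "Z = (\<integral>x. exp (g x) \<partial>\<nu>)"
  have int_exp: "integrable \<nu> (\<lambda>x. exp (g x))"
    using B by (intro \<nu>.integrable_const_bound[where B = "exp B"]) (auto simp: abs_le_iff)
  have "exp (- B) \<le> Z"
  proof -
    have "(\<integral>x. exp (- B) \<partial>\<nu>) \<le> Z" unfolding Z_def
      using B by (intro integral_mono int_exp) (auto simp: abs_le_iff minus_le_iff)
    then show ?thesis by (simp add: \<nu>.prob_space)
  qed
  then have Z: "Z > 0" using exp_gt_zero[of "-B"] by linarith
  have young: "u x * (g x - ln Z) \<le> u x * ln (u x) - u x + exp (g x) / Z" for x
  proof (cases "u x = 0")
    case True
    then show ?thesis using Z by simp
  next
    case False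
    then have u: "u x > 0" using u0[of x] by simp
    have "ln (exp (g x) / (Z * u x)) \<le> exp (g x) / (Z * u x) - 1"
      using Z u by (intro ln_le_minus_one) simp
    then have "u x * (g x - ln Z - ln (u x)) \<le> u x * (exp (g x) / (Z * u x) - 1)"
      using u Z by (intro mult_left_mono) (auto simp: ln_div ln_mult)
    then show ?thesis using u by (simp add: algebra_simps)
  qed
  have int_ug: "integrable \<nu> (\<lambda>x. u x * g x)"
  proof (rule Bochner_Integration.integrable_bound[where f = "\<lambda>x. B * u x"])
    show "AE x in \<nu>. norm (u x * g x) \<le> norm (B * u x)"
      using B u0 by (intro AE_I2)
        (auto simp: abs_mult mult.commute[of "u _"] intro!: mult_right_mono intro: order_trans[OF B abs_ge_self])
  qed (use dens in auto)
  have "(\<integral>x. g x \<partial>\<mu>) - ln Z = (\<integral>x. u x * g x \<partial>\<nu>) - ln Z * (\<integral>x. u x \<partial>\<nu>)"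
    unfolding dens(3) by (subst dens(1), subst integral_density) (auto simp: u0)
  also have "\<dots> = (\<integral>x. u x * (g x - ln Z) \<partial>\<nu>)"
    using int_ug dens(2) by (simp add: algebra_simps)
  also have "\<dots> \<le> (\<integral>x. u x * ln (u x) - u x + exp (g x) / Z \<partial>\<nu>)"
    using int_ug dens(2) int_exp 2(2) young
    by (intro integral_mono) (auto simp: algebra_simps u_def)
  also have "\<dots> = (\<integral>x. u x * ln (u x) \<partial>\<nu>)"
    using 2(2) dens(2,3) int_exp Z by (simp add: u_def Z_def[symmetric])
  finally show ?thesis using 2(3) by (simp add: u_def Z_def)
qed simp

lemma rel_entropy_nonneg: "0 \<le> rel_entropy \<mu> \<nu>"
  using donsker_varadhan[of "\<lambda>_. 0" 0] by (simp add: \<nu>.prob_space zero_ereal_def)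

text \<open>The optimal test function \<open>ln u\<close> is unbounded; it is replaced by
  \<open>ln (v n x)\<close>, where \<open>v n\<close> truncates \<open>u\<close> to
  \<open>[1/(n+1), n+1]\<close>. The integrands \<open>u * ln (v n x)\<close> are at least
  \<open>- 1\<close>, so Fatou's lemma carries the bound to the limit.\<close>

lemma rel_entropy_le_of_donsker_varadhan:
  assumes DV: "\<And>g B. g \<in> borel_measurable \<nu> \<Longrightarrow> (\<And>x. \<bar>g x\<bar> \<le> B) \<Longrightarrow>
      (\<integral>x. g x \<partial>\<mu>) \<le> c + ln (\<integral>x. exp (g x) \<partial>\<nu>)"
  shows "rel_entropy \<mu> \<nu> \<le> ereal c"
proof -
  have c0: "0 \<le> c"
    using DV[of "\<lambda>_. 0" 0] by (simp add: \<nu>.prob_space)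
  have ac: "absolutely_continuous \<nu> \<mu>"
    unfolding absolutely_continuous_def
  proof
    fix A assume A: "A \<in> null_sets \<nu>"
    then have [measurable]: "A \<in> sets \<nu>" and A': "A \<in> sets \<mu>" using sets_eq by auto
    \<comment> \<open>Multiples of the indicator of a set null for \<open>\<nu>\<close> do not
      change the exponential integral, while their mean under \<open>\<mu>\<close> grows with
      \<open>n\<close> unless it vanishes.\<close>
    have "real n * measure \<mu> A \<le> c" for n :: nat
    proof -
      have "AE x in \<nu>. exp (real n * indicator A x) = (1::real)"
        using AE_not_in[OF A] by eventually_elim simp
      then have "(\<integral>x. exp (real n * indicator A x) \<partial>\<nu>) = (\<integral>x. 1 \<partial>\<nu>)"
        by (intro integral_cong_AE) auto
      moreover have "(\<integral>x. real n * indicator A x \<partial>\<mu>) = real n * measure \<mu> A"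
        using A' by simp
      moreover have "\<bar>real n * indicator A x\<bar> \<le> real n" for x
        by (simp add: indicator_def)
      ultimately show ?thesis
        using DV[of "\<lambda>x. real n * indicator A x" "real n"] by (auto simp: \<nu>.prob_space)
    qed
    then have "measure \<mu> A = 0"
      using reals_Archimedean3[of "measure \<mu> A"] by (meson measure_nonneg not_le order_le_less)
    then show "A \<in> null_sets \<mu>"
      using A' by (simp add: null_sets_def \<mu>.emeasure_eq_measure)
  qed
  define u where "u = (\<lambda>x. enn2real (RN_deriv \<nu> \<mu> x))"
  have dens: "\<mu> = density \<nu> (\<lambda>x. ennreal (u x))" "integrable \<nu> u" "(\<integral>x. u x \<partial>\<nu>) = 1"
    unfolding u_def by (rule absolutely_continuous_density[OF ac])+
  have [measurable]: "u \<in> borel_measurable \<nu>" by (simp add: u_def)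
  have u0: "u x \<ge> 0" for x by (simp add: u_def)
  define v where "v n x = max (1 / real (Suc n)) (min (real (Suc n)) (u x))" for n x
  have [measurable]: "v n \<in> borel_measurable \<nu>" for n by (simp add: v_def[abs_def])
  have v_pos: "v n x > 0" for n x by (simp add: v_def less_max_iff_disj)
  have v_bounds: "1 / real (Suc n) \<le> v n x" "v n x \<le> real (Suc n)" for n x
    by (auto simp: v_def field_simps)
  have ln_v: "\<bar>ln (v n x)\<bar> \<le> ln (real (Suc n))" for n x
  proof -
    have "ln (1 / real (Suc n)) \<le> ln (v n x)" "ln (v n x) \<le> ln (real (Suc n))"
      using v_bounds[of n x] v_pos[of n x] by (intro ln_mono; simp)+
    then show ?thesis by (simp add: ln_div abs_le_iff)
  qed
  have lower: "u x * ln (v n x) \<ge> - 1" for n x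
  proof (cases "u x \<le> v n x")
    case True
    have "ln (inverse (v n x)) \<le> inverse (v n x) - 1"
      using v_pos by (intro ln_le_minus_one) simp
    then have "u x * (1 - inverse (v n x)) \<le> u x * ln (v n x)"
      using u0 v_pos[of n x] by (intro mult_left_mono) (simp_all add: ln_inverse)
    moreover have "u x * inverse (v n x) \<le> 1"
      using True v_pos[of n x] by (simp add: field_simps)
    ultimately show ?thesis using u0[of x] by (simp add: algebra_simps)
  next
    case False
    then have "v n x \<ge> 1" by (auto simp: v_def)
    then have "u x * ln (v n x) \<ge> 0" using u0 by (intro mult_nonneg_nonneg) auto
    then show ?thesis by simp
  qed
  have lim: "(\<lambda>n. u x * ln (v n x)) \<longlonglongrightarrow> u x * ln (u x)" for x
  proof (cases "u x = 0")
    case False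
    then have u: "u x > 0" using u0[of x] by simp
    obtain m1 m2 :: nat where m: "u x \<le> real m1" "1 / u x \<le> real m2"
      by (meson real_arch_simple)
    have "\<forall>\<^sub>F n in sequentially. v n x = u x"
      using eventually_ge_at_top[of m1] eventually_ge_at_top[of m2]
    proof eventually_elim
      case (elim n)
      have "1 \<le> u x * real m2" using m(2) u by (simp add: field_simps)
      also have "\<dots> \<le> u x * real (Suc n)" using u elim by (intro mult_left_mono) auto
      finally show ?case using m u elim by (auto simp: v_def min_def max_def field_simps)
    qed
    then have "\<forall>\<^sub>F n in sequentially. u x * ln (v n x) = u x * ln (u x)"
      by eventually_elim simp
    then show ?thesis by (rule tendsto_eventually)
  qed simp
  have int_v: "integrable \<nu> (\<lambda>x. u x * ln (v n x))" for n
  proof (rule Bochner_Integration.integrable_bound[where f = "\<lambda>x. ln (real (Suc n)) * u x"])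
    show "AE x in \<nu>. norm (u x * ln (v n x)) \<le> norm (ln (real (Suc n)) * u x)"
      using ln_v u0 by (intro AE_I2) (auto simp: abs_mult mult.commute[of "u _"] intro!: mult_right_mono)
  qed (use dens in auto)
  have int_le: "(\<integral>x. u x * ln (v n x) \<partial>\<nu>) \<le> c + ln (1 + 1 / real (Suc n))" for n
  proof -
    have int_vn: "integrable \<nu> (v n)"
      using v_bounds v_pos by (intro \<nu>.integrable_const_bound[where B = "real (Suc n)"]) (auto simp: abs_of_pos)
    have "(\<integral>x. u x * ln (v n x) \<partial>\<nu>) = (\<integral>x. ln (v n x) \<partial>\<mu>)"
      by (subst dens(1), subst integral_density) (auto simp: u0)
    also have "\<dots> \<le> c + ln (\<integral>x. exp (ln (v n x)) \<partial>\<nu>)"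
      using ln_v by (intro DV) auto
    also have "(\<integral>x. exp (ln (v n x)) \<partial>\<nu>) = (\<integral>x. v n x \<partial>\<nu>)"
      using v_pos by simp
    also have "ln \<dots> \<le> ln (1 + 1 / real (Suc n))"
    proof (rule ln_mono)
      have "(\<integral>x. 1 / real (Suc n) \<partial>\<nu>) \<le> (\<integral>x. v n x \<partial>\<nu>)"
        using v_bounds by (intro integral_mono int_vn) auto
      then show "0 < (\<integral>x. v n x \<partial>\<nu>)"
        by (simp add: \<nu>.prob_space) (smt (verit) of_nat_0_le_iff zero_less_divide_1_iff)
      \<comment> \<open>The truncation from below adds at most \<open>1/(n+1)\<close>, so the
        normalisation error vanishes in the limit.\<close>
      have "(\<integral>x. v n x \<partial>\<nu>) \<le> (\<integral>x. u x + 1 / real (Suc n) \<partial>\<nu>)"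
        using dens(2) u0 by (intro integral_mono int_vn) (auto simp: v_def intro: min.coboundedI2)
      also have "\<dots> = 1 + 1 / real (Suc n)"
        using dens(2,3) by (simp add: \<nu>.prob_space)
      finally show "(\<integral>x. v n x \<partial>\<nu>) \<le> 1 + 1 / real (Suc n)" .
    qed
    finally show ?thesis by simp
  qed
  have "(\<integral>\<^sup>+x. ennreal (u x * ln (u x) + 1) \<partial>\<nu>)
      = (\<integral>\<^sup>+x. liminf (\<lambda>n. ennreal (u x * ln (v n x) + 1)) \<partial>\<nu>)"
    by (intro nn_integral_cong lim_imp_Liminf[symmetric] tendsto_ennrealI tendsto_intros lim) simp
  also have "\<dots> \<le> liminf (\<lambda>n. \<integral>\<^sup>+x. ennreal (u x * ln (v n x) + 1) \<partial>\<nu>)"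
    by (rule nn_integral_liminf) measurable
  also have "\<dots> \<le> liminf (\<lambda>n. ennreal (c + ln (1 + 1 / real (Suc n)) + 1))"
  proof (intro Liminf_mono always_eventually allI)
    fix n
    have "(\<integral>\<^sup>+x. ennreal (u x * ln (v n x) + 1) \<partial>\<nu>) = ennreal (\<integral>x. u x * ln (v n x) + 1 \<partial>\<nu>)"
    proof (intro nn_integral_eq_integral AE_I2)
      show "0 \<le> u x * ln (v n x) + 1" for x using lower[of x n] by linarith
    qed (use int_v in auto)
    also have "\<dots> \<le> ennreal (c + ln (1 + 1 / real (Suc n)) + 1)"
      using int_v[of n] int_le[of n] by (intro ennreal_leI) (simp add: \<nu>.prob_space)
    finally show "(\<integral>\<^sup>+x. ennreal (u x * ln (v n x) + 1) \<partial>\<nu>) \<le> ennreal (c + ln (1 + 1 / real (Suc n)) + 1)" .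
  qed
  also have "\<dots> = ennreal (c + ln (1 + 0) + 1)"
  proof (rule lim_imp_Liminf, simp)
    have "(\<lambda>n. 1 / real (Suc n)) \<longlonglongrightarrow> 0"
      using LIMSEQ_inverse_real_of_nat by (simp add: inverse_eq_divide)
    then show "(\<lambda>n. ennreal (c + ln (1 + 1 / real (Suc n)) + 1)) \<longlonglongrightarrow> ennreal (c + ln (1 + 0) + 1)"
      by (intro tendsto_ennrealI tendsto_intros) auto
  qed
  finally have le: "(\<integral>\<^sup>+x. ennreal (u x * ln (u x) + 1) \<partial>\<nu>) \<le> ennreal (c + 1)" by simp
  have nn: "0 \<le> u x * ln (u x) + 1" for x
    using x_ln_x_ge[OF u0[of x]] u0[of x] by linarith
  have int1: "integrable \<nu> (\<lambda>x. u x * ln (u x) + 1)"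
    using le nn by (intro integrableI_bounded) (auto simp: le_less_trans)
  then have int: "integrable \<nu> (\<lambda>x. u x * ln (u x))"
    using Bochner_Integration.integrable_diff[OF int1, of "\<lambda>_. 1"] by simp
  have "ennreal (\<integral>x. u x * ln (u x) + 1 \<partial>\<nu>) \<le> ennreal (c + 1)"
    using le int1 nn by (subst (asm) nn_integral_eq_integral) auto
  then have "(\<integral>x. u x * ln (u x) \<partial>\<nu>) \<le> c"
    using int c0 by (subst (asm) ennreal_le_iff) (auto simp: \<nu>.prob_space)
  moreover have "rel_entropy \<mu> \<nu> = ereal (\<integral>x. u x * ln (u x) \<partial>\<nu>)"
  proof (cases rule: rel_entropy_cases)
    \<comment> \<open>This case is contradictory: integrability makes the positive and the negative
      part finite.\<close>
    case 1
    let ?P = "\<integral>\<^sup>+x. ennreal (u x * ln (u x)) \<partial>\<nu>" and ?Q = "\<integral>\<^sup>+x. ennreal (- (u x * ln (u x))) \<partial>\<nu>"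
    have "?P \<noteq> \<infinity>" "?Q \<noteq> \<infinity>"
      using int by (simp_all add: real_integrable_def)
    moreover have "rel_entropy \<mu> \<nu> = enn2ereal ?P - enn2ereal ?Q"
      using ac by (simp add: rel_entropy_def Let_def u_def)
    ultimately have "rel_entropy \<mu> \<nu> \<noteq> \<infinity>"
      by (cases ?P rule: ennreal_cases; cases ?Q rule: ennreal_cases) auto
    with 1 show ?thesis by simp
  qed (simp add: u_def)
  ultimately show ?thesis by simp
qed

end

text \<open>A test function on the image is split as \<open>g (X x) = (g (X x) - b x) + b x\<close>.
  The first part costs one entropy by \<open>dom\<close>; the mean of the second is estimated
  through \<open>\<gamma> * b\<close> and costs a further multiple
  \<open>1 / \<gamma>\<close>.\<close>

lemma rel_entropy_distr_le:
  fixes \<rho> P :: "'a measure" and Q :: "'b measure"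
  assumes "prob_space \<rho>" "prob_space P" "prob_space Q" and sets: "sets \<rho> = sets P"
    and X: "X \<in> P \<rightarrow>\<^sub>M Q" and b: "b \<in> borel_measurable P" "\<And>x. \<bar>b x\<bar> \<le> B"
    and \<gamma>: "\<gamma> > 0"
    and dom: "\<And>g B. g \<in> borel_measurable Q \<Longrightarrow> (\<And>x. \<bar>g x\<bar> \<le> B) \<Longrightarrow>
        (\<integral>x. exp (g (X x) - b x) \<partial>P) \<le> (\<integral>y. exp (g y) \<partial>Q)"
    and mom: "(\<integral>x. exp (\<gamma> * b x) \<partial>P) \<le> L"
  shows "rel_entropy (distr \<rho> Q X) Q \<le> ereal (1 + 1 / \<gamma>) * rel_entropy \<rho> P + ereal (ln L / \<gamma>)"
proof -
  interpret \<rho>: prob_space \<rho> by fact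
  interpret P: prob_space P by fact
  interpret Q: prob_space Q by fact
  note [measurable_cong] = sets
  note [measurable] = X b(1)
  have X': "X \<in> \<rho> \<rightarrow>\<^sub>M Q" by measurable
  have exp_pos: "0 < (\<integral>x. exp (f x) \<partial>P)" if [measurable]: "f \<in> borel_measurable P" and "\<And>x. \<bar>f x\<bar> \<le> D"
    for f :: "'a \<Rightarrow> real" and D
  proof -
    have D: "- D \<le> f x" "f x \<le> D" for x
      using that(2)[of x] by linarith+
    then have "0 \<le> D" by (meson neg_le_0_iff_le order_trans linorder_linear)
    then have "(\<integral>x. exp (- D) \<partial>P) \<le> (\<integral>x. exp (f x) \<partial>P)"
      using D by (intro integral_mono P.integrable_const_bound[where B = "exp D"])
        auto
    then show ?thesis
      using less_le_trans[OF exp_gt_zero[of "- D"]] by (simp add: P.prob_space)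
  qed
  show ?thesis
  proof (cases "rel_entropy \<rho> P = \<infinity>")
    case True
    moreover have "0 < 1 + 1 / \<gamma>" using \<gamma> by (simp add: add_pos_pos)
    ultimately show ?thesis by simp
  next
    case False
    with rel_entropy_nonneg[of \<rho> P] obtain H where H: "rel_entropy \<rho> P = ereal H"
      using assms(1-4) by (cases "rel_entropy \<rho> P") auto
    have DV: "(\<integral>x. g x \<partial>\<rho>) \<le> H + ln (\<integral>x. exp (g x) \<partial>P)"
      if "g \<in> borel_measurable P" "\<And>x. \<bar>g x\<bar> \<le> D" for g D
      using donsker_varadhan[OF assms(1,2,4) that] by (simp add: H)
    have "rel_entropy (distr \<rho> Q X) Q \<le> ereal ((1 + 1 / \<gamma>) * H + ln L / \<gamma>)"
    proof (rule rel_entropy_le_of_donsker_varadhan)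
      fix g :: "'b \<Rightarrow> real" and D assume g [measurable]: "g \<in> borel_measurable Q" and D: "\<And>x. \<bar>g x\<bar> \<le> D"
      have int: "integrable \<rho> (\<lambda>x. g (X x))" "integrable \<rho> b"
        by (rule \<rho>.integrable_const_bound[where B=D] \<rho>.integrable_const_bound[where B=B];
          use D b in simp)+
      have bd: "\<bar>g (X x) - b x\<bar> \<le> D + B" for x
        using D[of "X x"] b(2)[of x] by linarith
      have bd': "\<bar>\<gamma> * b x\<bar> \<le> \<gamma> * B" for x
        using b(2)[of x] \<gamma> by (simp add: abs_mult)
      have "\<gamma> * (\<integral>x. b x \<partial>\<rho>) \<le> H + ln (\<integral>x. exp (\<gamma> * b x) \<partial>P)"
        using DV[OF _ bd'] by simp
      also have "\<dots> \<le> H + ln L"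
        using mom exp_pos[OF _ bd'] by (intro add_left_mono ln_mono) auto
      finally have 1: "(\<integral>x. b x \<partial>\<rho>) \<le> (H + ln L) / \<gamma>"
        using \<gamma> by (simp add: field_simps)
      have "(\<integral>y. g y \<partial>distr \<rho> Q X) = (\<integral>x. g (X x) \<partial>\<rho>)"
        by (rule integral_distr) measurable
      also have "\<dots> = (\<integral>x. g (X x) - b x \<partial>\<rho>) + (\<integral>x. b x \<partial>\<rho>)"
        using int by simp
      also have "(\<integral>x. g (X x) - b x \<partial>\<rho>) \<le> H + ln (\<integral>x. exp (g (X x) - b x) \<partial>P)"
        by (rule DV[OF _ bd]) measurable
      also have "ln (\<integral>x. exp (g (X x) - b x) \<partial>P) \<le> ln (\<integral>y. exp (g y) \<partial>Q)"
        using dom[OF g D] exp_pos[OF _ bd] by (intro ln_mono) auto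
      finally have "(\<integral>y. g y \<partial>distr \<rho> Q X) \<le> H + ln (\<integral>y. exp (g y) \<partial>Q) + (\<integral>x. b x \<partial>\<rho>)" by simp
      with 1 show "(\<integral>y. g y \<partial>distr \<rho> Q X) \<le> ((1 + 1 / \<gamma>) * H + ln L / \<gamma>) + ln (\<integral>y. exp (g y) \<partial>Q)"
        by (simp add: add_divide_distrib distrib_right)
    qed (use \<rho>.prob_space_distr[OF X'] assms in auto)
    then show ?thesis by (simp add: H)
  qed
qed

section \<open>Exponential moments of squared sums\<close>

text \<open>The integrand is \<open>\<sigma>\<close> times the normal density of variance
  \<open>1 / (1 - 2 * q)\<close>, and \<open>q \<le> 1/4\<close> keeps
  \<open>\<sigma> \<le> 2\<close>.\<close>

lemma nn_integral_normal_exp_square: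
  fixes q :: real
  assumes q: "0 \<le> q" "q \<le> 1/4"
  shows "(\<integral>\<^sup>+z. ennreal (std_normal_density z * exp (q * z\<^sup>2)) \<partial>lborel) \<le> 2"
proof -
  define \<sigma> where "\<sigma> = 1 / sqrt (1 - 2 * q)"
  have pos: "0 < 1 - 2 * q" using q by simp
  then have \<sigma>: "\<sigma> > 0" "\<sigma>\<^sup>2 = 1 / (1 - 2 * q)" by (simp_all add: \<sigma>_def power_divide)
  have "sqrt (1/4) \<le> sqrt (1 - 2 * q)" using q by (intro real_sqrt_le_mono) simp
  then have "\<sigma> \<le> 2" using pos by (simp add: \<sigma>_def real_sqrt_divide field_simps)
  have "std_normal_density z * exp (q * z\<^sup>2) = \<sigma> * normal_density 0 \<sigma> z" for z
  proof -
    have "- z\<^sup>2 / 2 + q * z\<^sup>2 = - z\<^sup>2 / (2 * \<sigma>\<^sup>2)"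
      using pos unfolding \<sigma>(2) by (simp add: field_simps)
    then show ?thesis
      using \<sigma>(1) by (simp add: normal_density_def real_sqrt_mult exp_add[symmetric])
  qed
  then have "(\<integral>\<^sup>+z. ennreal (std_normal_density z * exp (q * z\<^sup>2)) \<partial>lborel)
      = ennreal \<sigma> * (\<integral>\<^sup>+z. ennreal (normal_density 0 \<sigma> z) \<partial>lborel)"
    using \<sigma>(1) by (simp add: ennreal_mult nn_integral_cmult)
  also have "(\<integral>\<^sup>+z. ennreal (normal_density 0 \<sigma> z) \<partial>lborel) = 1"
    using prob_space.emeasure_space_1[OF prob_space_normal_density[OF \<sigma>(1), of 0]]
    by (simp add: emeasure_density)
  finally show ?thesis using \<open>\<sigma> \<le> 2\<close> by (simp add: ennreal_le_iff flip: ennreal_numeral)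
qed

lemma nn_integral_normal_exp_linear:
  "(\<integral>\<^sup>+z. ennreal (std_normal_density z * exp (r * z)) \<partial>lborel) = ennreal (exp (r\<^sup>2 / 2))"
proof -
  have "std_normal_density z * exp (r * z) = exp (r\<^sup>2 / 2) * normal_density r 1 z" for z
  proof -
    have "- z\<^sup>2 / 2 + r * z = r\<^sup>2 / 2 + - (z - r)\<^sup>2 / 2"
      by (simp add: power2_eq_square field_simps)
    then show ?thesis
      by (simp add: normal_density_def exp_add[symmetric])
  qed
  then have "(\<integral>\<^sup>+z. ennreal (std_normal_density z * exp (r * z)) \<partial>lborel)
      = ennreal (exp (r\<^sup>2 / 2)) * (\<integral>\<^sup>+z. ennreal (normal_density r 1 z) \<partial>lborel)"
    by (simp add: ennreal_mult nn_integral_cmult)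
  also have "(\<integral>\<^sup>+z. ennreal (normal_density r 1 z) \<partial>lborel) = 1"
    using prob_space.emeasure_space_1[OF prob_space_normal_density[of 1 r]]
    by (simp add: emeasure_density)
  finally show ?thesis by simp
qed

text \<open>Hoeffding's lemma on \<open>[- b, b]\<close>: the squared length
  \<open>4 * b\<^sup>2\<close> turns its factor \<open>1/8\<close> into \<open>1/2\<close>. A
  negative \<open>r\<close> is moved into the sign of \<open>a\<close>.\<close>

lemma (in prob_space) nn_integral_exp_centered_le:
  assumes a [measurable]: "a \<in> borel_measurable M" and b: "\<And>x. \<bar>a x\<bar> \<le> b"
    and mean: "expectation a = 0"
  shows "(\<integral>\<^sup>+x. ennreal (exp (r * a x)) \<partial>M) \<le> ennreal (exp (r\<^sup>2 * b\<^sup>2 / 2))"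
proof -
  have pos: "(\<integral>\<^sup>+x. ennreal (exp (r * a x)) \<partial>M) \<le> ennreal (exp (r\<^sup>2 * b\<^sup>2 / 2))"
    if "r > 0" and [measurable]: "a \<in> borel_measurable M" and b: "\<And>x. \<bar>a x\<bar> \<le> b"
      and mean: "expectation a = 0" for r a
  proof -
    interpret interval_bounded_random_variable M a "- b" b
      by unfold_locales (use b in \<open>auto simp: abs_le_iff minus_le_iff\<close>)
    show ?thesis
      using Hoeffdings_lemma_nn_integral_0[OF that(1) mean] by (simp add: power_mult_distrib mult.commute flip: mult_2)
  qed
  consider "r = 0" | "r > 0" | "- r > 0" by linarith
  then show ?thesis
  proof cases
    case 1
    then show ?thesis by (simp add: emeasure_space_1)
  next
    case 2
    then show ?thesis using pos assms by blast
  next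
    case 3
    then show ?thesis using pos[of "- r" "\<lambda>x. - a x"] assms by simp
  qed
qed

text \<open>The square is linearised by averaging \<open>exp (r z)\<close> over a Gaussian variable \<open>z\<close>.\<close>
lemma exp_moment_square_sum:
  assumes m: "prob_space m" and a: "a \<in> borel_measurable m" "\<And>x. \<bar>a x\<bar> \<le> b" "(\<integral>x. a x \<partial>m) = 0"
    and c: "0 \<le> c" "c * b\<^sup>2 \<le> 1/4" and N: "N \<ge> 1"
  shows "(\<integral>\<^sup>+x. ennreal (exp (c * (\<Sum>i<N. a (x i))\<^sup>2 / real N)) \<partial>Pi\<^sub>M {..<N} (\<lambda>_. m)) \<le> 2"
proof -
  interpret m: prob_space m by fact
  interpret product_sigma_finite "\<lambda>_::nat. m" by standard
  interpret P: prob_space "Pi\<^sub>M {..<N} (\<lambda>_. m)" by (intro prob_space_PiM m)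
  interpret pair_sigma_finite lborel "Pi\<^sub>M {..<N} (\<lambda>_. m)" ..
  note [measurable] = a(1)
  \<comment> \<open>Chosen so that the Gaussian mean of \<open>exp (r * S x * z)\<close>, namely
    \<open>exp ((r * S x)\<^sup>2 / 2)\<close>, is the exponential to be estimated.\<close>
  define r where "r = sqrt (2 * c / real N)"
  have r2: "r\<^sup>2 = 2 * c / real N" using c by (simp add: r_def)
  define S where "S x = (\<Sum>i<N. a (x i))" for x
  have [measurable]: "S \<in> borel_measurable (Pi\<^sub>M {..<N} (\<lambda>_. m))"
    unfolding S_def by measurable
  have "(\<integral>\<^sup>+x. ennreal (exp (c * (S x)\<^sup>2 / real N)) \<partial>Pi\<^sub>M {..<N} (\<lambda>_. m))
     = (\<integral>\<^sup>+x. (\<integral>\<^sup>+z. ennreal (std_normal_density z * exp (r * S x * z)) \<partial>lborel) \<partial>Pi\<^sub>M {..<N} (\<lambda>_. m))"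
    by (simp add: nn_integral_normal_exp_linear power_mult_distrib r2)
  also have "\<dots> = (\<integral>\<^sup>+z. (\<integral>\<^sup>+x. ennreal (std_normal_density z * exp (r * S x * z)) \<partial>Pi\<^sub>M {..<N} (\<lambda>_. m)) \<partial>lborel)"
    by (rule Fubini') measurable
  also have "\<dots> \<le> (\<integral>\<^sup>+z. ennreal (std_normal_density z * exp ((c * b\<^sup>2) * z\<^sup>2)) \<partial>lborel)"
  proof (rule nn_integral_mono)
    fix z :: real
    have "(\<integral>\<^sup>+x. ennreal (std_normal_density z * exp (r * S x * z)) \<partial>Pi\<^sub>M {..<N} (\<lambda>_. m))
      = ennreal (std_normal_density z) * (\<integral>\<^sup>+x. (\<Prod>i<N. ennreal (exp ((r * z) * a (x i)))) \<partial>Pi\<^sub>M {..<N} (\<lambda>_. m))"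
      by (simp add: ennreal_mult nn_integral_cmult prod_ennreal exp_sum[symmetric] S_def
          sum_distrib_left sum_distrib_right mult_ac)
    also have "(\<integral>\<^sup>+x. (\<Prod>i<N. ennreal (exp ((r * z) * a (x i)))) \<partial>Pi\<^sub>M {..<N} (\<lambda>_. m))
      = (\<Prod>i<N. \<integral>\<^sup>+x. ennreal (exp ((r * z) * a x)) \<partial>m)"
      by (rule product_nn_integral_prod) auto
    also have "\<dots> \<le> (\<Prod>i<N. ennreal (exp ((r * z)\<^sup>2 * b\<^sup>2 / 2)))"
      by (intro prod_mono_ennreal m.nn_integral_exp_centered_le a)
    \<comment> \<open>The \<open>N\<close> factors cancel the \<open>1/N\<close> in
      \<open>r\<^sup>2\<close>, which makes the bound independent of \<open>N\<close>.\<close>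
    also have "\<dots> = ennreal (exp ((c * b\<^sup>2) * z\<^sup>2))"
      using N by (simp add: prod_ennreal exp_of_nat_mult[symmetric] ennreal_power power_mult_distrib r2 mult_ac)
    finally show "(\<integral>\<^sup>+x. ennreal (std_normal_density z * exp (r * S x * z)) \<partial>Pi\<^sub>M {..<N} (\<lambda>_. m))
        \<le> ennreal (std_normal_density z * exp ((c * b\<^sup>2) * z\<^sup>2))"
      by (simp add: ennreal_mult mult_left_mono)
  qed
  also have "\<dots> \<le> 2"
    using c by (intro nn_integral_normal_exp_square) auto
  finally show ?thesis by (simp add: S_def)
qed

section \<open>Calculus on the circle\<close>

definition has_circle_deriv :: "(circle \<Rightarrow> real) \<Rightarrow> (circle \<Rightarrow> real) \<Rightarrow> bool" where
  "has_circle_deriv f f' \<longleftrightarrow> (\<forall>x. ((\<lambda>s. f (x \<oplus> s)) has_real_derivative f' x) (at 0))"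

lemma has_circle_derivD:
  assumes "has_circle_deriv f f'"
  shows "((\<lambda>s. f (x \<oplus> s)) has_real_derivative f' (x \<oplus> s)) (at s)"
proof -
  have "((\<lambda>r. f (x \<oplus> (r + s))) has_real_derivative f' (x \<oplus> s)) (at 0)"
    using assms[unfolded has_circle_deriv_def, rule_format, of "x \<oplus> s"] by (simp add: add.commute)
  then show ?thesis
    using DERIV_shift[of "\<lambda>s. f (x \<oplus> s)" "f' (x \<oplus> s)" 0 s] by simp
qed

lemma circle_mvt:
  assumes "has_circle_deriv f f'"
  obtains \<xi> where "\<bar>\<xi>\<bar> \<le> \<bar>s\<bar>" "f (x \<oplus> s) - f x = s * f' (x \<oplus> \<xi>)"
proof -
  consider "s = 0" | "0 < s" | "s < 0" by linarith
  then show thesis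
  proof cases
    case 1
    then show ?thesis by (intro that[of 0]) auto
  next
    case 2
    from MVT2[OF this has_circle_derivD[OF assms, of x]] obtain \<xi> where
      "0 < \<xi>" "\<xi> < s" "f (x \<oplus> s) - f (x \<oplus> 0) = (s - 0) * f' (x \<oplus> \<xi>)" by blast
    then show ?thesis by (intro that[of \<xi>]) auto
  next
    case 3
    from MVT2[OF this has_circle_derivD[OF assms, of x]] obtain \<xi> where
      "s < \<xi>" "\<xi> < 0" "f (x \<oplus> 0) - f (x \<oplus> s) = (0 - s) * f' (x \<oplus> \<xi>)" by blast
    then show ?thesis by (intro that[of \<xi>]) auto
  qed
qed

lemma circle_lipschitz:
  assumes "has_circle_deriv f f'" and B: "\<And>x. \<bar>f' x\<bar> \<le> B"
  shows "\<bar>f (x \<oplus> s) - f x\<bar> \<le> B * \<bar>s\<bar>"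
proof -
  obtain \<xi> where "f (x \<oplus> s) - f x = s * f' (x \<oplus> \<xi>)"
    using circle_mvt[OF assms(1)] by metis
  then show ?thesis
    using mult_right_mono[OF B abs_ge_zero, of "x \<oplus> \<xi>" s] by (simp add: abs_mult mult.commute)
qed

lemma circle_taylor:
  assumes f: "has_circle_deriv f f'" and B: "\<And>x s. \<bar>f' (x \<oplus> s) - f' x\<bar> \<le> B * \<bar>s\<bar>"
  shows "\<bar>f (x \<oplus> s) - f x - s * f' x\<bar> \<le> B * s\<^sup>2"
proof -
  obtain \<xi> where \<xi>: "\<bar>\<xi>\<bar> \<le> \<bar>s\<bar>" "f (x \<oplus> s) - f x = s * f' (x \<oplus> \<xi>)"
    using circle_mvt[OF f] by metis
  have "0 \<le> B" using B[of x 1] by simp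
  have "\<bar>f (x \<oplus> s) - f x - s * f' x\<bar> = \<bar>s\<bar> * \<bar>f' (x \<oplus> \<xi>) - f' x\<bar>"
    by (simp add: \<xi>(2) abs_mult[symmetric] right_diff_distrib)
  also have "\<dots> \<le> \<bar>s\<bar> * (B * \<bar>s\<bar>)"
    using B[of x \<xi>] \<xi>(1) \<open>0 \<le> B\<close> by (intro mult_left_mono) (auto intro: order_trans mult_left_mono)
  finally show ?thesis by (simp add: power2_eq_square mult_ac)
qed

text \<open>A uniform quadratic remainder survives integration over a parameter, so the derivative
  of a parameter integral can be read off from a Taylor bound on the integrand.\<close>

lemma has_circle_derivI_taylor:
  assumes "\<And>x s. \<bar>f (x \<oplus> s) - f x - s * f' x\<bar> \<le> B * s\<^sup>2"
  shows "has_circle_deriv f f'"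
  unfolding has_circle_deriv_def DERIV_def
proof
  fix x
  show "(\<lambda>s. (f (x \<oplus> (0 + s)) - f (x \<oplus> 0)) / s) \<midarrow>0\<rightarrow> f' x"
  proof (rule LIM_zero_cancel, rule Lim_null_comparison)
    show "\<forall>\<^sub>F s in at 0. norm ((f (x \<oplus> (0 + s)) - f (x \<oplus> 0)) / s - f' x) \<le> B * \<bar>s\<bar>"
      unfolding eventually_at_filter
    proof (intro always_eventually allI impI)
      fix s :: real assume s: "s \<noteq> 0"
      then have "(f (x \<oplus> (0 + s)) - f (x \<oplus> 0)) / s - f' x = (f (x \<oplus> s) - f x - s * f' x) / s"
        by (simp add: field_simps)
      then show "norm ((f (x \<oplus> (0 + s)) - f (x \<oplus> 0)) / s - f' x) \<le> B * \<bar>s\<bar>"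
        using assms[of x s] s by (simp add: field_simps power2_eq_square abs_mult[symmetric])
    qed
    have "((\<lambda>s. B * \<bar>s\<bar>) \<longlongrightarrow> B * \<bar>0\<bar>) (at (0::real))"
      by (intro tendsto_intros)
    then show "((\<lambda>s. B * \<bar>s\<bar>) \<longlongrightarrow> 0) (at (0::real))" by simp
  qed
qed

text \<open>The weight cuts the circle at its origin and reduces the claim to the fundamental
  theorem on \<open>[0, b]\<close>. It is the kernel \<open>below\<close> of the later partial
  integration; \<open>b = 1\<close> is the full period.\<close>

lemma integral_circle_deriv:
  assumes f: "has_circle_deriv f f'" and [measurable]: "f' \<in> borel_measurable borel"
    and B: "\<And>x. \<bar>f' x\<bar> \<le> B" and b: "0 \<le> b" "b \<le> 1"
  shows "(\<integral>t. f' t * (if circle_coord t < b then 1 else 0) \<partial>circle_lebesgue) = f (to_circle b) - f (to_circle 0)"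
proof -
  define g where "g s = f' (to_circle s) * indicator {0..b} s" for s
  have "((\<lambda>s. f (to_circle s)) has_real_derivative f' (to_circle s)) (at s)" for s
    using has_circle_derivD[OF f, of "to_circle 0" s] by simp
  then have FTC: "((\<lambda>s. f' (to_circle s)) has_integral f (to_circle b) - f (to_circle 0)) {0..b}"
    by (intro fundamental_theorem_of_calculus b)
      (auto simp: has_real_derivative_iff_has_vector_derivative[symmetric] intro: has_field_derivative_at_within)
  have "(g has_integral f (to_circle b) - f (to_circle 0)) UNIV"
  proof -
    have "g = (\<lambda>s. if s \<in> {0..b} then f' (to_circle s) else 0)"
      by (auto simp: g_def fun_eq_iff)
    then show ?thesis
      using FTC by (simp only: has_integral_restrict_UNIV)
  qed
  moreover have g_int: "integrable lborel g"
  proof (rule Bochner_Integration.integrable_bound[where f = "\<lambda>s. B * indicator {0..b} s"])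
    show "AE s in lborel. norm (g s) \<le> norm (B * indicator {0..b} s)"
      using B by (intro AE_I2) (auto simp: g_def indicator_def intro: order_trans[OF _ abs_ge_self])
    show "g \<in> borel_measurable lborel" unfolding g_def by measurable
  qed (use b in auto)
  ultimately have g_eq: "integral\<^sup>L lborel g = f (to_circle b) - f (to_circle 0)"
    using has_integral_integral_lborel[OF g_int] has_integral_unique by blast
  have "(\<integral>t. f' t * (if circle_coord t < b then 1 else 0) \<partial>circle_lebesgue) =
     (\<integral>s. f' (to_circle s) * (if circle_coord (to_circle s) < b then 1 else 0) * indicator {0..<1} s \<partial>lborel)"
    by (rule integral_circle_lebesgue) measurable
  also have "\<dots> = integral\<^sup>L lborel g"
  proof (rule integral_cong_AE)
    show "AE s in lborel. f' (to_circle s) * (if circle_coord (to_circle s) < b then 1 else 0) * indicator {0..<1} s = g s"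
      using AE_lborel_singleton[of b]
    proof eventually_elim
      case (elim s)
      then show ?case
        using b by (auto simp: g_def indicator_def circle_coord_to_circle frac_eq[THEN iffD2])
    qed
    show "g \<in> borel_measurable lborel" unfolding g_def by measurable
  qed measurable
  finally show ?thesis using g_eq by simp
qed

lemma integral_circle_deriv_eq_0:
  assumes "has_circle_deriv f f'" and "f' \<in> borel_measurable borel" and "\<And>x. \<bar>f' x\<bar> \<le> B"
  shows "(\<integral>t. f' t \<partial>circle_lebesgue) = 0"
  using integral_circle_deriv[OF assms, of 1] to_circle_add_1[of 0] by simp

section \<open>Derivatives and pointwise bounds from the C^k norms of lifts\<close>

definition circle_deriv :: "(circle \<Rightarrow> real) \<Rightarrow> circle \<Rightarrow> real" where
  "circle_deriv f x = deriv (\<lambda>s. f (x \<oplus> s)) 0"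

definition deriv_1 :: "(circle \<Rightarrow> circle \<Rightarrow> real) \<Rightarrow> circle \<Rightarrow> circle \<Rightarrow> real" where
  "deriv_1 h x y = circle_deriv (\<lambda>x. h x y) x"

definition deriv_2 :: "(circle \<Rightarrow> circle \<Rightarrow> real) \<Rightarrow> circle \<Rightarrow> circle \<Rightarrow> real" where
  "deriv_2 h x y = circle_deriv (h x) y"

definition circle_Ck :: "nat \<Rightarrow> real \<Rightarrow> (circle \<Rightarrow> real) \<Rightarrow> bool" where
  "circle_Ck k B f \<longleftrightarrow> C_diff k (lift1 f) \<and> C_norm k (lift1 f) \<le> B"

definition torus_Ck :: "nat \<Rightarrow> real \<Rightarrow> (circle \<Rightarrow> circle \<Rightarrow> real) \<Rightarrow> bool" where
  "torus_Ck k B h \<longleftrightarrow> C_diff k (lift2 h) \<and> C_norm k (lift2 h) \<le> B"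

lemma C_diff_continuous: "C_diff k f \<Longrightarrow> continuous_on UNIV f"
  by (cases k) auto

lemma C_norm_ge_SUP: "(SUP x. \<bar>f x\<bar>) \<le> C_norm k f"
  by (cases k) auto

lemma C_norm_partial_deriv_le: "b \<in> Basis \<Longrightarrow> C_norm k (partial_deriv b f) \<le> C_norm (Suc k) f"
  unfolding C_norm.simps by (rule Max_ge) auto

lemma partial_deriv_lift1: "partial_deriv 1 (lift1 f) = lift1 (circle_deriv f)"
  by (simp add: fun_eq_iff partial_deriv_def lift1_def circle_deriv_def)

lemma partial_deriv_lift2:
  "partial_deriv (1, 0) (lift2 h) = lift2 (deriv_1 h)"
  "partial_deriv (0, 1) (lift2 h) = lift2 (deriv_2 h)"
  by (simp_all add: fun_eq_iff partial_deriv_def lift2_def deriv_1_def deriv_2_def circle_deriv_def)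

lemma Basis_real_pair: "(1, 0) \<in> (Basis :: (real \<times> real) set)" "(0, 1) \<in> (Basis :: (real \<times> real) set)"
  by (auto simp: Basis_prod_def)

lemma circle_Ck_continuous: "circle_Ck k B f \<Longrightarrow> continuous_on UNIV (lift1 f)"
  unfolding circle_Ck_def using C_diff_continuous by blast

lemma torus_Ck_continuous: "torus_Ck k B h \<Longrightarrow> continuous_on UNIV (lift2 h)"
  unfolding torus_Ck_def using C_diff_continuous by blast

text \<open>The supremum in \<open>C_norm\<close> dominates the values only if the function is
  bounded. Compactness of \<open>[0, 1]\<close> together with periodicity supplies this.\<close>

lemma circle_Ck_bound:
  assumes "circle_Ck k B f"
  shows "\<bar>f x\<bar> \<le> B"
proof -
  have f: "f y = lift1 f (circle_coord y)" for y by (simp add: lift1_def)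
  have "compact (lift1 f ` {0..1})"
    by (intro compact_continuous_image continuous_on_subset[OF circle_Ck_continuous[OF assms]]) auto
  then obtain D where D: "\<And>y. y \<in> lift1 f ` {0..1} \<Longrightarrow> \<bar>y\<bar> \<le> D"
    using compact_imp_bounded bounded_iff by (metis real_norm_def)
  have "\<bar>lift1 f s\<bar> \<le> D" for s
    using D[of "f (to_circle s)"] unfolding lift1_def[of f s]
    by (metis f atLeastAtMost_iff circle_coord_ge_0 circle_coord_lt_1 image_eqI less_imp_le)
  then have "bdd_above (range (\<lambda>s. \<bar>lift1 f s\<bar>))" by (rule bdd_aboveI2)
  then have "\<bar>lift1 f (circle_coord x)\<bar> \<le> (SUP s. \<bar>lift1 f s\<bar>)" by (rule cSUP_upper[rotated]) simp
  with C_norm_ge_SUP[of "lift1 f" k] assms show ?thesis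
    by (simp add: f[symmetric] circle_Ck_def)
qed

lemma torus_Ck_bound:
  assumes "torus_Ck k B h"
  shows "\<bar>h x y\<bar> \<le> B"
proof -
  have h: "h x y = lift2 h (circle_coord x, circle_coord y)" for x y by (simp add: lift2_def)
  have "compact (lift2 h ` ({0..1} \<times> {0..1}))"
    by (intro compact_continuous_image continuous_on_subset[OF torus_Ck_continuous[OF assms]] compact_Times) auto
  then obtain D where D: "\<And>y. y \<in> lift2 h ` ({0..1} \<times> {0..1}) \<Longrightarrow> \<bar>y\<bar> \<le> D"
    using compact_imp_bounded bounded_iff by (metis real_norm_def)
  have "\<bar>lift2 h p\<bar> \<le> D" for p
  proof -
    have "lift2 h p = lift2 h (circle_coord (to_circle (fst p)), circle_coord (to_circle (snd p)))"
      by (simp add: lift2_def)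
    also have "\<bar>\<dots>\<bar> \<le> D"
      by (intro D imageI) (simp add: less_imp_le)
    finally show ?thesis .
  qed
  then have "bdd_above (range (\<lambda>s. \<bar>lift2 h s\<bar>))" by (rule bdd_aboveI2)
  then have "\<bar>lift2 h (circle_coord x, circle_coord y)\<bar> \<le> (SUP s. \<bar>lift2 h s\<bar>)" by (rule cSUP_upper[rotated]) simp
  with C_norm_ge_SUP[of "lift2 h" k] assms show ?thesis
    by (simp add: h[symmetric] torus_Ck_def)
qed

lemma circle_Ck_measurable:
  assumes "circle_Ck k B f"
  shows "f \<in> borel_measurable borel"
proof -
  have "f = (\<lambda>y. lift1 f (circle_coord y))" by (simp add: lift1_def)
  moreover have "lift1 f \<in> borel_measurable borel"
    by (rule borel_measurable_continuous_onI[OF circle_Ck_continuous[OF assms]])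
  ultimately show ?thesis by (metis measurable_compose measurable_circle_coord)
qed

lemma torus_Ck_measurable:
  assumes "torus_Ck k B h" and [measurable]: "f \<in> M \<rightarrow>\<^sub>M borel" "g \<in> M \<rightarrow>\<^sub>M borel"
  shows "(\<lambda>z. h (f z) (g z)) \<in> borel_measurable M"
proof -
  have eq: "(\<lambda>z. h (f z) (g z)) = (\<lambda>z. lift2 h (circle_coord (f z), circle_coord (g z)))"
    by (simp add: lift2_def)
  have lift: "lift2 h \<in> borel_measurable borel"
    by (rule borel_measurable_continuous_onI[OF torus_Ck_continuous[OF assms(1)]])
  have pair: "(\<lambda>z. (circle_coord (f z), circle_coord (g z))) \<in> M \<rightarrow>\<^sub>M borel"
    by (intro borel_measurable_Pair) measurable
  show ?thesis unfolding eq by (rule measurable_compose[OF pair lift])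
qed

lemma circle_Ck_deriv:
  assumes "circle_Ck (Suc k) B f"
  shows "circle_Ck k B (circle_deriv f)" "has_circle_deriv f (circle_deriv f)"
proof -
  show "circle_Ck k B (circle_deriv f)"
    using assms C_norm_partial_deriv_le[of 1 k "lift1 f"]
    by (auto simp: circle_Ck_def partial_deriv_lift1[symmetric] simp del: C_norm.simps)
  have "(\<lambda>s. lift1 f (circle_coord x + s *\<^sub>R 1)) differentiable (at 0)" for x
    using assms by (simp add: circle_Ck_def)
  moreover have "lift1 f (circle_coord x + s *\<^sub>R 1) = f (x \<oplus> s)" for x s
    using translate_to_circle[of "circle_coord x" s] by (simp add: lift1_def)
  ultimately show "has_circle_deriv f (circle_deriv f)"
    by (simp add: has_circle_deriv_def circle_deriv_def real_differentiable_def DERIV_deriv_iff_real_differentiable)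
qed

lemma torus_Ck_deriv:
  assumes "torus_Ck (Suc k) B h"
  shows "torus_Ck k B (deriv_1 h)" "torus_Ck k B (deriv_2 h)"
    "has_circle_deriv (\<lambda>x. h x y) (\<lambda>x. deriv_1 h x y)" "has_circle_deriv (h x) (deriv_2 h x)"
proof -
  have C: "C_diff (Suc k) (lift2 h)" "C_norm (Suc k) (lift2 h) \<le> B"
    using assms by (simp_all only: torus_Ck_def)
  have "C_diff k (partial_deriv b (lift2 h))" "C_norm k (partial_deriv b (lift2 h)) \<le> B"
    if "b \<in> Basis" for b
    using C that C_norm_partial_deriv_le[OF that, of k "lift2 h"] by auto
  from this[OF Basis_real_pair(1)] this[OF Basis_real_pair(2)]
  show "torus_Ck k B (deriv_1 h)" "torus_Ck k B (deriv_2 h)"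
    by (simp_all only: torus_Ck_def partial_deriv_lift2)
  have D: "(\<lambda>s. lift2 h (p + s *\<^sub>R b)) differentiable (at 0)" if "b \<in> Basis" for p b
    using C(1) that unfolding C_diff.simps by blast
  have D1: "(\<lambda>s. h (x \<oplus> s) y) differentiable (at 0)" for x y
    using D[OF Basis_real_pair(1), of "(circle_coord x, circle_coord y)"]
      translate_to_circle[of "circle_coord x"] by (simp add: lift2_def)
  have D2: "(\<lambda>s. h x (y \<oplus> s)) differentiable (at 0)" for x y
    using D[OF Basis_real_pair(2), of "(circle_coord x, circle_coord y)"]
      translate_to_circle[of "circle_coord y"] by (simp add: lift2_def)
  show "has_circle_deriv (\<lambda>x. h x y) (\<lambda>x. deriv_1 h x y)" "has_circle_deriv (h x) (deriv_2 h x)"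
    using D1 D2
    by (simp_all add: has_circle_deriv_def deriv_1_def deriv_2_def circle_deriv_def DERIV_deriv_iff_real_differentiable)
qed

section \<open>The mean-field shift\<close>

lemma (in prob_space) abs_expectation_le:
  fixes f :: "'a \<Rightarrow> real"
  assumes "f \<in> borel_measurable M" "\<And>x. \<bar>f x\<bar> \<le> B"
  shows "\<bar>expectation f\<bar> \<le> B"
proof -
  have "integrable M f" using assms by (intro integrable_const_bound[where B=B]) auto
  then have "norm (expectation f) \<le> expectation (\<lambda>x. norm (f x))" by simp
  also have "\<dots> \<le> expectation (\<lambda>_. B)"
    using assms \<open>integrable M f\<close> by (intro integral_mono) auto
  finally show ?thesis by (simp add: prob_space)
qed

lemma quotient_lipschitz:
  fixes u u' v v' :: real
  assumes "\<bar>u' - u\<bar> \<le> A * r" "\<bar>v' - v\<bar> \<le> B * r" "\<bar>u\<bar> \<le> D" "c \<le> v" "c \<le> v'" "0 < c" "0 \<le> r"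
  shows "\<bar>u' / v' - u / v\<bar> \<le> (A / c + D * B / c\<^sup>2) * r"
proof -
  have "0 < v" "0 < v'" using assms by auto
  then have "u' / v' - u / v = (u' - u) / v' + u * (v - v') / (v * v')"
    by (simp add: field_simps)
  also have "\<bar>\<dots>\<bar> \<le> \<bar>u' - u\<bar> / v' + \<bar>u\<bar> * \<bar>v' - v\<bar> / (v * v')"
    using \<open>0 < v\<close> \<open>0 < v'\<close> by (intro order_trans[OF abs_triangle_ineq]) (simp add: abs_mult abs_minus_commute)
  also have "\<dots> \<le> A * r / c + D * (B * r) / (c * c)"
    using assms by (intro add_mono frac_le mult_mono) (auto intro: order_trans[OF abs_ge_zero])
  finally show ?thesis by (simp add: field_simps power2_eq_square)
qed

text \<open>The data of one time step. \<open>1 \<le> M\<close> gives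
  \<open>\<Delta> \<le> \<Delta> * M\<close>, and \<open>1 / 64\<close> is the size at which the
  loss of the Jacobian inequality is absorbed in \<open>jac_lower\<close>.\<close>

locale mean_field =
  fixes h :: "circle \<Rightarrow> circle \<Rightarrow> real" and \<rho> :: "circle \<Rightarrow> real" and M \<kappa> K \<Delta> :: real
  assumes h: "torus_Ck 3 M h" and \<rho>: "circle_Ck 2 K \<rho>"
    and \<kappa>: "0 < \<kappa>" and \<rho>_ge: "\<And>x. \<kappa> \<le> \<rho> x"
    and prob: "prob_space (measure_of_density \<rho>)"
    and M: "1 \<le> M" and \<Delta>: "0 < \<Delta>" "\<Delta> * M \<le> 1 / 64"
begin

definition "\<mu> = measure_of_density \<rho>"
definition "h1 = deriv_1 h"
definition "h2 = deriv_2 h"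
definition "h11 = deriv_1 h1"
definition "h21 = deriv_1 h2"
definition "\<rho>1 = circle_deriv \<rho>"

sublocale \<mu>: prob_space \<mu> using prob by (simp add: \<mu>_def)

lemma sets_\<mu> [measurable_cong, simp]: "sets \<mu> = sets borel" "space \<mu> = UNIV"
  by (simp_all add: \<mu>_def measure_of_density_def)

lemma h_smooth:
  "torus_Ck (Suc (Suc (Suc 0))) M h" "torus_Ck (Suc (Suc 0)) M h1" "torus_Ck (Suc (Suc 0)) M h2"
  "torus_Ck (Suc 0) M h11" "torus_Ck (Suc 0) M h21"
proof -
  show h3: "torus_Ck (Suc (Suc (Suc 0))) M h" using h by (simp add: numeral_3_eq_3)
  show h1: "torus_Ck (Suc (Suc 0)) M h1" and h2: "torus_Ck (Suc (Suc 0)) M h2"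
    using torus_Ck_deriv(1,2)[OF h3] by (simp_all add: h1_def h2_def)
  show "torus_Ck (Suc 0) M h11" "torus_Ck (Suc 0) M h21"
    using torus_Ck_deriv(1)[OF h1] torus_Ck_deriv(1)[OF h2] by (simp_all add: h11_def h21_def)
qed

lemmas h_bounds = h_smooth[THEN torus_Ck_bound]
lemmas h_measurable [measurable (raw)] = h_smooth[THEN torus_Ck_measurable]

lemma \<rho>_smooth: "circle_Ck (Suc (Suc 0)) K \<rho>" "circle_Ck (Suc 0) K \<rho>1"
proof -
  show "circle_Ck (Suc (Suc 0)) K \<rho>" using \<rho> by (simp add: numeral_2_eq_2)
  from circle_Ck_deriv(1)[OF this] show "circle_Ck (Suc 0) K \<rho>1" by (simp add: \<rho>1_def)
qed

lemmas \<rho>_bounds = \<rho>_smooth[THEN circle_Ck_bound]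
lemmas \<rho>_measurable [measurable] = \<rho>_smooth[THEN circle_Ck_measurable]

lemma h_deriv: "has_circle_deriv (\<lambda>x. h x y) (\<lambda>x. h1 x y)" "has_circle_deriv (h x) (h2 x)"
  "has_circle_deriv (\<lambda>x. h1 x y) (\<lambda>x. h11 x y)" "has_circle_deriv (\<lambda>x. h2 x y) (\<lambda>x. h21 x y)"
  using torus_Ck_deriv(3,4)[OF h_smooth(1)] torus_Ck_deriv(3)[OF h_smooth(2)] torus_Ck_deriv(3)[OF h_smooth(3)]
  by (simp_all add: h1_def h2_def h11_def h21_def)

lemma h_lipschitz: "\<bar>h (x \<oplus> s) y - h x y\<bar> \<le> M * \<bar>s\<bar>" "\<bar>h x (y \<oplus> s) - h x y\<bar> \<le> M * \<bar>s\<bar>"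
  "\<bar>h1 (x \<oplus> s) y - h1 x y\<bar> \<le> M * \<bar>s\<bar>" "\<bar>h11 (x \<oplus> s) y - h11 x y\<bar> \<le> M * \<bar>s\<bar>"
  "\<bar>h21 (x \<oplus> s) y - h21 x y\<bar> \<le> M * \<bar>s\<bar>"
  using circle_lipschitz[OF h_deriv(1) h_bounds(2)] circle_lipschitz[OF h_deriv(2) h_bounds(3)]
    circle_lipschitz[OF h_deriv(3) h_bounds(4)]
    circle_lipschitz[OF torus_Ck_deriv(3)[OF h_smooth(4)] torus_Ck_bound[OF torus_Ck_deriv(1)[OF h_smooth(4)]]]
    circle_lipschitz[OF torus_Ck_deriv(3)[OF h_smooth(5)] torus_Ck_bound[OF torus_Ck_deriv(1)[OF h_smooth(5)]]]
  by auto

lemma h_taylor: "\<bar>h (x \<oplus> s) y - h x y - s * h1 x y\<bar> \<le> M * s\<^sup>2"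
  "\<bar>h1 (x \<oplus> s) y - h1 x y - s * h11 x y\<bar> \<le> M * s\<^sup>2"
  "\<bar>h2 (x \<oplus> s) y - h2 x y - s * h21 x y\<bar> \<le> M * s\<^sup>2"
  by (rule circle_taylor[OF h_deriv(1)] circle_taylor[OF h_deriv(3)] circle_taylor[OF h_deriv(4)];
      rule h_lipschitz)+

lemma integral_\<mu>: "f \<in> borel_measurable borel \<Longrightarrow> (\<integral>y. f y \<partial>\<mu>) = (\<integral>y. \<rho> y * f y \<partial>circle_lebesgue)" for f :: "circle \<Rightarrow> real"
proof -
  have "0 \<le> \<rho> y" for y using \<kappa> \<rho>_ge[of y] by linarith
  then show "f \<in> borel_measurable borel \<Longrightarrow> ?thesis"
    unfolding \<mu>_def measure_of_density_def by (subst integral_density) auto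
qed

text \<open>\<open>m\<close> is the mean-field drift, \<open>m1\<close> and \<open>m2\<close> are
  its first two derivatives, and \<open>slope\<close> is the derivative of the lift of the shift
  \<open>x \<oplus> \<Delta> * m x\<close>.\<close>

definition "m x = (\<integral>y. h x y \<partial>\<mu>)"
definition "m1 x = (\<integral>y. h1 x y \<partial>\<mu>)"
definition "m2 x = (\<integral>y. h11 x y \<partial>\<mu>)"
definition "slope x = 1 + \<Delta> * m1 x"
definition "\<epsilon> = \<Delta> * M"

lemma m_measurable [measurable]: "m \<in> borel_measurable borel" "m1 \<in> borel_measurable borel"
  "m2 \<in> borel_measurable borel" "slope \<in> borel_measurable borel"
  unfolding m_def[abs_def] m1_def[abs_def] m2_def[abs_def] slope_def[abs_def] by measurable

lemma h_integrable: "integrable \<mu> (h x)" "integrable \<mu> (h1 x)" "integrable \<mu> (h11 x)"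
  by (rule \<mu>.integrable_const_bound[where B=M]; use h_bounds in \<open>auto intro!: AE_I2\<close>)+

lemma m_bounds: "\<bar>m x\<bar> \<le> M" "\<bar>m1 x\<bar> \<le> M" "\<bar>m2 x\<bar> \<le> M"
  unfolding m_def m1_def m2_def by (rule \<mu>.abs_expectation_le; use h_bounds in auto)+

lemma m_taylor: "\<bar>m (x \<oplus> s) - m x - s * m1 x\<bar> \<le> M * s\<^sup>2" "\<bar>m1 (x \<oplus> s) - m1 x - s * m2 x\<bar> \<le> M * s\<^sup>2"
proof -
  have "m (x \<oplus> s) - m x - s * m1 x = (\<integral>y. h (x \<oplus> s) y - h x y - s * h1 x y \<partial>\<mu>)"
    unfolding m_def m1_def using h_integrable by simp
  also have "\<bar>\<dots>\<bar> \<le> M * s\<^sup>2"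
    by (rule \<mu>.abs_expectation_le[OF _ h_taylor(1)]) measurable
  finally show "\<bar>m (x \<oplus> s) - m x - s * m1 x\<bar> \<le> M * s\<^sup>2" .
  have "m1 (x \<oplus> s) - m1 x - s * m2 x = (\<integral>y. h1 (x \<oplus> s) y - h1 x y - s * h11 x y \<partial>\<mu>)"
    unfolding m1_def m2_def using h_integrable by simp
  also have "\<bar>\<dots>\<bar> \<le> M * s\<^sup>2"
    by (rule \<mu>.abs_expectation_le[OF _ h_taylor(2)]) measurable
  finally show "\<bar>m1 (x \<oplus> s) - m1 x - s * m2 x\<bar> \<le> M * s\<^sup>2" .
qed

lemma m_lipschitz: "\<bar>m (x \<oplus> s) - m x\<bar> \<le> M * \<bar>s\<bar>" "\<bar>m1 (x \<oplus> s) - m1 x\<bar> \<le> M * \<bar>s\<bar>"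
  "\<bar>m2 (x \<oplus> s) - m2 x\<bar> \<le> M * \<bar>s\<bar>"
proof -
  have "m (x \<oplus> s) - m x = (\<integral>y. h (x \<oplus> s) y - h x y \<partial>\<mu>)" "m1 (x \<oplus> s) - m1 x = (\<integral>y. h1 (x \<oplus> s) y - h1 x y \<partial>\<mu>)"
    "m2 (x \<oplus> s) - m2 x = (\<integral>y. h11 (x \<oplus> s) y - h11 x y \<partial>\<mu>)"
    unfolding m_def m1_def m2_def using h_integrable by simp_all
  then show "\<bar>m (x \<oplus> s) - m x\<bar> \<le> M * \<bar>s\<bar>" "\<bar>m1 (x \<oplus> s) - m1 x\<bar> \<le> M * \<bar>s\<bar>"
    "\<bar>m2 (x \<oplus> s) - m2 x\<bar> \<le> M * \<bar>s\<bar>"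
    using h_lipschitz(1,3,4) by (auto intro!: \<mu>.abs_expectation_le)
qed

lemma \<epsilon>: "0 < \<epsilon>" "\<epsilon> \<le> 1 / 64" "\<Delta> \<le> \<epsilon>"
  using M \<Delta> by (simp_all add: \<epsilon>_def)

lemma \<Delta>_abs_le: "\<bar>y\<bar> \<le> M * r \<Longrightarrow> \<bar>\<Delta> * y\<bar> \<le> \<epsilon> * r"
  using \<Delta>(1) by (simp add: abs_mult \<epsilon>_def mult.assoc)

lemma slope_bounds: "\<bar>slope x - 1\<bar> \<le> \<epsilon>" "1 / 2 \<le> slope x" "0 < slope x"
proof -
  show 1: "\<bar>slope x - 1\<bar> \<le> \<epsilon>" using \<Delta>_abs_le[of "m1 x" 1] m_bounds(2) by (simp add: slope_def)
  with \<epsilon> show "1 / 2 \<le> slope x" "0 < slope x" by linarith+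
qed

lemma slope_deriv: "has_circle_deriv slope (\<lambda>x. \<Delta> * m2 x)"
proof (rule has_circle_derivI_taylor)
  fix x s
  have "slope (x \<oplus> s) - slope x - s * (\<Delta> * m2 x) = \<Delta> * (m1 (x \<oplus> s) - m1 x - s * m2 x)"
    by (simp add: slope_def algebra_simps)
  then show "\<bar>slope (x \<oplus> s) - slope x - s * (\<Delta> * m2 x)\<bar> \<le> \<epsilon> * s\<^sup>2"
    using \<Delta>_abs_le[OF m_taylor(2)] by simp
qed

section \<open>The reference density and its logarithm after the shift\<close>

lemma \<rho>_pos: "0 < \<rho> x"
  using \<kappa> \<rho>_ge[of x] by linarith

lemma K_pos: "0 < K"
  using \<rho>_pos[of "to_circle 0"] \<rho>_bounds(1)[of "to_circle 0"] by linarith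

lemma \<rho>_deriv: "has_circle_deriv \<rho> \<rho>1"
  using circle_Ck_deriv(2)[OF \<rho>_smooth(1)] by (simp add: \<rho>1_def)

lemma \<rho>_lipschitz: "\<bar>\<rho> (x \<oplus> s) - \<rho> x\<bar> \<le> K * \<bar>s\<bar>" "\<bar>\<rho>1 (x \<oplus> s) - \<rho>1 x\<bar> \<le> K * \<bar>s\<bar>"
  using circle_lipschitz[OF \<rho>_deriv \<rho>_bounds(2)]
    circle_lipschitz[OF circle_Ck_deriv(2)[OF \<rho>_smooth(2)] circle_Ck_bound[OF circle_Ck_deriv(1)[OF \<rho>_smooth(2)]]]
  by auto

text \<open>The logarithm of the density of the image of \<open>\<mu>\<close> under the shift, at the image of a point.\<close>
definition "p x = ln (\<rho> x) - ln (slope x)"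
definition "p1 x = \<rho>1 x / \<rho> x - \<Delta> * m2 x / slope x"
text \<open>\<open>P1\<close> bounds \<open>p1\<close> and \<open>P2\<close> is a Lipschitz constant
  of it. The summand 1 pays for the term with \<open>slope\<close>, which is small by the choice of
  \<open>\<Delta>\<close>.\<close>

definition "P1 = K / \<kappa> + 1"
definition "P2 = K / \<kappa> + K\<^sup>2 / \<kappa>\<^sup>2 + 1"

lemma P_nonneg: "1 \<le> P1" "1 \<le> P2"
  using K_pos \<kappa> by (simp_all add: P1_def P2_def)

lemma p1_measurable [measurable]: "p1 \<in> borel_measurable borel"
  unfolding p1_def[abs_def] by measurable

lemma p1_bound: "\<bar>p1 x\<bar> \<le> P1"
proof -
  have "\<bar>\<rho>1 x / \<rho> x\<bar> \<le> K / \<kappa>"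
    using \<rho>_bounds(2)[of x] \<rho>_ge[of x] \<kappa> K_pos by (simp add: abs_div_pos[symmetric] \<rho>_pos frac_le)
  moreover have "\<bar>\<Delta> * m2 x / slope x\<bar> \<le> \<epsilon> / (1/2)"
    using \<Delta>_abs_le[of "m2 x" 1] m_bounds(3) slope_bounds[of x] \<epsilon>
    by (subst abs_divide) (intro frac_le, auto)
  ultimately show ?thesis
    using \<epsilon> abs_triangle_ineq4[of "\<rho>1 x / \<rho> x" "\<Delta> * m2 x / slope x"]
    unfolding p1_def P1_def by simp
qed

lemma p_deriv: "has_circle_deriv p p1"
  unfolding has_circle_deriv_def
proof
  fix x
  show "((\<lambda>s. p (x \<oplus> s)) has_real_derivative p1 x) (at 0)"
    unfolding p_def p1_def
    by (rule derivative_eq_intros refl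
        has_circle_derivD[OF \<rho>_deriv, where x = x and s = 0, unfolded translate_0]
        has_circle_derivD[OF slope_deriv, where x = x and s = 0, unfolded translate_0] | simp add: \<rho>_pos slope_bounds)+
qed

lemma p1_lipschitz: "\<bar>p1 (x \<oplus> s) - p1 x\<bar> \<le> P2 * \<bar>s\<bar>"
proof -
  have 1: "\<bar>\<rho>1 (x \<oplus> s) / \<rho> (x \<oplus> s) - \<rho>1 x / \<rho> x\<bar> \<le> (K / \<kappa> + K * K / \<kappa>\<^sup>2) * \<bar>s\<bar>"
    by (rule quotient_lipschitz[OF \<rho>_lipschitz(2) \<rho>_lipschitz(1) \<rho>_bounds(2) \<rho>_ge \<rho>_ge \<kappa>]) simp
  have "\<bar>\<Delta> * m2 (x \<oplus> s) / slope (x \<oplus> s) - \<Delta> * m2 x / slope x\<bar> \<le> (\<epsilon> / (1/2) + \<epsilon> * \<epsilon> / (1/2)\<^sup>2) * \<bar>s\<bar>"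
  proof (rule quotient_lipschitz)
    show "\<bar>\<Delta> * m2 (x \<oplus> s) - \<Delta> * m2 x\<bar> \<le> \<epsilon> * \<bar>s\<bar>"
      using \<Delta>_abs_le[OF m_lipschitz(3)] by (simp add: right_diff_distrib)
    show "\<bar>slope (x \<oplus> s) - slope x\<bar> \<le> \<epsilon> * \<bar>s\<bar>"
      using \<Delta>_abs_le[OF m_lipschitz(2)] by (simp add: slope_def right_diff_distrib)
    show "\<bar>\<Delta> * m2 x\<bar> \<le> \<epsilon>"
      using \<Delta>_abs_le[of "m2 x" 1] m_bounds(3) by simp
  qed (use slope_bounds in auto)
  also have "\<dots> \<le> 1 * \<bar>s\<bar>"
  proof (rule mult_right_mono)
    have "\<epsilon> * \<epsilon> \<le> 1/64 * (1/64)" using \<epsilon> by (intro mult_mono) auto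
    then show "\<epsilon> / (1/2) + \<epsilon> * \<epsilon> / (1/2)\<^sup>2 \<le> 1" using \<epsilon> by (simp add: power2_eq_square)
  qed simp
  finally show ?thesis
    using 1 unfolding p1_def P2_def by (simp add: power2_eq_square distrib_right)
qed

lemma p_taylor: "\<bar>p (x \<oplus> s) - p x - s * p1 x\<bar> \<le> P2 * s\<^sup>2"
  by (rule circle_taylor[OF p_deriv p1_lipschitz])

section \<open>Centered kernels\<close>

text \<open>The mean of \<open>below (x j) t\<close> over \<open>j\<close> is the fraction of
  particles with coordinate beyond \<open>t\<close>, that is, one minus the empirical distribution
  function. Centering concerns the particle position \<open>y\<close> at a fixed level
  \<open>t\<close>.\<close>

definition "below y t = (if circle_coord t < circle_coord y then 1 else 0 :: real)"
definition "centered y t = below y t - (\<integral>z. below z t \<partial>\<mu>)"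

lemma below_measurable [measurable (raw)]:
  assumes [measurable]: "f \<in> N \<rightarrow>\<^sub>M borel" "g \<in> N \<rightarrow>\<^sub>M borel"
  shows "(\<lambda>z. below (f z) (g z)) \<in> borel_measurable N"
  unfolding below_def by measurable

lemma mean_below_measurable [measurable]: "(\<lambda>t. \<integral>z. below z t \<partial>\<mu>) \<in> borel_measurable borel"
  by measurable

lemma centered_measurable [measurable (raw)]:
  "f \<in> N \<rightarrow>\<^sub>M borel \<Longrightarrow> g \<in> N \<rightarrow>\<^sub>M borel \<Longrightarrow> (\<lambda>z. centered (f z) (g z)) \<in> borel_measurable N"
  unfolding centered_def by (intro borel_measurable_diff measurable_compose[OF _ mean_below_measurable]) measurable

lemma below_integrable: "integrable \<mu> (\<lambda>z. below z t)"
  by (rule \<mu>.integrable_const_bound[where B=1]) (auto simp: below_def)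

lemma centered_bound: "\<bar>centered y t\<bar> \<le> 1"
proof -
  have "0 \<le> (\<integral>z. below z t \<partial>\<mu>)" by (rule integral_nonneg_AE) (auto simp: below_def)
  moreover have "\<bar>\<integral>z. below z t \<partial>\<mu>\<bar> \<le> 1"
    by (rule \<mu>.abs_expectation_le) (auto simp: below_def)
  ultimately show ?thesis by (simp add: centered_def) (simp add: below_def)
qed

lemma integral_centered: "(\<integral>y. centered y t \<partial>\<mu>) = 0"
  unfolding centered_def using below_integrable \<mu>.prob_space by simp

text \<open>The fundamental theorem in the second argument, started at \<open>to_circle 0\<close>;
  subtracting the mean over \<open>\<mu>\<close> removes the value there. Under the integral,
  \<open>x\<close> and \<open>y\<close> stand in separate factors.\<close>

lemma h_centered: "h x y - m x = (\<integral>t. h2 x t * centered y t \<partial>circle_lebesgue)"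
proof -
  interpret P: pair_prob_space \<mu> circle_lebesgue ..
  have FTC: "(\<integral>t. h2 x t * below y t \<partial>circle_lebesgue) = h x y - h x (to_circle 0)" for y
    unfolding below_def
    using integral_circle_deriv[OF h_deriv(2) _ h_bounds(3), of x "circle_coord y"] by (simp add: less_imp_le)
  have bound: "\<bar>h2 x t * below y t\<bar> \<le> M" for y t
    using h_bounds(3)[of x t] M by (simp add: below_def)
  have int1: "integrable circle_lebesgue (\<lambda>t. h2 x t * below y t)" for y
    by (intro circle_lebesgue.integrable_const_bound[where B=M]) (simp_all add: bound)
  have int2: "integrable circle_lebesgue (\<lambda>t. h2 x t * (\<integral>z. below z t \<partial>\<mu>))"
  proof (rule circle_lebesgue.integrable_const_bound[where B=M])
    have "\<bar>\<integral>z. below z t \<partial>\<mu>\<bar> \<le> 1" for t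
      by (rule \<mu>.abs_expectation_le) (auto simp: below_def)
    then show "AE t in circle_lebesgue. norm (h2 x t * (\<integral>z. below z t \<partial>\<mu>)) \<le> M"
      using mult_mono[OF h_bounds(3) _ _ abs_ge_zero] M by (intro AE_I2) (force simp: abs_mult)
  qed measurable
  have "m x - h x (to_circle 0) = (\<integral>y. h x y - h x (to_circle 0) \<partial>\<mu>)"
    unfolding m_def using h_integrable \<mu>.prob_space by simp
  also have "\<dots> = (\<integral>y. (\<integral>t. h2 x t * below y t \<partial>circle_lebesgue) \<partial>\<mu>)"
    by (simp add: FTC)
  also have "\<dots> = (\<integral>t. (\<integral>y. h2 x t * below y t \<partial>\<mu>) \<partial>circle_lebesgue)"
  proof (rule P.Fubini_integral[symmetric])
    show "integrable (\<mu> \<Otimes>\<^sub>M circle_lebesgue) (\<lambda>(y, t). h2 x t * below y t)"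
      by (intro P.integrable_const_bound[where B=M]) (simp_all add: split_beta bound)
  qed
  also have "\<dots> = (\<integral>t. h2 x t * (\<integral>y. below y t \<partial>\<mu>) \<partial>circle_lebesgue)" by simp
  finally have "h x y - m x = (\<integral>t. h2 x t * below y t \<partial>circle_lebesgue) - (\<integral>t. h2 x t * (\<integral>y. below y t \<partial>\<mu>) \<partial>circle_lebesgue)"
    using FTC[of y] by simp
  then show ?thesis
    using int1 int2 by (simp add: centered_def right_diff_distrib)
qed

lemma integrable_mult_centered:
  assumes [measurable]: "f \<in> borel_measurable borel" and f: "\<And>t. \<bar>f t\<bar> \<le> B"
  shows "integrable circle_lebesgue (\<lambda>t. f t * centered y t)"
proof (rule circle_lebesgue.integrable_const_bound[where B=B])
  have "\<bar>f t\<bar> * \<bar>centered y t\<bar> \<le> \<bar>f t\<bar> * 1" for t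
    by (intro mult_left_mono centered_bound) simp
  then show "AE t in circle_lebesgue. norm (f t * centered y t) \<le> B"
    using f by (intro AE_I2) (auto simp: abs_mult intro: order_trans)
qed measurable

text \<open>Both sides of \<open>h_centered\<close> are differentiated in \<open>x\<close>, and
  derivatives are unique. The kernel thus arises as the \<open>x\<close>-derivative of
  \<open>h2\<close>, the form on which \<open>integral_flux\<close> relies.\<close>

lemma h1_centered: "h1 x y - m1 x = (\<integral>t. h21 x t * centered y t \<partial>circle_lebesgue)"
proof -
  let ?f = "\<lambda>x. h x y - m x" and ?I = "\<lambda>x. \<integral>t. h21 x t * centered y t \<partial>circle_lebesgue"
  have "((\<lambda>s. ?f (x \<oplus> s)) has_real_derivative h1 x y - m1 x) (at 0)"
  proof -
    have "has_circle_deriv m m1" by (rule has_circle_derivI_taylor[OF m_taylor(1)])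
    then show ?thesis
      using h_deriv(1)[of y] unfolding has_circle_deriv_def by (auto intro!: derivative_eq_intros)
  qed
  moreover have "has_circle_deriv ?f ?I"
  proof (rule has_circle_derivI_taylor)
    fix x s
    have int: "integrable circle_lebesgue (\<lambda>t. h2 x t * centered y t)"
      "integrable circle_lebesgue (\<lambda>t. h21 x t * centered y t)" for x
      using h_bounds by (auto intro!: integrable_mult_centered)
    have "?f (x \<oplus> s) - ?f x - s * ?I x = (\<integral>t. (h2 (x \<oplus> s) t - h2 x t - s * h21 x t) * centered y t \<partial>circle_lebesgue)"
      unfolding h_centered using int by (simp add: left_diff_distrib mult.assoc)
    also have "\<bar>\<dots>\<bar> \<le> M * s\<^sup>2"
    proof (rule circle_lebesgue.abs_expectation_le)
      fix t
      have "\<bar>h2 (x \<oplus> s) t - h2 x t - s * h21 x t\<bar> * \<bar>centered y t\<bar> \<le> (M * s\<^sup>2) * 1"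
        using M by (intro mult_mono h_taylor centered_bound) auto
      then show "\<bar>(h2 (x \<oplus> s) t - h2 x t - s * h21 x t) * centered y t\<bar> \<le> M * s\<^sup>2"
        by (simp add: abs_mult)
    qed measurable
    finally show "\<bar>?f (x \<oplus> s) - ?f x - s * ?I x\<bar> \<le> M * s\<^sup>2" .
  qed
  then have "((\<lambda>s. ?f (x \<oplus> s)) has_real_derivative ?I x) (at 0)"
    by (simp add: has_circle_deriv_def)
  ultimately show ?thesis by (rule DERIV_unique)
qed

text \<open>Kernel of the first-order change of the logarithmic weight: \<open>p1 * h2\<close> stems
  from the displacement in the logarithmic density \<open>p\<close>, \<open>h21\<close> from the
  diagonal of the Jacobian, both relative to \<open>slope\<close>.\<close>

definition "flux x t = (p1 x * h2 x t + h21 x t) / slope x"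
definition "Ca = 2 * (P1 * M + M)"

lemma flux_measurable [measurable (raw)]:
  assumes [measurable]: "f \<in> N \<rightarrow>\<^sub>M borel" "g \<in> N \<rightarrow>\<^sub>M borel"
  shows "(\<lambda>z. flux (f z) (g z)) \<in> borel_measurable N"
  unfolding flux_def by measurable

lemma flux_bound: "\<bar>flux x t\<bar> \<le> Ca"
proof -
  have "\<bar>p1 x * h2 x t\<bar> \<le> P1 * M"
    unfolding abs_mult using P_nonneg by (intro mult_mono p1_bound h_bounds) auto
  then have "\<bar>p1 x * h2 x t + h21 x t\<bar> \<le> P1 * M + M"
    using h_bounds(5)[of x t] by linarith
  then have "\<bar>flux x t\<bar> \<le> (P1 * M + M) / (1/2)"
    using slope_bounds[of x] P_nonneg M unfolding flux_def abs_divide by (intro frac_le) auto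
  then show ?thesis by (simp add: Ca_def mult.commute)
qed

text \<open>The product of \<open>\<rho>\<close> and \<open>flux\<close> is the derivative of \<open>\<rho> h2 / slope\<close>.\<close>
lemma integral_flux: "(\<integral>x. flux x t \<partial>\<mu>) = 0"
proof -
  have "has_circle_deriv (\<lambda>x. \<rho> x * h2 x t / slope x) (\<lambda>x. \<rho> x * flux x t)"
    unfolding has_circle_deriv_def
  proof
    fix x
    have nz: "\<rho> x \<noteq> 0" "slope x \<noteq> 0" using \<rho>_pos[of x] slope_bounds(3)[of x] by auto
    show "((\<lambda>s. \<rho> (x \<oplus> s) * h2 (x \<oplus> s) t / slope (x \<oplus> s)) has_real_derivative \<rho> x * flux x t) (at 0)"
      by (rule derivative_eq_intros refl
        has_circle_derivD[OF \<rho>_deriv, where x = x and s = 0, unfolded translate_0]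
        has_circle_derivD[OF h_deriv(4)[where y = t], where x = x and s = 0, unfolded translate_0]
        has_circle_derivD[OF slope_deriv, where x = x and s = 0, unfolded translate_0])+
        (use nz in \<open>simp_all add: flux_def p1_def field_simps\<close>)
  qed
  then have "(\<integral>x. \<rho> x * flux x t \<partial>circle_lebesgue) = 0"
  proof (rule integral_circle_deriv_eq_0)
    show "\<bar>\<rho> x * flux x t\<bar> \<le> K * Ca" for x
      unfolding abs_mult using K_pos by (intro mult_mono flux_bound \<rho>_bounds) auto
  qed measurable
  then show ?thesis by (simp add: integral_\<mu>)
qed

end

section \<open>The particle map in the coordinates of the mean-field shift\<close>

text \<open>
  The particle \<open>i\<close> moves from \<open>x i\<close> to the image under the mean-field shift of the point
  \<open>x i \<oplus> w i x\<close>.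
\<close>
locale mean_field_particles = mean_field +
  fixes N :: nat and w :: "nat \<Rightarrow> (nat \<Rightarrow> circle) \<Rightarrow> real"
  assumes N: "1 \<le> N"
    and w_measurable: "\<And>i. i < N \<Longrightarrow> w i \<in> borel_measurable (torus_borel N)"
    and w_eq: "\<And>i x. i < N \<Longrightarrow> x \<in> extensional {..<N} \<Longrightarrow>
      w i x + \<Delta> * m (x i \<oplus> w i x) = \<Delta> / real N * (\<Sum>j<N. h (x i) (x j))"
begin

definition "field i x = \<Delta> / real N * (\<Sum>j<N. h (x i) (x j))"
definition "field1 i x = \<Delta> / real N * (\<Sum>j<N. h1 (x i) (x j))"
definition "err i x = (\<Sum>j<N. h (x i) (x j)) / real N - m (x i)"
definition "err1 i x = (\<Sum>j<N. h1 (x i) (x j)) / real N - m1 (x i)"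
text \<open>Implicit differentiation of the equation for \<open>w i\<close> in the coordinate
  \<open>i\<close> gives this up to the self-interaction: for \<open>j = i\<close> the second
  argument of \<open>h\<close> moves as well, which is paid for by
  \<open>\<epsilon> / real N\<close>.\<close>

definition "dw i x = (1 + field1 i x - \<epsilon> / real N) / slope (x i \<oplus> w i x) - 1"

lemma N_pos: "0 < real N" using N by simp

lemma field_lipschitz:
  assumes i: "i < N"
  shows "\<bar>field i (torus_shift N x a) - field i x\<bar> \<le> \<epsilon> * \<bar>a i\<bar> + \<epsilon> / real N * (\<Sum>j<N. \<bar>a j\<bar>)"
proof -
  have "field i (torus_shift N x a) - field i x = \<Delta> / real N * (\<Sum>j<N. h (x i \<oplus> a i) (x j \<oplus> a j) - h (x i) (x j))"
    using i by (simp add: field_def sum_subtractf right_diff_distrib)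
  also have "\<bar>\<dots>\<bar> = \<Delta> / real N * \<bar>\<Sum>j<N. h (x i \<oplus> a i) (x j \<oplus> a j) - h (x i) (x j)\<bar>"
    using \<Delta> by (simp add: abs_mult)
  also have "\<dots> \<le> \<Delta> / real N * (\<Sum>j<N. M * \<bar>a i\<bar> + M * \<bar>a j\<bar>)"
  proof (intro mult_left_mono order_trans[OF sum_abs] sum_mono)
    fix j
    show "\<bar>h (x i \<oplus> a i) (x j \<oplus> a j) - h (x i) (x j)\<bar> \<le> M * \<bar>a i\<bar> + M * \<bar>a j\<bar>"
      using h_lipschitz(1)[of "x i" "a i" "x j \<oplus> a j"] h_lipschitz(2)[of "x i" "x j" "a j"] by linarith
  qed (use \<Delta> in simp)
  also have "\<dots> = \<epsilon> * \<bar>a i\<bar> + \<epsilon> / real N * (\<Sum>j<N. \<bar>a j\<bar>)"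
    using N_pos by (simp add: sum.distrib sum_distrib_left[symmetric] \<epsilon>_def field_simps)
  finally show ?thesis .
qed

text \<open>The two fixed-point equations are subtracted and
  \<open>\<epsilon> * \<bar>\<delta>\<bar>\<close> is absorbed; the influence of each other particle
  keeps its factor \<open>1 / N\<close>.\<close>

lemma w_lipschitz:
  assumes i: "i < N" and x: "x \<in> extensional {..<N}"
  shows "\<bar>w i (torus_shift N x a) - w i x\<bar> \<le> 4 * \<epsilon> * \<bar>a i\<bar> + 4 * \<epsilon> / real N * (\<Sum>j<N. \<bar>a j\<bar>)"
proof -
  define \<delta> where "\<delta> = w i (torus_shift N x a) - w i x"
  define y where "y = x i \<oplus> w i x"
  define R where "R = \<epsilon> / real N * (\<Sum>j<N. \<bar>a j\<bar>)"
  have "0 \<le> R" using \<epsilon> by (auto simp: R_def intro!: mult_nonneg_nonneg sum_nonneg)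
  have 1: "w i (torus_shift N x a) + \<Delta> * m (y \<oplus> (a i + \<delta>)) = field i (torus_shift N x a)"
    using w_eq[OF i torus_shift_extensional, of x a] i unfolding field_def by (simp add: y_def \<delta>_def algebra_simps)
  have 2: "w i x + \<Delta> * m y = field i x"
    using w_eq[OF i x] unfolding field_def by (simp add: y_def)
  have "\<bar>\<Delta> * (m (y \<oplus> (a i + \<delta>)) - m y)\<bar> \<le> \<epsilon> * \<bar>a i + \<delta>\<bar>"
    by (rule \<Delta>_abs_le[OF m_lipschitz(1)])
  also have "\<dots> \<le> \<epsilon> * (\<bar>a i\<bar> + \<bar>\<delta>\<bar>)" using \<epsilon> by (intro mult_left_mono) auto
  finally have "\<bar>\<Delta> * (m (y \<oplus> (a i + \<delta>)) - m y)\<bar> \<le> \<epsilon> * \<bar>a i\<bar> + \<epsilon> * \<bar>\<delta>\<bar>" by (simp add: distrib_left)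
  moreover have "\<delta> = (field i (torus_shift N x a) - field i x) - \<Delta> * (m (y \<oplus> (a i + \<delta>)) - m y)"
    using 1 2 by (simp add: \<delta>_def algebra_simps)
  moreover have "\<bar>field i (torus_shift N x a) - field i x\<bar> \<le> \<epsilon> * \<bar>a i\<bar> + R"
    unfolding R_def by (rule field_lipschitz[OF i])
  ultimately have "\<bar>\<delta>\<bar> \<le> 2 * (\<epsilon> * \<bar>a i\<bar>) + R + \<epsilon> * \<bar>\<delta>\<bar>" by linarith
  moreover have "\<epsilon> * \<bar>\<delta>\<bar> \<le> 1/2 * \<bar>\<delta>\<bar>" using \<epsilon> by (intro mult_right_mono) auto
  ultimately have "\<bar>\<delta>\<bar> \<le> 4 * (\<epsilon> * \<bar>a i\<bar>) + 4 * R" using \<open>0 \<le> R\<close> by linarith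
  then show ?thesis by (simp add: \<delta>_def R_def)
qed

lemma w_increment:
  assumes i: "i < N" and x: "x \<in> extensional {..<N}" and s: "0 \<le> s"
  shows "w i (x(i := x i \<oplus> s)) - w i x \<ge> s * dw i x - 1 * s\<^sup>2"
proof -
  define x' where "x' = x(i := x i \<oplus> s)"
  define a where "a j = (if j = i then s else 0)" for j
  have x': "x' = torus_shift N x a"
    by (rule torus_eqI[where N=N]) (use x i in \<open>auto simp: x'_def a_def extensional_def torus_shift_def\<close>)
  then have x'_ext: "x' \<in> extensional {..<N}" by simp
  define \<delta> where "\<delta> = w i x' - w i x"
  define y where "y = x i \<oplus> w i x"
  have "\<bar>a j\<bar> = (if j = i then s else 0)" for j
    using s by (simp add: a_def)
  then have "(\<Sum>j<N. \<bar>a j\<bar>) = s" using i by simp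
  then have "\<bar>\<delta>\<bar> \<le> 4 * \<epsilon> * s + 4 * \<epsilon> / real N * s"
    using w_lipschitz[OF i x, of a] s unfolding x'[symmetric] \<delta>_def by (simp add: a_def)
  also have "4 * \<epsilon> / real N * s \<le> 4 * \<epsilon> / 1 * s"
    using N \<epsilon> s by (intro mult_right_mono divide_left_mono) auto
  also have "4 * \<epsilon> * s \<le> 1/16 * s" using \<epsilon> s by (intro mult_right_mono) auto
  finally have "\<bar>\<delta>\<bar> \<le> 1/16 * s + 4 * \<epsilon> / 1 * s" by simp
  also have "4 * \<epsilon> / 1 * s \<le> 1/16 * s" using \<epsilon> s by (intro mult_right_mono) auto
  finally have \<delta>: "\<bar>\<delta>\<bar> \<le> s" using s by simp
  \<comment> \<open>\<open>\<sigma>\<close> is the increment of the displaced point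
    \<open>x i \<oplus> w i x\<close>; it is nonnegative because
    \<open>\<bar>\<delta>\<bar> \<le> s\<close>.\<close>
  define \<sigma> where "\<sigma> = s + \<delta>"
  have \<sigma>: "0 \<le> \<sigma>" "\<sigma> \<le> 2 * s" using \<delta> by (auto simp: \<sigma>_def)
  have "w i x' + \<Delta> * m (y \<oplus> \<sigma>) = field i x'"
    using w_eq[OF i x'_ext] i unfolding field_def by (simp add: y_def \<sigma>_def \<delta>_def x'_def algebra_simps)
  moreover have "w i x + \<Delta> * m y = field i x"
    using w_eq[OF i x] unfolding field_def by (simp add: y_def)
  ultimately have \<sigma>_eq: "\<sigma> + \<Delta> * (m (y \<oplus> \<sigma>) - m y) = s + (field i x' - field i x)"
    by (simp add: \<sigma>_def \<delta>_def algebra_simps)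
  have "field i x' - field i x - s * field1 i x
      = \<Delta> / real N * (\<Sum>j<N. h (x' i) (x' j) - h (x i) (x j) - s * h1 (x i) (x j))"
    by (simp add: field_def field1_def sum_subtractf right_diff_distrib sum_distrib_left[symmetric])
  \<comment> \<open>In the summand \<open>j = i\<close> both arguments of \<open>h\<close> move,
    which costs one further Lipschitz estimate of size \<open>M * s\<close>.\<close>
  also have "\<dots> \<ge> \<Delta> / real N * (\<Sum>j<N. - (M * s\<^sup>2) - (if j = i then M * s else 0))"
  proof (intro mult_left_mono sum_mono)
    fix j
    have "h (x i \<oplus> s) (x j) - h (x i) (x j) - s * h1 (x i) (x j) \<ge> - (M * s\<^sup>2)"
      using h_taylor(1)[of "x i" s "x j"] by linarith
    moreover have "h (x i \<oplus> s) (x i \<oplus> s) - h (x i \<oplus> s) (x i) \<ge> - (M * s)"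
      using h_lipschitz(2)[of "x i \<oplus> s" "x i" s] s by simp
    ultimately show "- (M * s\<^sup>2) - (if j = i then M * s else 0) \<le> h (x' i) (x' j) - h (x i) (x j) - s * h1 (x i) (x j)"
      by (auto simp: x'_def)
  qed (use \<Delta> in simp)
  also have "\<Delta> / real N * (\<Sum>j<N. - (M * s\<^sup>2) - (if j = i then M * s else 0)) = - (\<epsilon> * s\<^sup>2) - \<epsilon> * s / real N"
    using i N_pos by (simp add: sum_subtractf \<epsilon>_def field_simps)
  finally have field: "field i x' - field i x \<ge> s * field1 i x - \<epsilon> * s\<^sup>2 - \<epsilon> * s / real N" by simp
  have "\<bar>\<Delta> * (m (y \<oplus> \<sigma>) - m y - \<sigma> * m1 y)\<bar> \<le> \<epsilon> * \<sigma>\<^sup>2"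
    by (rule \<Delta>_abs_le[OF m_taylor(1)])
  also have "\<epsilon> * \<sigma>\<^sup>2 \<le> \<epsilon> * (2 * s)\<^sup>2" using \<sigma> \<epsilon> by (intro mult_left_mono power_mono) auto
  finally have "\<Delta> * (m (y \<oplus> \<sigma>) - m y) \<le> \<Delta> * (\<sigma> * m1 y) + 4 * (\<epsilon> * s\<^sup>2)"
    by (simp add: algebra_simps power2_eq_square abs_le_iff)
  moreover have "\<sigma> * slope y = \<sigma> + \<Delta> * (\<sigma> * m1 y)"
    by (simp add: slope_def algebra_simps)
  ultimately have "\<sigma> * slope y \<ge> s * (1 + field1 i x - \<epsilon> / real N) - 5 * (\<epsilon> * s\<^sup>2)"
    using \<sigma>_eq field by (simp add: algebra_simps)
  then have "\<sigma> \<ge> (s * (1 + field1 i x - \<epsilon> / real N) - 5 * (\<epsilon> * s\<^sup>2)) / slope y"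
    using slope_bounds(3)[of y] by (simp add: field_simps)
  moreover have "5 * (\<epsilon> * s\<^sup>2) / slope y \<le> 5 * (\<epsilon> * s\<^sup>2) / (1/2)"
    using slope_bounds[of y] \<epsilon> by (intro divide_left_mono) auto
  moreover have "5 * (\<epsilon> * s\<^sup>2) / (1/2) \<le> 1 * s\<^sup>2"
  proof -
    have "(10 * \<epsilon>) * s\<^sup>2 \<le> 1 * s\<^sup>2" using \<epsilon> by (intro mult_right_mono) auto
    then show ?thesis by simp
  qed
  moreover have "(s * X - Y) / slope y = s * (X / slope y) - Y / slope y" for X Y
    by (simp add: diff_divide_distrib)
  note this[of "1 + field1 i x - \<epsilon> / real N" "5 * (\<epsilon> * s\<^sup>2)"]
  ultimately have "\<sigma> \<ge> s * ((1 + field1 i x - \<epsilon> / real N) / slope y) - 1 * s\<^sup>2"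
    by linarith
  then show ?thesis
    by (simp add: dw_def y_def \<sigma>_def \<delta>_def x'_def algebra_simps)
qed

section \<open>Jacobian factors weighted by the density\<close>

definition "jac i x = 1 + dw i x - 2 * (4 * \<epsilon>)\<^sup>2 / real N"

lemma err_bounds: "\<bar>\<Delta> * err1 i x\<bar> \<le> 2 * \<epsilon>"
proof -
  have "\<bar>\<Sum>j<N. h1 (x i) (x j)\<bar> \<le> (\<Sum>j<N. M)"
    by (intro order_trans[OF sum_abs] sum_mono h_bounds)
  then have "\<bar>(\<Sum>j<N. h1 (x i) (x j)) / real N\<bar> \<le> M"
    using N_pos by (simp add: field_simps)
  then have "\<bar>err1 i x\<bar> \<le> M * 2"
    using m_bounds(2)[of "x i"] unfolding err1_def by linarith
  from \<Delta>_abs_le[OF this] show ?thesis by simp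
qed

text \<open>The factor \<open>1 / slope\<close> of \<open>dw\<close> is taken at the displaced point
  and combines with the density there to \<open>exp (p y)\<close>. The logarithm of the weight ratio
  is then bounded below by \<open>ln (1 + t)\<close> plus an increment of \<open>p\<close>, and both
  are expanded to second order. The displacement satisfies \<open>v * S = e\<close> up to a
  quadratic error; \<open>6 * \<epsilon> / N\<close> collects the errors of order
  \<open>1 / N\<close>.\<close>

lemma jac_lower:
  assumes i: "i < N" and x: "x \<in> extensional {..<N}"
  shows "\<rho> (x i) * exp (\<Delta> * ((p1 (x i) * err i x + err1 i x) / slope (x i)) - 6 * \<epsilon> / real N
      - (16 + 4 * (P1 + P2)) * ((\<Delta> * err i x)\<^sup>2 + (\<Delta> * err1 i x)\<^sup>2)) \<le> jac i x * \<rho> (x i \<oplus> w i x)"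
proof -
  define S where "S = slope (x i)"
  define y where "y = x i \<oplus> w i x"
  define q where "q = \<Delta> * err1 i x"
  define e where "e = \<Delta> * err i x"
  define v where "v = w i x"
  define n where "n = \<epsilon> / real N"
  have S: "1/2 \<le> S" "0 < S" using slope_bounds by (auto simp: S_def)
  have n: "0 < n" "n \<le> \<epsilon>" using \<epsilon> N by (auto simp: n_def field_simps)
  have q: "\<bar>q\<bar> \<le> 2 * \<epsilon>" unfolding q_def by (rule err_bounds)
  \<comment> \<open>One \<open>n\<close> is the self-interaction in \<open>dw\<close>; the other
    absorbs the loss \<open>2 * (4 * \<epsilon>)\<^sup>2 / N\<close> of the Jacobian inequality, as
    \<open>64 * \<epsilon> \<le> 1\<close>.\<close>
  define t where "t = (q - 2 * n) / S"
  have t_abs: "\<bar>t\<bar> \<le> 2 * \<bar>q\<bar> + 4 * n"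
  proof -
    have "\<bar>t\<bar> \<le> (\<bar>q\<bar> + 2 * n) / (1/2)"
      unfolding t_def abs_divide using S n by (intro frac_le) auto
    then show ?thesis by simp
  qed
  then have "\<bar>t\<bar> \<le> 1/2" using q n \<epsilon> by linarith
  then have "ln (1 + t) \<ge> t - 2 * t\<^sup>2" and t_pos: "0 < 1 + t"
    using abs_ln_one_plus_x_minus_x_bound[of t] by (auto simp: abs_le_iff)
  moreover have "t \<ge> q / S - 4 * n"
  proof -
    have "2 * n / S \<le> 2 * n / (1/2)" using S n by (intro divide_left_mono) auto
    then show ?thesis by (simp add: t_def diff_divide_distrib)
  qed
  moreover have "t\<^sup>2 \<le> 8 * q\<^sup>2 + n"
  proof -
    have "t\<^sup>2 \<le> (2 * \<bar>q\<bar> + 4 * n)\<^sup>2"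
      using t_abs by (metis abs_ge_zero power2_abs power_mono)
    also have "\<dots> \<le> 8 * q\<^sup>2 + 32 * n\<^sup>2"
      using sum_squares_bound[of "2 * \<bar>q\<bar>" "4 * n"] by (simp add: power2_sum power_mult_distrib)
    also have "32 * n\<^sup>2 \<le> 1 * n"
    proof -
      have "(32 * n) * n \<le> 1 * n" using n \<epsilon> by (intro mult_right_mono) auto
      then show ?thesis by (simp add: power2_eq_square)
    qed
    finally show ?thesis by simp
  qed
  ultimately have ln_t: "ln (1 + t) \<ge> q / S - 6 * n - 16 * q\<^sup>2" by linarith
  have v_eq: "v + \<Delta> * (m (x i \<oplus> v) - m (x i)) = e"
  proof -
    have "\<Delta> / real N * (\<Sum>j<N. h (x i) (x j)) = e + \<Delta> * m (x i)"
      using N_pos by (simp add: e_def err_def field_simps)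
    then show ?thesis using w_eq[OF i x] by (simp add: v_def algebra_simps)
  qed
  have "\<bar>\<Delta> * (m (x i \<oplus> v) - m (x i))\<bar> \<le> \<epsilon> * \<bar>v\<bar>"
    by (rule \<Delta>_abs_le[OF m_lipschitz(1)])
  moreover have "\<epsilon> * \<bar>v\<bar> \<le> 1/2 * \<bar>v\<bar>" using \<epsilon> by (intro mult_right_mono) auto
  ultimately have v_abs: "\<bar>v\<bar> \<le> 2 * \<bar>e\<bar>" using v_eq by linarith
  have v2: "v\<^sup>2 \<le> 4 * e\<^sup>2"
    using power_mono[OF v_abs abs_ge_zero, of 2] by (simp add: power_mult_distrib)
  have "\<bar>\<Delta> * (m (x i \<oplus> v) - m (x i) - v * m1 (x i))\<bar> \<le> \<epsilon> * v\<^sup>2"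
    by (rule \<Delta>_abs_le[OF m_taylor(1)])
  moreover have "e - v * S = \<Delta> * (m (x i \<oplus> v) - m (x i) - v * m1 (x i))"
    using v_eq by (simp add: S_def slope_def algebra_simps)
  ultimately have "\<bar>e - v * S\<bar> \<le> \<epsilon> * v\<^sup>2" by simp
  then have "\<bar>e - v * S\<bar> / S \<le> \<epsilon> * v\<^sup>2 / (1/2)"
    using S \<epsilon> by (intro frac_le) auto
  also have "\<dots> \<le> 1 * v\<^sup>2"
  proof -
    have "(2 * \<epsilon>) * v\<^sup>2 \<le> 1 * v\<^sup>2" using \<epsilon> by (intro mult_right_mono) auto
    then show ?thesis by simp
  qed
  finally have "\<bar>e / S - v\<bar> \<le> v\<^sup>2"
    using S by (simp add: abs_divide[symmetric, of _ S, unfolded abs_of_pos[OF S(2)]] diff_divide_distrib)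
  then have "\<bar>p1 (x i) * (e / S - v)\<bar> \<le> P1 * v\<^sup>2"
    unfolding abs_mult using P_nonneg by (intro mult_mono p1_bound) auto
  then have "v * p1 (x i) \<ge> p1 (x i) * e / S - P1 * v\<^sup>2" by (simp add: algebra_simps abs_le_iff)
  moreover have "p y \<ge> p (x i) + v * p1 (x i) - P2 * v\<^sup>2"
    using p_taylor[of "x i" v] by (simp add: y_def v_def abs_le_iff)
  moreover have "(P1 + P2) * v\<^sup>2 \<le> (P1 + P2) * (4 * e\<^sup>2)"
    using v2 P_nonneg by (intro mult_left_mono) auto
  ultimately have p_y: "p y \<ge> p (x i) + p1 (x i) * e / S - 4 * (P1 + P2) * e\<^sup>2"
    by (simp add: algebra_simps)
  have field1: "1 + field1 i x = S + q"
    using N_pos by (simp add: field1_def S_def slope_def q_def err1_def field_simps)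
  have "jac i x \<ge> S * (1 + t) / slope y"
  proof -
    have "2 * (4 * \<epsilon>)\<^sup>2 / real N * slope y \<le> 2 * (4 * \<epsilon>)\<^sup>2 / real N * 2"
      using slope_bounds(1)[of y] \<epsilon> by (intro mult_left_mono) auto
    also have "\<dots> = (64 * \<epsilon>) * n" by (simp add: n_def power2_eq_square)
    also have "\<dots> \<le> 1 * n" using \<epsilon> n by (intro mult_right_mono) auto
    finally have "2 * (4 * \<epsilon>)\<^sup>2 / real N \<le> n / slope y"
      using slope_bounds(3)[of y] by (simp add: pos_le_divide_eq)
    moreover have "S * (1 + t) = S + q - n - n"
      using S by (simp add: t_def field_simps)
    then have "S * (1 + t) / slope y = (S + q - n) / slope y - n / slope y"
      by (simp only: diff_divide_distrib)
    moreover have "jac i x = (S + q - n) / slope y - 2 * (4 * \<epsilon>)\<^sup>2 / real N"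
      unfolding jac_def dw_def using field1 by (simp add: n_def y_def)
    ultimately show ?thesis by linarith
  qed
  then have "S * (1 + t) / slope y * \<rho> y \<le> jac i x * \<rho> y"
    by (rule mult_right_mono) (use \<rho>_pos[of y] in simp)
  moreover have "S * (1 + t) / slope y * \<rho> y = S * exp (ln (1 + t) + p y)"
    using t_pos \<rho>_pos[of y] slope_bounds(3)[of y] by (simp add: p_def exp_add exp_diff)
  moreover have "\<rho> (x i) = S * exp (p (x i))"
    using \<rho>_pos[of "x i"] slope_bounds(3)[of "x i"] by (simp add: p_def exp_diff S_def)
  moreover have "S * exp (p (x i)) * exp (\<Delta> * ((p1 (x i) * err i x + err1 i x) / S) - 6 * n
      - (16 + 4 * (P1 + P2)) * (e\<^sup>2 + q\<^sup>2)) \<le> S * exp (ln (1 + t) + p y)"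
  proof -
    have "\<Delta> * ((p1 (x i) * err i x + err1 i x) / S) = p1 (x i) * e / S + q / S"
      by (simp add: e_def q_def add_divide_distrib distrib_left mult_ac)
    moreover have "(16 + 4 * (P1 + P2)) * (e\<^sup>2 + q\<^sup>2) \<ge> 16 * q\<^sup>2 + 4 * (P1 + P2) * e\<^sup>2"
    proof -
      have "0 \<le> 16 * e\<^sup>2 + 4 * (P1 + P2) * q\<^sup>2" using P_nonneg by auto
      then show ?thesis by (simp add: algebra_simps)
    qed
    ultimately have "p (x i) + (\<Delta> * ((p1 (x i) * err i x + err1 i x) / S) - 6 * n
      - (16 + 4 * (P1 + P2)) * (e\<^sup>2 + q\<^sup>2)) \<le> ln (1 + t) + p y"
      using ln_t p_y by linarith
    then have "exp (p (x i) + (\<Delta> * ((p1 (x i) * err i x + err1 i x) / S) - 6 * n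
      - (16 + 4 * (P1 + P2)) * (e\<^sup>2 + q\<^sup>2))) \<le> exp (ln (1 + t) + p y)" by simp
    from mult_left_mono[OF this less_imp_le[OF S(2)]] show ?thesis
      by (simp only: exp_add mult.assoc)
  qed
  ultimately show ?thesis
    by (simp add: S_def y_def q_def e_def n_def)
qed

section \<open>Normalised sums and the quadratic cost\<close>

definition "flux_sum x t = (\<Sum>i<N. flux (x i) t)"
definition "centered_sum x t = (\<Sum>i<N. centered (x i) t)"
text \<open>Under the reference law both sums have independent centered summands and are typically
  of size \<open>sqrt N\<close>; the division by \<open>N\<close> makes \<open>quad\<close> of order
  one.\<close>

definition "quad x = (\<integral>t. ((flux_sum x t)\<^sup>2 + (centered_sum x t)\<^sup>2) / real N \<partial>circle_lebesgue)"
text \<open>The leading 1 covers \<open>6 * \<epsilon>\<close>. The coefficient is the quadratic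
  constant \<open>16 + 4 * (P1 + P2)\<close> of \<open>jac_lower\<close> plus 1 from
  \<open>sum_linear_terms\<close>.\<close>

definition "cost x = 1 + (17 + 4 * (P1 + P2)) * quad x"

lemma sums_measurable [measurable]:
  "(\<lambda>(x, t). flux_sum x t) \<in> borel_measurable (torus_borel N \<Otimes>\<^sub>M borel)"
  "(\<lambda>(x, t). centered_sum x t) \<in> borel_measurable (torus_borel N \<Otimes>\<^sub>M borel)"
  "flux_sum x \<in> borel_measurable borel" "centered_sum x \<in> borel_measurable borel"
  unfolding flux_sum_def[abs_def] centered_sum_def[abs_def] by measurable

lemma sums_bounds: "\<bar>flux_sum x t\<bar> \<le> real N * Ca" "\<bar>centered_sum x t\<bar> \<le> real N"
proof -
  have "\<bar>flux_sum x t\<bar> \<le> (\<Sum>i<N. Ca)" "\<bar>centered_sum x t\<bar> \<le> (\<Sum>i<N. 1)"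
    unfolding flux_sum_def centered_sum_def
    by (intro order_trans[OF sum_abs] sum_mono flux_bound centered_bound)+
  then show "\<bar>flux_sum x t\<bar> \<le> real N * Ca" "\<bar>centered_sum x t\<bar> \<le> real N" by simp_all
qed

lemma squares_bounds:
  "(flux_sum x t)\<^sup>2 \<le> (real N * Ca)\<^sup>2" "(centered_sum x t)\<^sup>2 \<le> (real N)\<^sup>2"
  using power_mono[OF sums_bounds(1) abs_ge_zero, of x t 2] power_mono[OF sums_bounds(2) abs_ge_zero, of x t 2]
  by simp_all

lemma squares_integrable:
  "integrable circle_lebesgue (\<lambda>t. (flux_sum x t)\<^sup>2)" "integrable circle_lebesgue (\<lambda>t. (centered_sum x t)\<^sup>2)"
  by (rule circle_lebesgue.integrable_const_bound[where B="(real N * Ca)\<^sup>2"]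
      circle_lebesgue.integrable_const_bound[where B="(real N)\<^sup>2"];
      use squares_bounds in simp)+

lemma quad_eq: "quad x = ((\<integral>t. (flux_sum x t)\<^sup>2 \<partial>circle_lebesgue) + (\<integral>t. (centered_sum x t)\<^sup>2 \<partial>circle_lebesgue)) / real N"
  unfolding quad_def using squares_integrable by simp

lemma quad_nonneg: "0 \<le> quad x"
  unfolding quad_def by (intro integral_nonneg_AE AE_I2) simp

lemma err_eq:
  "err i x = (\<integral>t. h2 (x i) t * centered_sum x t \<partial>circle_lebesgue) / real N"
  "err1 i x = (\<integral>t. h21 (x i) t * centered_sum x t \<partial>circle_lebesgue) / real N"
proof -
  have int: "integrable circle_lebesgue (\<lambda>t. h2 z t * centered y t)"
    "integrable circle_lebesgue (\<lambda>t. h21 z t * centered y t)" for y z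
    using h_bounds by (auto intro!: integrable_mult_centered)
  have "err i x = (\<Sum>j<N. h (x i) (x j) - m (x i)) / real N"
    using N_pos by (simp add: err_def sum_subtractf field_simps)
  also have "\<dots> = (\<integral>t. h2 (x i) t * centered_sum x t \<partial>circle_lebesgue) / real N"
    using int by (simp add: h_centered centered_sum_def sum_distrib_left)
  finally show "err i x = (\<integral>t. h2 (x i) t * centered_sum x t \<partial>circle_lebesgue) / real N" .
  have "err1 i x = (\<Sum>j<N. h1 (x i) (x j) - m1 (x i)) / real N"
    using N_pos by (simp add: err1_def sum_subtractf field_simps)
  also have "\<dots> = (\<integral>t. h21 (x i) t * centered_sum x t \<partial>circle_lebesgue) / real N"
    using int by (simp add: h1_centered centered_sum_def sum_distrib_left)
  finally show "err1 i x = (\<integral>t. h21 (x i) t * centered_sum x t \<partial>circle_lebesgue) / real N" .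
qed

text \<open>Cauchy-Schwarz on the circle, in the form that a variance is nonnegative. The result
  carries a factor \<open>1 / N\<close>, so squared errors summed over all particles remain of order
  \<open>quad\<close>.\<close>

lemma integral_mult_square_le:
  assumes [measurable]: "f \<in> borel_measurable borel" and f: "\<And>t. \<bar>f t\<bar> \<le> M"
  shows "(\<Delta> * ((\<integral>t. f t * centered_sum x t \<partial>circle_lebesgue) / real N))\<^sup>2 \<le> \<epsilon>\<^sup>2 * quad x / real N"
proof -
  let ?g = "\<lambda>t. f t * centered_sum x t"
  have g_abs: "\<bar>?g t\<bar> \<le> M * real N" for t
    unfolding abs_mult using M by (intro mult_mono f sums_bounds) auto
  have g2: "(?g t)\<^sup>2 \<le> M\<^sup>2 * (centered_sum x t)\<^sup>2" for t
    unfolding power_mult_distrib using power_mono[OF f abs_ge_zero, of t 2] by (intro mult_right_mono) auto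
  have int: "integrable circle_lebesgue ?g"
    by (rule circle_lebesgue.integrable_const_bound[where B="M * real N"]) (use g_abs in auto)
  have int2: "integrable circle_lebesgue (\<lambda>t. (?g t)\<^sup>2)"
  proof (rule circle_lebesgue.integrable_const_bound[where B="(M * real N)\<^sup>2"])
    show "AE t in circle_lebesgue. norm ((?g t)\<^sup>2) \<le> (M * real N)\<^sup>2"
      using power_mono[OF g_abs abs_ge_zero, of _ 2] by simp
  qed measurable
  have "(\<integral>t. ?g t \<partial>circle_lebesgue)\<^sup>2 \<le> (\<integral>t. (?g t)\<^sup>2 \<partial>circle_lebesgue)"
    using circle_lebesgue.variance_eq[OF int int2] circle_lebesgue.variance_positive[of ?g] by simp
  also have "\<dots> \<le> (\<integral>t. M\<^sup>2 * (centered_sum x t)\<^sup>2 \<partial>circle_lebesgue)"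
    using int2 squares_integrable g2 by (intro integral_mono) auto
  also have "\<dots> \<le> M\<^sup>2 * (real N * quad x)"
  proof -
    have "0 \<le> (\<integral>t. (flux_sum x t)\<^sup>2 \<partial>circle_lebesgue)" by (intro integral_nonneg_AE AE_I2) simp
    then show ?thesis unfolding quad_eq using N_pos by (simp add: mult_left_mono)
  qed
  finally have "\<Delta>\<^sup>2 * (\<integral>t. ?g t \<partial>circle_lebesgue)\<^sup>2 / (real N)\<^sup>2 \<le> \<Delta>\<^sup>2 * (M\<^sup>2 * (real N * quad x)) / (real N)\<^sup>2"
    by (intro divide_right_mono mult_left_mono) auto
  also have "\<dots> = \<epsilon>\<^sup>2 * quad x / real N"
    using N_pos by (simp add: \<epsilon>_def field_simps power2_eq_square)
  finally show ?thesis by (simp add: power_mult_distrib power_divide)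
qed

lemma err_squares: "(\<Delta> * err i x)\<^sup>2 + (\<Delta> * err1 i x)\<^sup>2 \<le> quad x / real N"
proof -
  have "\<epsilon>\<^sup>2 \<le> (1/2)\<^sup>2" using \<epsilon> by (intro power_mono) auto
  then have "\<epsilon>\<^sup>2 * (quad x / real N) \<le> 1/2 * (quad x / real N)"
    using quad_nonneg[of x] by (intro mult_right_mono) (auto simp: power2_eq_square)
  moreover have "(\<Delta> * err i x)\<^sup>2 \<le> \<epsilon>\<^sup>2 * quad x / real N" "(\<Delta> * err1 i x)\<^sup>2 \<le> \<epsilon>\<^sup>2 * quad x / real N"
    unfolding err_eq by (rule integral_mult_square_le; use h_bounds in simp)+
  ultimately show ?thesis by (simp only: times_divide_eq_right[symmetric]) linarith
qed

text \<open>The sum over \<open>i\<close> goes inside the integral over \<open>t\<close>. There the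
  double sum factors into \<open>flux_sum * centered_sum / N\<close>, which the inequality of
  arithmetic and geometric means bounds by the integrand of \<open>quad\<close>.\<close>

lemma sum_linear_terms:
  "\<bar>\<Sum>i<N. \<Delta> * ((p1 (x i) * err i x + err1 i x) / slope (x i))\<bar> \<le> quad x"
proof -
  have int: "integrable circle_lebesgue (\<lambda>t. f t * centered_sum x t)"
    if [measurable]: "f \<in> borel_measurable borel" and f: "\<And>t. \<bar>f t\<bar> \<le> B" for f B
  proof (rule circle_lebesgue.integrable_const_bound[where B="B * real N"])
    have "0 \<le> B" using f[of undefined] by linarith
    then have "\<bar>f t\<bar> * \<bar>centered_sum x t\<bar> \<le> B * real N" for t
      using f by (intro mult_mono sums_bounds) auto
    then show "AE t in circle_lebesgue. norm (f t * centered_sum x t) \<le> B * real N"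
      by (simp add: abs_mult)
  qed measurable
  have int_h: "integrable circle_lebesgue (\<lambda>t. h2 z t * centered_sum x t)"
    "integrable circle_lebesgue (\<lambda>t. h21 z t * centered_sum x t)"
    "integrable circle_lebesgue (\<lambda>t. flux z t * centered_sum x t)" for z
    using h_bounds flux_bound by (auto intro!: int)
  have "(p1 (x i) * err i x + err1 i x) / slope (x i)
      = (\<integral>t. flux (x i) t * centered_sum x t \<partial>circle_lebesgue) / real N" for i
  proof -
    have "(\<integral>t. flux (x i) t * centered_sum x t \<partial>circle_lebesgue)
      = (\<integral>t. (p1 (x i) * (h2 (x i) t * centered_sum x t) + h21 (x i) t * centered_sum x t) / slope (x i) \<partial>circle_lebesgue)"
      by (intro Bochner_Integration.integral_cong) (auto simp: flux_def field_simps)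
    also have "\<dots> = (p1 (x i) * (\<integral>t. h2 (x i) t * centered_sum x t \<partial>circle_lebesgue)
        + (\<integral>t. h21 (x i) t * centered_sum x t \<partial>circle_lebesgue)) / slope (x i)"
      using int_h by simp
    finally show ?thesis by (simp add: err_eq add_divide_distrib mult.commute)
  qed
  then have "(\<Sum>i<N. \<Delta> * ((p1 (x i) * err i x + err1 i x) / slope (x i)))
     = \<Delta> * (\<integral>t. flux_sum x t * centered_sum x t / real N \<partial>circle_lebesgue)"
    using int_h by (simp add: flux_sum_def sum_distrib_left[symmetric] sum_divide_distrib[symmetric] sum_distrib_right)
  moreover have "\<bar>\<integral>t. flux_sum x t * centered_sum x t / real N \<partial>circle_lebesgue\<bar> \<le> quad x"
  proof -
    have "\<bar>\<integral>t. flux_sum x t * centered_sum x t / real N \<partial>circle_lebesgue\<bar>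
       \<le> (\<integral>t. \<bar>flux_sum x t * centered_sum x t / real N\<bar> \<partial>circle_lebesgue)"
      by (rule integral_abs_bound)
    also have "\<dots> \<le> quad x"
      unfolding quad_def
    proof (rule integral_mono)
      show "integrable circle_lebesgue (\<lambda>t. \<bar>flux_sum x t * centered_sum x t / real N\<bar>)"
        by (intro integrable_abs integrable_divide int[OF _ sums_bounds(1)]) measurable
      show "integrable circle_lebesgue (\<lambda>t. ((flux_sum x t)\<^sup>2 + (centered_sum x t)\<^sup>2) / real N)"
        using squares_integrable by simp
      fix t
      have "\<bar>flux_sum x t * centered_sum x t\<bar> \<le> (flux_sum x t)\<^sup>2 + (centered_sum x t)\<^sup>2"
        using sum_squares_bound[of "\<bar>flux_sum x t\<bar>" "\<bar>centered_sum x t\<bar>"]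
          mult_nonneg_nonneg[OF abs_ge_zero[of "flux_sum x t"] abs_ge_zero[of "centered_sum x t"]]
        unfolding abs_mult power2_abs by linarith
      then show "\<bar>flux_sum x t * centered_sum x t / real N\<bar> \<le> ((flux_sum x t)\<^sup>2 + (centered_sum x t)\<^sup>2) / real N"
        using N_pos by (simp add: abs_divide divide_right_mono)
    qed
    finally show ?thesis .
  qed
  moreover have "\<Delta> \<le> 1" using \<epsilon> by linarith
  ultimately show ?thesis
    using mult_mono[of \<Delta> 1 "\<bar>\<integral>t. flux_sum x t * centered_sum x t / real N \<partial>circle_lebesgue\<bar>" "quad x"] \<Delta>
    by (simp add: abs_mult)
qed

lemma prod_jac_lower:
  assumes x: "x \<in> extensional {..<N}"
  shows "ennreal (exp (- cost x)) * (\<Prod>i<N. ennreal (\<rho> (x i)))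
      \<le> (\<Prod>i<N. ennreal (\<rho> (x i \<oplus> w i x)) * ennreal (jac i x))"
proof -
  define c where "c = 16 + 4 * (P1 + P2)"
  define g where "g i = \<Delta> * ((p1 (x i) * err i x + err1 i x) / slope (x i)) - 6 * \<epsilon> / real N
      - c * ((\<Delta> * err i x)\<^sup>2 + (\<Delta> * err1 i x)\<^sup>2)" for i
  have c: "0 \<le> c" using P_nonneg by (simp add: c_def)
  have "- cost x \<le> (\<Sum>i<N. g i)"
  proof -
    have "(\<Sum>i<N. c * ((\<Delta> * err i x)\<^sup>2 + (\<Delta> * err1 i x)\<^sup>2)) \<le> (\<Sum>i<N. c * (quad x / real N))"
      by (intro sum_mono mult_left_mono err_squares c)
    also have "\<dots> = c * quad x" using N_pos by simp
    finally have "(\<Sum>i<N. g i) \<ge> - quad x - 6 * \<epsilon> - c * quad x"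
      unfolding g_def sum_subtractf using sum_linear_terms[of x] N_pos by (simp add: abs_le_iff)
    moreover have "cost x = 1 + quad x + c * quad x" by (simp add: cost_def c_def algebra_simps)
    ultimately show ?thesis using \<epsilon> by linarith
  qed
  then have "ennreal (exp (- cost x)) * (\<Prod>i<N. ennreal (\<rho> (x i)))
      \<le> ennreal (exp (\<Sum>i<N. g i)) * (\<Prod>i<N. ennreal (\<rho> (x i)))"
    by (intro mult_right_mono ennreal_leI) auto
  also have "\<dots> = (\<Prod>i<N. ennreal (\<rho> (x i) * exp (g i)))"
    using \<rho>_pos by (simp add: exp_sum prod_ennreal[symmetric] prod.distrib[symmetric] ennreal_mult'' mult.commute less_imp_le)
  also have "\<dots> \<le> (\<Prod>i<N. ennreal (\<rho> (x i \<oplus> w i x)) * ennreal (jac i x))"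
  proof (intro prod_mono_ennreal)
    fix i assume "i \<in> {..<N}"
    then have "\<rho> (x i) * exp (g i) \<le> jac i x * \<rho> (x i \<oplus> w i x)"
      using jac_lower[of i x] x by (simp add: g_def c_def)
    then show "ennreal (\<rho> (x i) * exp (g i)) \<le> ennreal (\<rho> (x i \<oplus> w i x)) * ennreal (jac i x)"
      using \<rho>_pos[of "x i \<oplus> w i x"] by (simp add: ennreal_mult'[symmetric] mult.commute less_imp_le ennreal_leI)
  qed
  finally show ?thesis .
qed

end

section \<open>One step of the dynamics\<close>

lemma PiM_density:
  fixes f :: "'a \<Rightarrow> ennreal"
  assumes I: "finite I" and M: "sigma_finite_measure M" and D: "sigma_finite_measure (density M f)"
    and f [measurable]: "f \<in> borel_measurable M"
  shows "Pi\<^sub>M I (\<lambda>_. density M f) = density (Pi\<^sub>M I (\<lambda>_. M)) (\<lambda>x. \<Prod>i\<in>I. f (x i))"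
proof -
  interpret D: product_sigma_finite "\<lambda>_. density M f" using D by (simp add: product_sigma_finite_def)
  interpret M: product_sigma_finite "\<lambda>_. M" using M by (simp add: product_sigma_finite_def)
  have "density (Pi\<^sub>M I (\<lambda>_. M)) (\<lambda>x. \<Prod>i\<in>I. f (x i)) = Pi\<^sub>M I (\<lambda>_. density M f)"
  proof (rule D.PiM_eqI[OF I])
    show "sets (density (Pi\<^sub>M I (\<lambda>_. M)) (\<lambda>x. \<Prod>i\<in>I. f (x i))) = sets (Pi\<^sub>M I (\<lambda>_. density M f))"
      by (simp cong: sets_PiM_cong)
    fix A assume A: "\<And>i. i \<in> I \<Longrightarrow> A i \<in> sets (density M f)"
    then have [measurable]: "Pi\<^sub>E I A \<in> sets (Pi\<^sub>M I (\<lambda>_. M))"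
      using I by (intro sets_PiM_I_finite) auto
    have "emeasure (density (Pi\<^sub>M I (\<lambda>_. M)) (\<lambda>x. \<Prod>i\<in>I. f (x i))) (Pi\<^sub>E I A)
      = (\<integral>\<^sup>+x. (\<Prod>i\<in>I. f (x i)) * indicator (Pi\<^sub>E I A) x \<partial>Pi\<^sub>M I (\<lambda>_. M))"
      by (rule emeasure_density) measurable
    also have "\<dots> = (\<integral>\<^sup>+x. (\<Prod>i\<in>I. f (x i) * indicator (A i) (x i)) \<partial>Pi\<^sub>M I (\<lambda>_. M))"
    proof (rule nn_integral_cong)
      fix x assume "x \<in> space (Pi\<^sub>M I (\<lambda>_. M))"
      then have "indicator (Pi\<^sub>E I A) x = (\<Prod>i\<in>I. indicator (A i) (x i) :: ennreal)"
        using I by (auto simp: indicator_def PiE_def Pi_def space_PiM prod.If_cases)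
      then show "(\<Prod>i\<in>I. f (x i)) * indicator (Pi\<^sub>E I A) x = (\<Prod>i\<in>I. f (x i) * indicator (A i) (x i))"
        by (simp add: prod.distrib)
    qed
    also have "\<dots> = (\<Prod>i\<in>I. \<integral>\<^sup>+y. f y * indicator (A i) y \<partial>M)"
      using I A by (intro M.product_nn_integral_prod) auto
    also have "\<dots> = (\<Prod>i\<in>I. emeasure (density M f) (A i))"
      using A by (intro prod.cong) (auto simp: emeasure_density)
    finally show "emeasure (density (Pi\<^sub>M I (\<lambda>_. M)) (\<lambda>x. \<Prod>i\<in>I. f (x i))) (Pi\<^sub>E I A)
      = (\<Prod>i\<in>I. emeasure (density M f) (A i))" .
  qed
  then show ?thesis by simp
qed

context mean_field_particles
begin

lemma prob_space_power: "prob_space (Pi\<^sub>M {..<N} (\<lambda>_. \<mu>))"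
  by (intro prob_space_PiM \<mu>.prob_space_axioms)

lemma sets_power [measurable_cong, simp]: "sets (Pi\<^sub>M {..<N} (\<lambda>_. \<mu>)) = sets (torus_borel N)"
  by (intro sets_PiM_cong) simp_all

lemma nn_integral_power:
  assumes "G \<in> borel_measurable (torus_borel N)"
  shows "(\<integral>\<^sup>+x. G x \<partial>Pi\<^sub>M {..<N} (\<lambda>_. \<mu>)) = (\<integral>\<^sup>+x. (\<Prod>i<N. ennreal (\<rho> (x i))) * G x \<partial>torus_lebesgue N)"
proof -
  have "Pi\<^sub>M {..<N} (\<lambda>_. \<mu>) = density (torus_lebesgue N) (\<lambda>x. \<Prod>i<N. ennreal (\<rho> (x i)))"
    unfolding \<mu>_def measure_of_density_def
    using \<mu>.sigma_finite_measure_axioms circle_lebesgue.sigma_finite_measure_axioms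
    by (intro PiM_density) (auto simp: \<mu>_def measure_of_density_def)
  then show ?thesis using assms by (simp add: nn_integral_density)
qed

lemma shift_measurable [measurable]:
  "(\<lambda>x. torus_shift N x (\<lambda>i. w i x)) \<in> torus_borel N \<rightarrow>\<^sub>M torus_borel N"
  using w_measurable by (intro measurable_torus_shift) auto

lemma cost_measurable [measurable]: "cost \<in> borel_measurable (torus_borel N)"
  unfolding cost_def[abs_def] quad_def by measurable

lemma dw_measurable: "i < N \<Longrightarrow> dw i \<in> borel_measurable (torus_borel N)"
  unfolding dw_def[abs_def] field1_def using w_measurable[of i] by measurable

text \<open>The product density is made part of the integrand in \<open>torus_jacobian_ineq\<close>,
  which turns the inequality for Lebesgue measure into one for the reference law.\<close>

lemma transport_ineq:
  assumes G [measurable]: "G \<in> borel_measurable (torus_borel N)"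
  shows "(\<integral>\<^sup>+x. ennreal (exp (- cost x)) * G (torus_shift N x (\<lambda>i. w i x)) \<partial>Pi\<^sub>M {..<N} (\<lambda>_. \<mu>))
    \<le> (\<integral>\<^sup>+x. G x \<partial>Pi\<^sub>M {..<N} (\<lambda>_. \<mu>))"
proof -
  have "(\<integral>\<^sup>+x. ennreal (exp (- cost x)) * G (torus_shift N x (\<lambda>i. w i x)) \<partial>Pi\<^sub>M {..<N} (\<lambda>_. \<mu>))
    = (\<integral>\<^sup>+x. (ennreal (exp (- cost x)) * (\<Prod>i<N. ennreal (\<rho> (x i)))) * G (torus_shift N x (\<lambda>i. w i x)) \<partial>torus_lebesgue N)"
    by (subst nn_integral_power) (auto simp: mult_ac)
  also have "\<dots> \<le> (\<integral>\<^sup>+x. (\<Prod>i<N. ennreal (\<rho> (x i \<oplus> w i x)) * ennreal (jac i x)) * G (torus_shift N x (\<lambda>i. w i x)) \<partial>torus_lebesgue N)"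
    by (intro nn_integral_mono mult_right_mono prod_jac_lower) auto
  also have "\<dots> = (\<integral>\<^sup>+x. ((\<Prod>i<N. ennreal (\<rho> (torus_shift N x (\<lambda>i. w i x) i))) * G (torus_shift N x (\<lambda>i. w i x)))
      * (\<Prod>i<N. ennreal (1 + dw i x - 2 * (4 * \<epsilon>)\<^sup>2 / real N)) \<partial>torus_lebesgue N)"
    by (intro nn_integral_cong) (simp add: prod.distrib jac_def mult_ac)
  also have "\<dots> \<le> (\<integral>\<^sup>+x. (\<Prod>i<N. ennreal (\<rho> (x i))) * G x \<partial>torus_lebesgue N)"
  proof (rule torus_jacobian_ineq[where C = 1 and l = "4 * \<epsilon>" and w = w and d = dw
        and G = "\<lambda>x. (\<Prod>i<N. ennreal (\<rho> (x i))) * G x"])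
    show "0 \<le> 4 * \<epsilon>" "4 * \<epsilon> \<le> 1 / 4" using \<epsilon> by auto
  qed (use w_measurable dw_measurable w_lipschitz w_increment in auto)
  also have "\<dots> = (\<integral>\<^sup>+x. G x \<partial>Pi\<^sub>M {..<N} (\<lambda>_. \<mu>))"
    by (rule nn_integral_power[symmetric]) fact
  finally show ?thesis .
qed

text \<open>This bound grows with \<open>N\<close> and serves only integrability; the estimate
  uniform in \<open>N\<close> is \<open>cost_exp_moment\<close>.\<close>

lemma cost_bounded: "\<exists>B. \<forall>x. \<bar>cost x\<bar> \<le> B"
proof -
  have "quad x \<le> ((real N * Ca)\<^sup>2 + (real N)\<^sup>2) / real N" for x
  proof -
    have "quad x \<le> (\<integral>t. ((real N * Ca)\<^sup>2 + (real N)\<^sup>2) / real N \<partial>circle_lebesgue)"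
      unfolding quad_def using squares_integrable squares_bounds
      by (intro integral_mono divide_right_mono add_mono) auto
    then show ?thesis using circle_lebesgue.prob_space by simp
  qed
  note mult_left_mono[OF this, of "17 + 4 * (P1 + P2)"]
  moreover have "0 \<le> (17 + 4 * (P1 + P2)) * quad x" for x
    using quad_nonneg[of x] P_nonneg by simp
  ultimately have "\<bar>cost x\<bar> \<le> 1 + (17 + 4 * (P1 + P2)) * (((real N * Ca)\<^sup>2 + (real N)\<^sup>2) / real N)" for x
    using P_nonneg unfolding cost_def by (subst abs_of_nonneg) auto
  then show ?thesis by blast
qed

text \<open>Jensen's inequality moves the exponential inside the integral over \<open>t\<close>, and
  \<open>u * v \<le> (u\<^sup>2 + v\<^sup>2) / 2\<close> separates the two squares at the price of
  doubled exponents. For fixed \<open>t\<close> this leaves moments of one squared centered sum at a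
  time. The factor 8 in the hypothesis provides the smallness condition for both bounds,
  \<open>Ca\<close> and \<open>1\<close>.\<close>

lemma cost_exp_moment:
  assumes \<gamma>: "0 < \<gamma>" "8 * \<gamma> * (17 + 4 * (P1 + P2)) * (Ca\<^sup>2 + 1) \<le> 1"
  shows "(\<integral>\<^sup>+x. ennreal (exp (\<gamma> * cost x)) \<partial>Pi\<^sub>M {..<N} (\<lambda>_. \<mu>)) \<le> ennreal (2 * exp \<gamma>)"
proof -
  interpret P: prob_space "Pi\<^sub>M {..<N} (\<lambda>_. \<mu>)" by (rule prob_space_power)
  interpret pair_sigma_finite "Pi\<^sub>M {..<N} (\<lambda>_. \<mu>)" circle_lebesgue ..
  define c where "c = \<gamma> * (17 + 4 * (P1 + P2))"
  have c: "0 < c" using \<gamma> P_nonneg by (simp add: c_def)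
  have c_le: "2 * c * Ca\<^sup>2 \<le> 1/4" "2 * c * 1\<^sup>2 \<le> 1/4"
  proof -
    have *: "8 * (c * Ca\<^sup>2) + 8 * c \<le> 1" using \<gamma>(2) by (simp add: c_def algebra_simps)
    have "0 \<le> c * Ca\<^sup>2" using c by simp
    with * c show "2 * c * Ca\<^sup>2 \<le> 1/4" "2 * c * 1\<^sup>2 \<le> 1/4" 
      by (simp_all only: mult.assoc power_one mult_1_right)
  qed
  define a b where "a x t = exp (2 * c * (flux_sum x t)\<^sup>2 / real N)" and "b x t = exp (2 * c * (centered_sum x t)\<^sup>2 / real N)" for x t
  have [measurable]: "(\<lambda>(x, t). a x t) \<in> borel_measurable (torus_borel N \<Otimes>\<^sub>M borel)"
    "(\<lambda>(x, t). b x t) \<in> borel_measurable (torus_borel N \<Otimes>\<^sub>M borel)"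
    unfolding a_def b_def by measurable
  have jensen: "ennreal (exp (\<gamma> * cost x)) \<le> ennreal (exp \<gamma>) * (\<integral>\<^sup>+t. ennreal ((a x t + b x t) / 2) \<partial>circle_lebesgue)" for x
  proof -
    define f where "f t = c * (((flux_sum x t)\<^sup>2 + (centered_sum x t)\<^sup>2) / real N)" for t
    have [measurable]: "f \<in> borel_measurable borel" unfolding f_def by measurable
    have f_bd: "0 \<le> f t" "f t \<le> c * (((real N * Ca)\<^sup>2 + (real N)\<^sup>2) / real N)" for t
      unfolding f_def using c squares_bounds
      by (auto intro!: mult_left_mono divide_right_mono add_mono mult_nonneg_nonneg divide_nonneg_nonneg)
    have "exp (\<integral>t. f t \<partial>circle_lebesgue) \<le> (\<integral>t. exp (f t) \<partial>circle_lebesgue)"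
    proof (rule circle_lebesgue.jensens_inequality[where I = UNIV])
      show "integrable circle_lebesgue f"
        by (rule circle_lebesgue.integrable_const_bound) (use f_bd in auto)
      show "integrable circle_lebesgue (\<lambda>t. exp (f t))"
        by (rule circle_lebesgue.integrable_const_bound[where B = "exp (c * (((real N * Ca)\<^sup>2 + (real N)\<^sup>2) / real N))"])
          (use f_bd in auto)
    qed (auto simp: exp_convex)
    moreover have "\<gamma> * cost x = \<gamma> + (\<integral>t. f t \<partial>circle_lebesgue)"
    proof -
      have "(\<integral>t. f t \<partial>circle_lebesgue) = c * quad x" unfolding f_def quad_def by simp
      then show ?thesis by (simp add: cost_def c_def algebra_simps)
    qed
    ultimately have "ennreal (exp (\<gamma> * cost x)) \<le> ennreal (exp \<gamma> * (\<integral>t. exp (f t) \<partial>circle_lebesgue))"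
      by (intro ennreal_leI) (simp add: exp_add)
    also have "\<dots> = ennreal (exp \<gamma>) * (\<integral>\<^sup>+t. ennreal (exp (f t)) \<partial>circle_lebesgue)"
    proof -
      have "integrable circle_lebesgue (\<lambda>t. exp (f t))"
        by (rule circle_lebesgue.integrable_const_bound[where B = "exp (c * (((real N * Ca)\<^sup>2 + (real N)\<^sup>2) / real N))"])
          (use f_bd in auto)
      then show ?thesis by (subst nn_integral_eq_integral) (auto simp: ennreal_mult)
    qed
    also have "\<dots> \<le> ennreal (exp \<gamma>) * (\<integral>\<^sup>+t. ennreal ((a x t + b x t) / 2) \<partial>circle_lebesgue)"
    proof (intro mult_left_mono nn_integral_mono ennreal_leI)
      fix t
      define u v where "u = exp (c * (flux_sum x t)\<^sup>2 / real N)" and "v = exp (c * (centered_sum x t)\<^sup>2 / real N)"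
      have "exp (f t) = u * v"
        by (simp add: f_def u_def v_def exp_add[symmetric] add_divide_distrib distrib_left)
      also have "\<dots> \<le> (u\<^sup>2 + v\<^sup>2) / 2" using sum_squares_bound[of u v] by simp
      also have "u\<^sup>2 = a x t" by (simp add: u_def a_def exp_double[symmetric])
      also have "v\<^sup>2 = b x t" by (simp add: v_def b_def exp_double[symmetric])
      finally show "exp (f t) \<le> (a x t + b x t) / 2" .
    qed simp
    finally show ?thesis .
  qed
  have a_mom: "(\<integral>\<^sup>+x. ennreal (a x t) \<partial>Pi\<^sub>M {..<N} (\<lambda>_. \<mu>)) \<le> 2" for t
    unfolding a_def flux_sum_def
    by (rule exp_moment_square_sum[OF \<mu>.prob_space_axioms _ flux_bound integral_flux]) (use c c_le N in auto)
  have b_mom: "(\<integral>\<^sup>+x. ennreal (b x t) \<partial>Pi\<^sub>M {..<N} (\<lambda>_. \<mu>)) \<le> 2" for t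
    unfolding b_def centered_sum_def
    by (rule exp_moment_square_sum[OF \<mu>.prob_space_axioms _ centered_bound integral_centered]) (use c c_le N in auto)
  have "(\<integral>\<^sup>+x. (\<integral>\<^sup>+t. ennreal ((a x t + b x t) / 2) \<partial>circle_lebesgue) \<partial>Pi\<^sub>M {..<N} (\<lambda>_. \<mu>))
     = (\<integral>\<^sup>+t. (\<integral>\<^sup>+x. ennreal ((a x t + b x t) / 2) \<partial>Pi\<^sub>M {..<N} (\<lambda>_. \<mu>)) \<partial>circle_lebesgue)"
    by (rule Fubini'[symmetric]) measurable
  also have "\<dots> \<le> (\<integral>\<^sup>+t. 2 \<partial>circle_lebesgue)"
  proof (rule nn_integral_mono)
    fix t
    have "(\<integral>\<^sup>+x. ennreal ((a x t + b x t) / 2) \<partial>Pi\<^sub>M {..<N} (\<lambda>_. \<mu>))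
      = (\<integral>\<^sup>+x. ennreal (1/2) * (ennreal (a x t) + ennreal (b x t)) \<partial>Pi\<^sub>M {..<N} (\<lambda>_. \<mu>))"
    proof (rule nn_integral_cong)
      fix x
      have "ennreal ((a x t + b x t) / 2) = ennreal (1/2 * (a x t + b x t))" by simp
      also have "\<dots> = ennreal (1/2) * ennreal (a x t + b x t)"
        by (rule ennreal_mult) (simp_all add: a_def b_def)
      also have "ennreal (a x t + b x t) = ennreal (a x t) + ennreal (b x t)"
        by (rule ennreal_plus) (simp_all add: a_def b_def)
      finally show "ennreal ((a x t + b x t) / 2) = ennreal (1/2) * (ennreal (a x t) + ennreal (b x t))" .
    qed
    also have "\<dots> = ennreal (1/2) * ((\<integral>\<^sup>+x. ennreal (a x t) \<partial>Pi\<^sub>M {..<N} (\<lambda>_. \<mu>)) + (\<integral>\<^sup>+x. ennreal (b x t) \<partial>Pi\<^sub>M {..<N} (\<lambda>_. \<mu>)))"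
      by (simp add: nn_integral_cmult nn_integral_add)
    also have "\<dots> \<le> ennreal (1/2) * (2 + 2)"
      by (intro mult_left_mono add_mono a_mom b_mom) simp
    also have "(2 + 2 :: ennreal) = ennreal 4" by simp
    also have "ennreal (1/2) * ennreal 4 = ennreal (1/2 * 4)"
      by (rule ennreal_mult[symmetric]) simp_all
    finally show "(\<integral>\<^sup>+x. ennreal ((a x t + b x t) / 2) \<partial>Pi\<^sub>M {..<N} (\<lambda>_. \<mu>)) \<le> 2" by simp
  qed
  also have "\<dots> = 2" using circle_lebesgue.emeasure_space_1 by simp
  finally have ab_mom: "(\<integral>\<^sup>+x. (\<integral>\<^sup>+t. ennreal ((a x t + b x t) / 2) \<partial>circle_lebesgue) \<partial>Pi\<^sub>M {..<N} (\<lambda>_. \<mu>)) \<le> 2" .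
  have "(\<integral>\<^sup>+x. ennreal (exp (\<gamma> * cost x)) \<partial>Pi\<^sub>M {..<N} (\<lambda>_. \<mu>))
     \<le> (\<integral>\<^sup>+x. ennreal (exp \<gamma>) * (\<integral>\<^sup>+t. ennreal ((a x t + b x t) / 2) \<partial>circle_lebesgue) \<partial>Pi\<^sub>M {..<N} (\<lambda>_. \<mu>))"
    by (intro nn_integral_mono jensen)
  also have "\<dots> = ennreal (exp \<gamma>) * (\<integral>\<^sup>+x. (\<integral>\<^sup>+t. ennreal ((a x t + b x t) / 2) \<partial>circle_lebesgue) \<partial>Pi\<^sub>M {..<N} (\<lambda>_. \<mu>))"
    by (rule nn_integral_cmult) measurable
  also have "\<dots> \<le> ennreal (exp \<gamma>) * 2"
    by (intro mult_left_mono ab_mom) simp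
  also have "\<dots> = ennreal (2 * exp \<gamma>)"
    by (simp add: ennreal_mult mult.commute)
  finally show ?thesis .
qed

end

section \<open>The entropy inequality for one step\<close>

context mean_field
begin

text \<open>The equations for the displacements are decoupled, each with Lipschitz constant
  \<open>\<epsilon>\<close> in its own unknown; the fixed-point lemma supplies measurability in
  \<open>x\<close>.\<close>

lemma particle_coordinates_exist:
  assumes N: "1 \<le> N"
  obtains w where "mean_field_particles h \<rho> M \<kappa> K \<Delta> N w"
proof -
  define f where "f i x v = \<Delta> / real N * (\<Sum>j<N. h (x i) (x j)) - \<Delta> * m (x i \<oplus> v i)"
    for i :: nat and x :: "nat \<Rightarrow> circle" and v :: "nat \<Rightarrow> real"
  obtain w where w: "\<And>i. i \<in> {..<N} \<Longrightarrow> w i \<in> borel_measurable (torus_borel N)"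
    "\<And>x i. x \<in> space (torus_borel N) \<Longrightarrow> i \<in> {..<N} \<Longrightarrow> w i x = f i x (\<lambda>j. w j x)"
  proof (rule measurable_contraction_fixpoint[of "{..<N}" \<epsilon> "torus_borel N" f])
    show "0 \<le> \<epsilon>" "\<epsilon> < 1" using \<epsilon> by auto
    show "(\<lambda>z. f i z (\<lambda>j. v j z)) \<in> borel_measurable (torus_borel N)"
      if v: "\<And>j. j \<in> {..<N} \<Longrightarrow> v j \<in> borel_measurable (torus_borel N)" and i: "i \<in> {..<N}" for v i
    proof -
      note [measurable] = v[OF i]
      have [measurable]: "(\<lambda>z. z j) \<in> torus_borel N \<rightarrow>\<^sub>M borel" if "j \<in> {..<N}" for j
        using that by (rule measurable_component_singleton)
      have [measurable]: "(\<lambda>z. z i) \<in> torus_borel N \<rightarrow>\<^sub>M borel"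
        using i by (rule measurable_component_singleton)
      show ?thesis unfolding f_def by measurable
    qed
    show "\<bar>f i z u - f i z v\<bar> \<le> \<epsilon> * c"
      if c: "\<And>j. j \<in> {..<N} \<Longrightarrow> \<bar>u j - v j\<bar> \<le> c" and i: "i \<in> {..<N}" for z u v c i
    proof -
      have "f i z u - f i z v = \<Delta> * (m (z i \<oplus> u i \<oplus> (v i - u i)) - m (z i \<oplus> u i))"
        by (simp add: f_def right_diff_distrib)
      also have "\<bar>\<dots>\<bar> \<le> \<epsilon> * \<bar>v i - u i\<bar>" by (rule \<Delta>_abs_le[OF m_lipschitz(1)])
      also have "\<dots> \<le> \<epsilon> * c" using c[OF i] \<epsilon> by (intro mult_left_mono) (auto simp: abs_minus_commute)
      finally show ?thesis .
    qed
  qed auto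
  have "mean_field_particles h \<rho> M \<kappa> K \<Delta> N w"
  proof
    show "1 \<le> N" by (rule N)
    show "w i \<in> borel_measurable (torus_borel N)" if "i < N" for i
      using w(1) that by simp
    show "w i x + \<Delta> * m (x i \<oplus> w i x) = \<Delta> / real N * (\<Sum>j<N. h (x i) (x j))"
      if "i < N" "x \<in> extensional {..<N}" for i x
    proof -
      have "w i x = \<Delta> / real N * (\<Sum>j<N. h (x i) (x j)) - \<Delta> * m (x i \<oplus> w i x)"
        using w(2)[of x i] that unfolding f_def by simp
      then show ?thesis by linarith
    qed
  qed
  then show ?thesis by (rule that)
qed

definition "\<gamma> = 1 / (8 * (17 + 4 * (P1 + P2)) * (Ca\<^sup>2 + 1))"

lemma \<gamma>_pos: "0 < \<gamma>"
  unfolding \<gamma>_def using P_nonneg by (intro divide_pos_pos mult_pos_pos add_nonneg_pos) auto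

definition particle_step :: "(circle \<Rightarrow> circle) \<Rightarrow> nat \<Rightarrow> (nat \<Rightarrow> circle) \<Rightarrow> nat \<Rightarrow> circle" where
  "particle_step F N x = (\<lambda>i\<in>{..<N}. F (x i \<oplus> \<Delta> / real N * (\<Sum>j<N. h (x i) (x j))))"

lemma particle_step_measurable:
  assumes [measurable]: "F \<in> borel \<rightarrow>\<^sub>M borel"
  shows "particle_step F N \<in> torus_borel N \<rightarrow>\<^sub>M torus_borel N"
  unfolding particle_step_def[abs_def] by measurable

text \<open>The coordinatewise map \<open>mf_map\<close> sends the current product law to the next
  one, and the particle step is this map after \<open>torus_shift\<close>. Test functions are
  therefore pulled back along \<open>mf_map\<close> before \<open>transport_ineq\<close> is
  applied.\<close>

lemma rel_entropy_particle_step: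
  assumes F [measurable]: "F \<in> borel \<rightarrow>\<^sub>M borel" and N: "1 \<le> N"
    and r: "prob_space r" "sets r = sets (torus_borel N)"
  shows "rel_entropy (distr r (torus_borel N) (particle_step F N))
      (Pi\<^sub>M {..<N} (\<lambda>_. distr \<mu> borel (mf_map F h \<Delta> \<mu>)))
    \<le> ereal (1 + 1 / \<gamma>) * rel_entropy r (Pi\<^sub>M {..<N} (\<lambda>_. \<mu>)) + ereal (1 + ln 2 / \<gamma>)"
proof -
  obtain w where "mean_field_particles h \<rho> M \<kappa> K \<Delta> N w"
    using particle_coordinates_exist[OF N] .
  then interpret mean_field_particles h \<rho> M \<kappa> K \<Delta> N w .
  define \<nu> where "\<nu> = distr \<mu> borel (mf_map F h \<Delta> \<mu>)"
  define P where "P = Pi\<^sub>M {..<N} (\<lambda>_. \<mu>)"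
  define Q where "Q = Pi\<^sub>M {..<N} (\<lambda>_. \<nu>)"
  have shift: "mf_shift h \<Delta> \<mu> = (\<lambda>x. x \<oplus> \<Delta> * m x)"
    by (simp add: fun_eq_iff mf_shift_def m_def)
  have map_meas [measurable]: "mf_map F h \<Delta> \<mu> \<in> borel \<rightarrow>\<^sub>M borel"
    unfolding mf_map_def shift by measurable
  have \<nu>: "prob_space \<nu>" unfolding \<nu>_def by (rule \<mu>.prob_space_distr) simp
  have P: "prob_space P" unfolding P_def by (rule prob_space_power)
  interpret P: prob_space P by (rule P)
  have Q: "prob_space Q" unfolding Q_def by (intro prob_space_PiM \<nu>)
  interpret Q: prob_space Q by (rule Q)
  have sets_Q [measurable_cong, simp]: "sets Q = sets (torus_borel N)"
    unfolding Q_def by (intro sets_PiM_cong) (simp_all add: \<nu>_def)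
  have sets_P [measurable_cong, simp]: "sets P = sets (torus_borel N)"
    unfolding P_def by (rule sets_power)
  have Q_distr: "Q = distr P (torus_borel N) (compose {..<N} (mf_map F h \<Delta> \<mu>))"
  proof -
    have "distr P (Pi\<^sub>M {..<N} (\<lambda>_. \<nu>)) (compose {..<N} (mf_map F h \<Delta> \<mu>)) = Pi\<^sub>M {..<N} (\<lambda>_. distr \<mu> \<nu> (mf_map F h \<Delta> \<mu>))"
      unfolding P_def by (rule distr_PiM_finite_prob_space') (use \<nu> in \<open>auto simp: \<mu>.prob_space_axioms \<nu>_def\<close>)
    moreover have "distr \<mu> \<nu> (mf_map F h \<Delta> \<mu>) = \<nu>"
      unfolding \<nu>_def by (intro distr_cong) auto
    moreover have "distr P (Pi\<^sub>M {..<N} (\<lambda>_. \<nu>)) (compose {..<N} (mf_map F h \<Delta> \<mu>))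
        = distr P (torus_borel N) (compose {..<N} (mf_map F h \<Delta> \<mu>))"
      by (intro distr_cong sets_PiM_cong) (auto simp: \<nu>_def)
    ultimately show ?thesis by (simp add: Q_def)
  qed
  have comp_meas [measurable]: "compose {..<N} (mf_map F h \<Delta> \<mu>) \<in> torus_borel N \<rightarrow>\<^sub>M torus_borel N"
    unfolding compose_def by measurable
  note [measurable] = particle_step_measurable[OF F]
  have step_eq: "particle_step F N x = compose {..<N} (mf_map F h \<Delta> \<mu>) (torus_shift N x (\<lambda>i. w i x))"
    if "x \<in> extensional {..<N}" for x
    using that w_eq by (auto simp: fun_eq_iff particle_step_def compose_def mf_map_def shift torus_shift_def)
  have sets_r: "sets r = sets P" using r by simp
  obtain B where B: "\<bar>cost x\<bar> \<le> B" for x using cost_bounded by blast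
  have "rel_entropy (distr r Q (particle_step F N)) Q
      \<le> ereal (1 + 1 / \<gamma>) * rel_entropy r P + ereal (ln (2 * exp \<gamma>) / \<gamma>)"
  proof (rule rel_entropy_distr_le[OF r(1) P Q sets_r _ _ B \<gamma>_pos])
    fix g D assume g: "g \<in> borel_measurable Q" and D: "\<And>x. \<bar>g x\<bar> \<le> (D::real)"
    from g have [measurable]: "g \<in> borel_measurable (torus_borel N)" by simp
    have bd: "g (particle_step F N x) - cost x \<le> D + B" "g y \<le> D" for x y
      using D[of "particle_step F N x"] D[of y] B[of x] by (auto simp: abs_le_iff)
    have int1: "integrable P (\<lambda>x. exp (g (particle_step F N x) - cost x))"
      by (rule P.integrable_const_bound[where B = "exp (D + B)"]) (use bd in auto)
    have int2: "integrable Q (\<lambda>y. exp (g y))"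
      by (rule Q.integrable_const_bound[where B = "exp D"]) (use bd in auto)
    define G where "G x = ennreal (exp (g (compose {..<N} (mf_map F h \<Delta> \<mu>) x)))" for x
    have [measurable]: "G \<in> borel_measurable (torus_borel N)" unfolding G_def by measurable
    have "ennreal (\<integral>x. exp (g (particle_step F N x) - cost x) \<partial>P)
      = (\<integral>\<^sup>+x. ennreal (exp (g (particle_step F N x) - cost x)) \<partial>P)"
      using int1 by (simp add: nn_integral_eq_integral)
    also have "\<dots> = (\<integral>\<^sup>+x. ennreal (exp (- cost x)) * G (torus_shift N x (\<lambda>i. w i x)) \<partial>P)"
    proof (rule nn_integral_cong)
      fix x assume "x \<in> space P"
      then have "x \<in> extensional {..<N}" by (simp add: P_def space_PiM PiE_def)
      then show "ennreal (exp (g (particle_step F N x) - cost x)) = ennreal (exp (- cost x)) * G (torus_shift N x (\<lambda>i. w i x))"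
        by (simp add: step_eq G_def ennreal_mult[symmetric] exp_add[symmetric])
    qed
    also have "\<dots> \<le> (\<integral>\<^sup>+x. G x \<partial>P)"
      unfolding P_def by (rule transport_ineq) simp
    also have "\<dots> = (\<integral>\<^sup>+y. ennreal (exp (g y)) \<partial>Q)"
      unfolding Q_distr by (subst nn_integral_distr) (auto simp: G_def[abs_def])
    also have "\<dots> = ennreal (\<integral>y. exp (g y) \<partial>Q)"
      using int2 by (simp add: nn_integral_eq_integral)
    finally show "(\<integral>x. exp (g (particle_step F N x) - cost x) \<partial>P) \<le> (\<integral>y. exp (g y) \<partial>Q)"
      by (simp add: ennreal_le_iff integral_nonneg_AE)
  next
    have "\<bar>\<gamma> * cost x\<bar> \<le> \<gamma> * B" for x using B[of x] \<gamma>_pos by (simp add: abs_mult)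
    then have "\<gamma> * cost x \<le> \<gamma> * B" for x by (meson abs_le_D1)
    then have int: "integrable P (\<lambda>x. exp (\<gamma> * cost x))"
      by (intro P.integrable_const_bound[where B = "exp (\<gamma> * B)"]) auto
    have "0 < 17 + 4 * (P1 + P2)" "0 < Ca\<^sup>2 + 1" using P_nonneg by (auto intro: add_nonneg_pos)
    then have "8 * \<gamma> * (17 + 4 * (P1 + P2)) * (Ca\<^sup>2 + 1) \<le> 1"
      by (simp add: \<gamma>_def)
    then have "(\<integral>\<^sup>+x. ennreal (exp (\<gamma> * cost x)) \<partial>P) \<le> ennreal (2 * exp \<gamma>)"
      unfolding P_def by (rule cost_exp_moment[OF \<gamma>_pos])
    then show "(\<integral>x. exp (\<gamma> * cost x) \<partial>P) \<le> 2 * exp \<gamma>"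
      using int by (simp add: nn_integral_eq_integral)
  qed simp_all
  moreover have "distr r Q (particle_step F N) = distr r (torus_borel N) (particle_step F N)"
    by (intro distr_cong) auto
  moreover have "ln (2 * exp \<gamma>) / \<gamma> = 1 + ln 2 / \<gamma>"
    using \<gamma>_pos by (simp add: ln_mult add_divide_distrib)
  ultimately show ?thesis by (simp add: P_def Q_def \<nu>_def)
qed

end


section \<open>Iteration in time\<close>

theorem theorem1p3:
  fixes M \<kappa> K :: real
  assumes "\<kappa> > 0" and "K > 0"
  shows "\<exists>\<Delta>\<^sub>0>0. \<exists>C>0. \<forall>(T::nat) (F :: circle \<Rightarrow> circle) (h :: circle \<Rightarrow> circle \<Rightarrow> real)
      (\<Delta>::real) (\<rho> :: nat \<Rightarrow> circle \<Rightarrow> real) (N::nat) (\<rho>\<^sub>0 :: (nat \<Rightarrow> circle) measure).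
    continuous_on UNIV F \<longrightarrow>
    C_diff 3 (lift2 h) \<longrightarrow> C_norm 3 (lift2 h) = M \<longrightarrow>
    0 < \<Delta> \<longrightarrow> \<Delta> < \<Delta>\<^sub>0 \<longrightarrow>
    (\<forall>t\<le>T. C_diff 2 (lift1 (\<rho> t)) \<and> prob_space (measure_of_density (\<rho> t)) \<and>
            (\<forall>x. \<rho> t x \<ge> \<kappa>) \<and> C_norm 2 (lift1 (\<rho> t)) \<le> K) \<longrightarrow>
    (\<forall>t<T. measure_of_density (\<rho> (Suc t)) =
            distr (measure_of_density (\<rho> t)) borel (mf_map F h \<Delta> (measure_of_density (\<rho> t)))) \<longrightarrow>
    N \<ge> 1 \<longrightarrow>
    prob_space \<rho>\<^sub>0 \<longrightarrow> sets \<rho>\<^sub>0 = sets (torus_borel N) \<longrightarrow>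
    (\<forall>t\<le>T.
       scaled_entropy N (particle_law F h \<Delta> N \<rho>\<^sub>0 t) (measure_of_density (\<rho> t)) \<le>
       ereal (exp (C * real t)) *
         (scaled_entropy N (particle_law F h \<Delta> N \<rho>\<^sub>0 0) (measure_of_density (\<rho> 0))
          + ereal (1 / real N)))"
proof -
  \<comment> \<open>The norm \<open>M\<close> may lie below 1, whereas \<open>mean_field\<close>
    asks for a bound of at least 1.\<close>
  define M' where "M' = max M 1"
  define g where "g = mean_field.\<gamma> M' \<kappa> K"
  define c1 c2 where "c1 = 1 + 1 / g" and "c2 = 1 + ln 2 / g"
  \<comment> \<open>\<open>D\<close> dominates \<open>c1\<close> and \<open>c2 + 1\<close>, so
    \<open>c1 * r + c2 + 1 \<le> D * (r + 1)\<close> for \<open>r \<ge> 0\<close>: entropy plus one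
    grows at most by the factor \<open>D = exp C\<close> per step.\<close>
  define D where "D = 2 + \<bar>c1\<bar> + \<bar>c2\<bar>"
  have D: "1 < D" "c1 \<le> D" "c2 + 1 \<le> D" by (auto simp: D_def)
  define C where "C = ln D"
  have C: "0 < C" and exp_C: "exp (C * real t) = D ^ t" for t
    using D by (auto simp: C_def exp_of_nat2_mult)
  \<comment> \<open>The witness for \<open>\<Delta>\<^sub>0\<close>; it enforces
    \<open>\<Delta> * M' \<le> 1 / 64\<close>.\<close>
  have "0 < 1 / (64 * M')" by (simp add: M'_def)
  moreover note C
  moreover have "scaled_entropy N (particle_law F h \<Delta> N \<rho>\<^sub>0 t) (measure_of_density (\<rho> t)) \<le>
       ereal (exp (C * real t)) *
         (scaled_entropy N (particle_law F h \<Delta> N \<rho>\<^sub>0 0) (measure_of_density (\<rho> 0)) + ereal (1 / real N))"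
    if F: "continuous_on UNIV F" and h: "C_diff 3 (lift2 h)" "C_norm 3 (lift2 h) = M"
      and \<Delta>: "0 < \<Delta>" "\<Delta> < 1 / (64 * M')"
      and \<rho>: "\<forall>t\<le>T. C_diff 2 (lift1 (\<rho> t)) \<and> prob_space (measure_of_density (\<rho> t)) \<and>
            (\<forall>x. \<rho> t x \<ge> \<kappa>) \<and> C_norm 2 (lift1 (\<rho> t)) \<le> K"
      and evol: "\<forall>t<T. measure_of_density (\<rho> (Suc t)) =
            distr (measure_of_density (\<rho> t)) borel (mf_map F h \<Delta> (measure_of_density (\<rho> t)))"
      and N: "N \<ge> 1" and \<rho>\<^sub>0: "prob_space \<rho>\<^sub>0" "sets \<rho>\<^sub>0 = sets (torus_borel N)" and t: "t \<le> T"
    for T F h \<Delta> \<rho> N \<rho>\<^sub>0 t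
  proof -
    have F_meas [measurable]: "F \<in> borel \<rightarrow>\<^sub>M borel" by (rule borel_measurable_continuous_onI[OF F])
    have mf: "mean_field h (\<rho> s) M' \<kappa> K \<Delta>" if "s \<le> T" for s
    proof (rule mean_field.intro)
      show "\<Delta> * M' \<le> 1 / 64" using \<Delta> by (simp add: M'_def field_simps)
      show "torus_Ck 3 M' h" unfolding torus_Ck_def using h by (simp only: M'_def max.cobounded1 simp_thms)
      show "circle_Ck 2 K (\<rho> s)" unfolding circle_Ck_def using \<rho> that by blast
      show "\<kappa> \<le> \<rho> s x" for x using \<rho> that by blast
      show "prob_space (measure_of_density (\<rho> s))" using \<rho> that by blast
      show "1 \<le> M'" by (simp add: M'_def)
    qed (fact assms(1) \<Delta>(1))+
    define law where "law s = particle_law F h \<Delta> N \<rho>\<^sub>0 s" for s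
    define R where "R s = rel_entropy (law s) (Pi\<^sub>M {..<N} (\<lambda>_. measure_of_density (\<rho> s)))" for s
    define H where "H s = scaled_entropy N (law s) (measure_of_density (\<rho> s))" for s
    have H: "H s = ereal (1 / real N) * R s" for s by (simp add: H_def R_def scaled_entropy_def)
    have particles_Suc: "particles F h \<Delta> N (Suc s) = mean_field.particle_step h \<Delta> F N \<circ> particles F h \<Delta> N s" for s
      by (simp add: fun_eq_iff Let_def mean_field.particle_step_def[OF mf[of 0]])
    have step_meas: "mean_field.particle_step h \<Delta> F N \<in> torus_borel N \<rightarrow>\<^sub>M torus_borel N"
      by (rule mean_field.particle_step_measurable[OF mf[of 0] F_meas]) simp
    have part_meas: "particles F h \<Delta> N s \<in> \<rho>\<^sub>0 \<rightarrow>\<^sub>M torus_borel N" for s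
    proof (induction s)
      case 0
      have "particles F h \<Delta> N 0 = (\<lambda>x. x)" by (simp add: fun_eq_iff)
      then show ?case by (simp add: measurable_ident_sets \<rho>\<^sub>0)
    next
      case (Suc s)
      then show ?case unfolding particles_Suc using step_meas by (rule measurable_comp)
    qed
    have law: "prob_space (law s)" "sets (law s) = sets (torus_borel N)" for s
      using prob_space.prob_space_distr[OF \<rho>\<^sub>0(1) part_meas] by (simp_all add: law_def particle_law_def)
    have law_Suc: "law (Suc s) = distr (law s) (torus_borel N) (mean_field.particle_step h \<Delta> F N)" for s
      unfolding law_def particle_law_def particles_Suc
      by (rule distr_distr[OF step_meas part_meas, symmetric])
    have sets_prod: "sets (Pi\<^sub>M {..<N} (\<lambda>_. measure_of_density (\<rho> s))) = sets (torus_borel N)" for s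
      by (intro sets_PiM_cong) (simp_all add: measure_of_density_def)
    have R_nonneg: "0 \<le> R s" if "s \<le> T" for s
      unfolding R_def
      by (rule rel_entropy_nonneg) (use law sets_prod \<rho> that in \<open>auto intro: prob_space_PiM\<close>)
    have R_Suc: "R (Suc s) \<le> ereal c1 * R s + ereal c2" if s: "s < T" for s
    proof -
      interpret mean_field h "\<rho> s" M' \<kappa> K \<Delta> by (rule mf) (use s in simp)
      show ?thesis
        using rel_entropy_particle_step[OF F_meas N law, of s] evol s
        by (simp add: R_def law_Suc \<mu>_def c1_def c2_def g_def)
    qed
    have c1: "0 \<le> c1"
      using mean_field.\<gamma>_pos[OF mf[of 0]] by (simp add: c1_def g_def)
    show ?thesis
    proof (cases "R 0 = \<infinity>")
      case True
      have "0 < 1 / real N" using N by simp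
      with True D have "ereal (exp (C * real t)) * (H 0 + ereal (1 / real N)) = \<infinity>"
        by (simp add: H)
      then show ?thesis unfolding H_def law_def by simp
    next
      case False
      then obtain r0 where r0: "R 0 = ereal r0" "0 \<le> r0"
        using R_nonneg[of 0] by (cases "R 0") auto
      \<comment> \<open>The induction runs on the unscaled entropy plus one; the division by
        \<open>N\<close> at the end produces the summand \<open>1 / N\<close>.\<close>
      have "\<exists>r\<ge>0. R s = ereal r \<and> r + 1 \<le> D ^ s * (r0 + 1)" if "s \<le> T" for s
        using that
      proof (induction s)
        case 0
        then show ?case using r0 by auto
      next
        case (Suc s)
        then obtain r where r: "0 \<le> r" "R s = ereal r" "r + 1 \<le> D ^ s * (r0 + 1)" by auto
        have "R (Suc s) \<le> ereal (c1 * r + c2)"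
          using R_Suc[of s] Suc.prems r by simp
        then obtain r' where r': "R (Suc s) = ereal r'" "0 \<le> r'" "r' \<le> c1 * r + c2"
          using R_nonneg[OF Suc.prems] by (cases "R (Suc s)") auto
        have "r' + 1 \<le> D * r + D"
          using r'(3) D mult_right_mono[OF D(2) r(1)] by linarith
        also have "\<dots> = D * (r + 1)" by (simp add: distrib_left)
        also have "\<dots> \<le> D * (D ^ s * (r0 + 1))" using r(3) D by (intro mult_left_mono) auto
        finally show ?case using r' by (auto simp: mult.assoc)
      qed
      from this[OF t] obtain r where r: "R t = ereal r" "r + 1 \<le> D ^ t * (r0 + 1)" by auto
      have "r / real N \<le> D ^ t * (r0 + 1) / real N"
        using r(2) by (intro divide_right_mono) auto
      then have "H t \<le> ereal (exp (C * real t)) * (H 0 + ereal (1 / real N))"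
        by (simp add: H r r0 exp_C add_divide_distrib[symmetric])
      then show ?thesis by (simp add: H_def law_def)
    qed
  qed
  ultimately show ?thesis by blast
qed

end
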